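(* Let $f:S^n\to S^m$ be an LOMSE of $(n,p,k)$-type, and let $M_{f,\theta}$ and $C_{f,\theta}$ be the corresponding Lawson-Osserman sphere and Lawson-Osserman cone. Let $Q_0=\{x_1=\dots=x_{n+1}=0\}\subset\mathbb R^{n+m+2}$. Then: (A) All normal planes of $M_{f,\theta}$ in $S^{n+m+1}$ make a constant acute angle $\alpha_{n,p,k}$ with $Q_0$, where $$\cos\alpha_{n,p,k}=\sqrt{\frac{1-\frac pn}{1-\frac{p}{k(k+n-1)}}}\cdot\left(\frac{n-p}{k(k+n-1)-p}\right)^{p/2}.$$ (B) The volume of $M_{f,\theta}$ is $$V_{n,p,k}=\left(\frac{k(k+n-1)}{n}\right)^{p/2}\left(\frac{1-\frac pn}{1-\frac p{k(k+n-1)}}\right)^{\frac{n-p}2}\omega_n,$$ where $\omega_n$ is the volume of the $n$-dimensional unit Euclidean sphere. (C) $C_{f,\theta}$ is an entire minimal graph with constant Jordan angles relative to $Q_0$. The tangent Jordan angles of $C_{f,\theta}$ are $$\arccos\sqrt{\frac{n-p}{k(k+n-1)-p}},\qquad \arccos\sqrt{\frac{1-\frac pn}{1-\frac p{k(k+n-1)}}},\qquad 0,$$ of multiplicities $p$, $1$, $n-p$ respectively. The slope function of $C_{f,\theta}$ is identically equal to $W_{n,p,k}:=\sec\alpha_{n,p,k}$.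
   Context: $S^d\subset\mathbb R^{d+1}$ is the unit sphere with its canonical metric $g_d$. For a smooth map $f:S^n\to S^m$ and $\theta\in(0,\pi/2)$ put $M_{f,\theta}=\{(\cos\theta\cdot x,\ \sin\theta\cdot f(x)):x\in S^n\}\subset S^{n+m+1}\subset\mathbb R^{n+1}\times\mathbb R^{m+1}$. The map $f$ is a Lawson-Osserman map (LOM) if there is some $\theta\in(0,\pi/2)$ such that $M_{f,\theta}$ is a minimal submanifold of $S^{n+m+1}$; then $M_{f,\theta}$ is the associated Lawson-Osserman sphere and the cone $C_{f,\theta}$ over $M_{f,\theta}$ (with vertex the origin of $\mathbb R^{n+m+2}$) is the associated Lawson-Osserman cone; it is the graph of $F_{f,\theta}(y)=\tan\theta\,|y|f(y/|y|)$ for $y\ne0$, $F_{f,\theta}(0)=0$, on $\mathbb R^{n+1}$. An LOMSE is an LOM which is not a totally geodesic isometric embedding and such that for each $x\in S^n$ all nonzero singular values of $(f_* )_x:(T_xS^n,g_n)\to(T_{f(x)}S^m,g_m)$ are equal. It is a fact that for an LOMSE the common nonzero singular value $\lambda$ and its multiplicity $p$ are constant on $S^n$, that there is an integer $k\ge2$ such that all components of $f$ are spherical harmonics of degree $k$ on $S^n$, that $\lambda^2=k(k+n-1)/p$, and that the angle $\theta$ is uniquely determined, $\cos^2\theta=\frac{1-p/n}{1-p/(k(k+n-1))}$; such $f$ is said to be of $(n,p,k)$-type. Angle between two oriented $(m+1)$-planes $N,Q$ in $\mathbb R^{n+m+2}$: the angle $\alpha\in[0,\pi]$ with $\cos\alpha=\langle\nu_1\wedge\dots\wedge\nu_{m+1},q_1\wedge\dots\wedge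 q_{m+1}\rangle$ for oriented orthonormal bases $(\nu_i)$ of $N$ and $(q_i)$ of $Q$; in (A) the normal bundle of $M_{f,\theta}$ in $S^{n+m+1}$ (of rank $m+1$) is given the orientation (suitably chosen) for which this is acute. Jordan angles between planes $P$ and $Q$ of the same dimension: the critical values of the angle between nonzero $u\in P$ and its orthogonal projection to $Q$ (equivalently, arccosines of the singular values of the orthogonal projection $P\to Q$, counted with multiplicity). The tangent Jordan angles of $C_{f,\theta}$ (at a point other than the vertex) are the Jordan angles between the tangent space and $Q_0^\perp=\mathbb R^{n+1}\times\{0\}$; "constant Jordan angles relative to $Q_0$" means the Jordan angles between all normal planes and $Q_0$ are constant. The slope function $W$ is the product of the secants of the tangent Jordan angles; for the graph of $F$ it equals $\sqrt{\det(I+(dF)^{T}dF)}$. "Entire minimal graph" for the cone is meant for a Lipschitz function on all of $\mathbb R^{n+1}$, smooth away from $0$, satisfying the minimal surface equations weakly. *)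

theory Defs
  imports "HOL-Analysis.Analysis" "HOL-Library.Multiset"
begin

section \<open>Smooth maps\<close>

text \<open>Only meant for open sets: \<open>C\<^sup>r\<^sup>+\<^sup>1\<close> means differentiable with all directional derivatives
  \<open>C\<^sup>r\<close>.\<close>

primrec Ck_on :: "nat \<Rightarrow> 'e::euclidean_space set \<Rightarrow> ('e \<Rightarrow> 'f::real_normed_vector) \<Rightarrow> bool" where
  "Ck_on 0 U f \<longleftrightarrow> continuous_on U f"
| "Ck_on (Suc r) U f \<longleftrightarrow> f differentiable_on U \<and>
     (\<forall>v. Ck_on r U (\<lambda>x. frechet_derivative f (at x) v))"

definition smooth_on :: "'e::euclidean_space set \<Rightarrow> ('e \<Rightarrow> 'f::real_normed_vector) \<Rightarrow> bool" where
  "smooth_on U f \<longleftrightarrow> (\<forall>r. Ck_on r U f)"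


section \<open>Linear algebra: determinants, singular values, Jordan angles\<close>

text \<open>Leibniz determinant of a matrix whose rows and columns are indexed by a finite set.\<close>

definition det_on :: "'i set \<Rightarrow> ('i \<Rightarrow> 'i \<Rightarrow> real) \<Rightarrow> real" where
  "det_on I A = (\<Sum>\<pi> | \<pi> permutes I. of_int (sign \<pi>) * (\<Prod>i\<in>I. A i (\<pi> i)))"

definition orthonormal_basis :: "'e::euclidean_space set \<Rightarrow> 'e set \<Rightarrow> bool" where
  "orthonormal_basis B V \<longleftrightarrow> pairwise orthogonal B \<and> (\<forall>b\<in>B. norm b = 1) \<and> span B = V"

text \<open>Ordered orthonormal bases \<open>\<nu> 0, \<dots>, \<nu> (r - 1)\<close>; the values \<open>\<nu> i\<close> for \<open>i \<ge> r\<close> are irrelevant.\<close>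

definition orthonormal_frame :: "nat \<Rightarrow> (nat \<Rightarrow> 'e::euclidean_space) \<Rightarrow> 'e set \<Rightarrow> bool" where
  "orthonormal_frame r \<nu> V \<longleftrightarrow>
     (\<forall>i<r. \<forall>j<r. \<nu> i \<bullet> \<nu> j = (if i = j then 1 else 0)) \<and> span (\<nu> ` {..<r}) = V"

text \<open>The inner product of the simple \<open>r\<close>-vectors \<open>\<nu>\<^sub>0 \<and> \<dots> \<and> \<nu>\<^sub>r\<^sub>-\<^sub>1\<close> and \<open>e\<^sub>0 \<and> \<dots> \<and> e\<^sub>r\<^sub>-\<^sub>1\<close>.\<close>

definition wedge_inner ::
    "nat \<Rightarrow> (nat \<Rightarrow> 'e::euclidean_space) \<Rightarrow> (nat \<Rightarrow> 'e) \<Rightarrow> real" where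
  "wedge_inner r \<nu> e = det_on {..<r} (\<lambda>i j. \<nu> i \<bullet> e j)"

text \<open>Angle between two oriented \<open>r\<close>-planes given by oriented orthonormal bases.\<close>

definition oriented_angle ::
    "nat \<Rightarrow> (nat \<Rightarrow> 'e::euclidean_space) \<Rightarrow> (nat \<Rightarrow> 'e) \<Rightarrow> real" where
  "oriented_angle r \<nu> e = arccos (wedge_inner r \<nu> e)"

definition orth_proj :: "'e::euclidean_space set \<Rightarrow> 'e \<Rightarrow> 'e" where
  "orth_proj S x = (THE y. y \<in> S \<and> (\<forall>s\<in>S. orthogonal (x - y) s))"

text \<open>For \<open>A\<close> linear on the subspace \<open>V\<close>, this is the eigenspace of \<open>A\<^sup>*A : V \<rightarrow> V\<close> for the
  eigenvalue \<open>s\<^sup>2\<close>.\<close>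

definition singular_space ::
    "('e::euclidean_space \<Rightarrow> 'f::euclidean_space) \<Rightarrow> 'e set \<Rightarrow> real \<Rightarrow> 'e set" where
  "singular_space A V s = {v\<in>V. \<forall>w\<in>V. A v \<bullet> A w = s\<^sup>2 * (v \<bullet> w)}"

text \<open>Singular values of \<open>A\<close> on \<open>V\<close>, with multiplicities summing up to the dimension of \<open>V\<close>.\<close>

definition singular_values ::
    "('e::euclidean_space \<Rightarrow> 'f::euclidean_space) \<Rightarrow> 'e set \<Rightarrow> real multiset" where
  "singular_values A V =
     (\<Sum>s | 0 \<le> s \<and> singular_space A V s \<noteq> {0}. replicate_mset (dim (singular_space A V s)) s)"

definition jordan_angles :: "'e::euclidean_space set \<Rightarrow> 'e set \<Rightarrow> real multiset" where
  "jordan_angles P Q = image_mset arccos (singular_values (orth_proj Q) P)"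


section \<open>Submanifolds of Euclidean space\<close>

definition smooth_submanifold :: "nat \<Rightarrow> 'e::euclidean_space set \<Rightarrow> bool" where
  "smooth_submanifold d M \<longleftrightarrow>
     (\<forall>q\<in>M. \<exists>V W \<Phi> \<Psi> (L :: 'e set). open V \<and> q \<in> V \<and> open W \<and> homeomorphism V W \<Phi> \<Psi> \<and>
        smooth_on V \<Phi> \<and> smooth_on W \<Psi> \<and> subspace L \<and> dim L = d \<and> \<Phi> ` (M \<inter> V) = L \<inter> W)"

definition curve_at :: "'e::euclidean_space set \<Rightarrow> 'e \<Rightarrow> (real \<Rightarrow> 'e) \<Rightarrow> bool" where
  "curve_at M q \<gamma> \<longleftrightarrow>
     \<gamma> 0 = q \<and> (\<exists>\<epsilon>>0. smooth_on {-\<epsilon><..<\<epsilon>} \<gamma> \<and> \<gamma> ` {-\<epsilon><..<\<epsilon>} \<subseteq> M)"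

definition velocity :: "(real \<Rightarrow> 'e::euclidean_space) \<Rightarrow> 'e" where
  "velocity \<gamma> = vector_derivative \<gamma> (at 0)"

definition acceleration :: "(real \<Rightarrow> 'e::euclidean_space) \<Rightarrow> 'e" where
  "acceleration \<gamma> = vector_derivative (\<lambda>t. vector_derivative \<gamma> (at t)) (at 0)"

definition tangent_space :: "'e::euclidean_space set \<Rightarrow> 'e \<Rightarrow> 'e set" where
  "tangent_space M q = velocity ` {\<gamma>. curve_at M q \<gamma>}"

definition normal_plane :: "'e::euclidean_space set \<Rightarrow> 'e \<Rightarrow> 'e set" where
  "normal_plane M q = {\<nu>. \<forall>t\<in>tangent_space M q. orthogonal \<nu> t}"

text \<open>The normal plane at \<open>q\<close> of a submanifold \<open>M\<close> of the unit sphere, inside that sphere.\<close>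

definition sphere_normal_plane :: "'e::euclidean_space set \<Rightarrow> 'e \<Rightarrow> 'e set" where
  "sphere_normal_plane M q = {\<nu>\<in>normal_plane M q. orthogonal \<nu> q}"

text \<open>The second fundamental form \<open>II(v,v)\<close> of \<open>M\<close> in the unit sphere: the component of the
  acceleration of a curve in \<open>M\<close> with velocity \<open>v\<close> that is normal to \<open>M\<close> and tangent to the sphere.
  By Meusnier's theorem it only depends on \<open>v\<close>.\<close>

definition second_fundamental_form :: "'e::euclidean_space set \<Rightarrow> 'e \<Rightarrow> 'e \<Rightarrow> 'e" where
  "second_fundamental_form M q v =
     (THE h. \<exists>\<gamma>. curve_at M q \<gamma> \<and> velocity \<gamma> = v \<and>
        h = orth_proj (sphere_normal_plane M q) (acceleration \<gamma>))"

text \<open>Minimality is vanishing of the mean curvature vector, the trace of the second fundamental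
  form.\<close>

definition minimal_in_sphere :: "nat \<Rightarrow> 'e::euclidean_space set \<Rightarrow> bool" where
  "minimal_in_sphere d M \<longleftrightarrow> smooth_submanifold d M \<and> M \<subseteq> sphere 0 1 \<and>
     (\<forall>q\<in>M. \<forall>B. orthonormal_basis B (tangent_space M q) \<longrightarrow>
        (\<Sum>v\<in>B. second_fundamental_form M q v) = 0)"

text \<open>An orientation of a continuous family \<open>N\<close> of \<open>r\<close>-planes over \<open>M\<close>. It is represented by an
  oriented orthonormal basis \<open>\<nu> q\<close> of each \<open>N q\<close>; not the bases but only the orientations they
  define have to vary continuously, which is the second condition.\<close>

definition orientation_of ::
    "nat \<Rightarrow> 'e::euclidean_space set \<Rightarrow> ('e \<Rightarrow> 'e set) \<Rightarrow> ('e \<Rightarrow> nat \<Rightarrow> 'e) \<Rightarrow> bool" where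
  "orientation_of r M N \<nu> \<longleftrightarrow> (\<forall>q\<in>M. orthonormal_frame r (\<nu> q) (N q)) \<and>
     (\<forall>q\<in>M. \<forall>\<^sub>F q' in at q within M. wedge_inner r (\<nu> q) (\<nu> q') > 0)"

text \<open>Lebesgue measure on the coordinate subspace spanned by \<open>D \<subseteq> Basis\<close> (compare the definition
  of \<open>lborel\<close>).\<close>

definition lborel_span :: "'e::euclidean_space set \<Rightarrow> 'e measure" where
  "lborel_span D = distr (\<Pi>\<^sub>M b\<in>D. lborel) borel (\<lambda>g. \<Sum>b\<in>D. g b *\<^sub>R b)"

text \<open>A local parametrization \<open>\<phi>\<close> of \<open>M\<close> has the coordinate subspace \<open>span D \<cong> \<real>\<^sup>d\<close> as parameter
  domain; this avoids a type of dimension \<open>d\<close>. Its Jacobian is the square root of the determinant of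
  the first fundamental form.\<close>

definition param_jacobian ::
    "'e::euclidean_space set \<Rightarrow> ('e \<Rightarrow> 'e) \<Rightarrow> 'e \<Rightarrow> real" where
  "param_jacobian D \<phi> y =
     sqrt (det_on D (\<lambda>b c. frechet_derivative \<phi> (at y) b \<bullet> frechet_derivative \<phi> (at y) c))"

text \<open>The \<open>d\<close>-dimensional Riemannian volume of a submanifold \<open>M\<close>: the supremum of the areas of
  compact parametrized pieces. A single (not necessarily connected) parameter domain suffices, since
  finitely many disjoint pieces can be parametrized over disjoint translates.\<close>

definition riemannian_volume :: "nat \<Rightarrow> 'e::euclidean_space set \<Rightarrow> ennreal" where
  "riemannian_volume d M = Sup {\<integral>\<^sup>+ y\<in>K. ennreal (param_jacobian D \<phi> y) \<partial>lborel_span D | D U K \<phi>.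
     D \<subseteq> Basis \<and> card D = d \<and> open U \<and> smooth_on U \<phi> \<and> \<phi> ` (U \<inter> span D) \<subseteq> M \<and>
     compact K \<and> K \<subseteq> U \<inter> span D \<and> inj_on \<phi> K}"


section \<open>Entire minimal graphs\<close>

definition graph_metric :: "(real^'a \<Rightarrow> real^'b) \<Rightarrow> real^'a \<Rightarrow> real^'a^'a" where
  "graph_metric F y = mat 1 + transpose (jacobian F (at y)) ** jacobian F (at y)"

definition graph_area_density :: "(real^'a \<Rightarrow> real^'b) \<Rightarrow> real^'a \<Rightarrow> real" where
  "graph_area_density F y = sqrt (det (graph_metric F y))"

definition test_function :: "(real^'a \<Rightarrow> real) \<Rightarrow> bool" where
  "test_function \<phi> \<longleftrightarrow> smooth_on UNIV \<phi> \<and> compact (closure {y. \<phi> y \<noteq> 0})"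

definition partial_deriv :: "'a::finite \<Rightarrow> (real^'a \<Rightarrow> real) \<Rightarrow> real^'a \<Rightarrow> real" where
  "partial_deriv i \<phi> y = frechet_derivative \<phi> (at y) (axis i 1)"

text \<open>Weak form of the minimal surface system
  \<open>\<Sum>\<^sub>i \<partial>\<^sub>i (\<surd>g g\<^sup>i\<^sup>j) = 0\<close> and \<open>\<Sum>\<^sub>i\<^sub>j \<partial>\<^sub>i (\<surd>g g\<^sup>i\<^sup>j \<partial>\<^sub>j F\<^sup>\<beta>) = 0\<close>.\<close>

definition weak_minimal_surface_system :: "(real^'a \<Rightarrow> real^'b) \<Rightarrow> bool" where
  "weak_minimal_surface_system F \<longleftrightarrow> (\<forall>\<phi>. test_function \<phi> \<longrightarrow>
     (\<forall>j. has_bochner_integral lborel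
        (\<lambda>y. \<Sum>i\<in>UNIV. graph_area_density F y * matrix_inv (graph_metric F y) $ i $ j
               * partial_deriv i \<phi> y) 0) \<and>
     (\<forall>\<beta>. has_bochner_integral lborel
        (\<lambda>y. \<Sum>i\<in>UNIV. \<Sum>j\<in>UNIV. graph_area_density F y * matrix_inv (graph_metric F y) $ i $ j
               * jacobian F (at y) $ \<beta> $ j * partial_deriv i \<phi> y) 0))"

definition entire_minimal_graph :: "((real^'a::finite) \<times> (real^'b::finite)) set \<Rightarrow> bool" where
  "entire_minimal_graph C \<longleftrightarrow> (\<exists>F :: real^'a \<Rightarrow> real^'b.
     C = range (\<lambda>y. (y, F y)) \<and> (\<exists>L. L-lipschitz_on UNIV F) \<and> smooth_on (- {0}) F \<and>
     weak_minimal_surface_system F)"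


section \<open>Maps between spheres\<close>

text \<open>A map \<open>f\<close> between unit spheres is a function on the ambient space of which only the values on
  the sphere matter. It is differentiated through its extension \<open>y \<mapsto> f (y / |y|)\<close>, the composition
  with a smooth retraction onto the sphere.\<close>

definition radial_ext :: "(real^'a \<Rightarrow> real^'b) \<Rightarrow> real^'a \<Rightarrow> real^'b" where
  "radial_ext f y = f (y /\<^sub>R norm y)"

definition smooth_sphere_map :: "(real^'a \<Rightarrow> real^'b) \<Rightarrow> bool" where
  "smooth_sphere_map f \<longleftrightarrow> f ` sphere 0 1 \<subseteq> sphere 0 1 \<and> smooth_on (- {0}) (radial_ext f)"

definition sphere_tangent :: "'e::euclidean_space \<Rightarrow> 'e set" where
  "sphere_tangent x = {v. orthogonal x v}"

text \<open>The differential \<open>(f\<^sub>*)\<^sub>x\<close>, to be applied to vectors in \<open>sphere_tangent x\<close> only.\<close>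

definition sphere_deriv :: "(real^'a \<Rightarrow> real^'b) \<Rightarrow> real^'a \<Rightarrow> real^'a \<Rightarrow> real^'b" where
  "sphere_deriv f x = frechet_derivative (radial_ext f) (at x)"

text \<open>An isometric embedding that takes unit speed great circles to unit speed great circles.\<close>

definition totally_geodesic_isometric_embedding :: "(real^'a \<Rightarrow> real^'b) \<Rightarrow> bool" where
  "totally_geodesic_isometric_embedding f \<longleftrightarrow> smooth_sphere_map f \<and> inj_on f (sphere 0 1) \<and>
     (\<forall>x\<in>sphere 0 1. \<forall>v\<in>sphere_tangent x. norm (sphere_deriv f x v) = norm v) \<and>
     (\<forall>x\<in>sphere 0 1. \<forall>v\<in>sphere_tangent x. norm v = 1 \<longrightarrow>
        (\<forall>t. f (cos t *\<^sub>R x + sin t *\<^sub>R v) = cos t *\<^sub>R f x + sin t *\<^sub>R sphere_deriv f x v))"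

definition laplacian :: "('e::euclidean_space \<Rightarrow> real) \<Rightarrow> 'e \<Rightarrow> real" where
  "laplacian h y =
     (\<Sum>b\<in>Basis. frechet_derivative (\<lambda>z. frechet_derivative h (at z) b) (at y) b)"

definition spherical_harmonic :: "nat \<Rightarrow> ('e::euclidean_space \<Rightarrow> real) \<Rightarrow> bool" where
  "spherical_harmonic k g \<longleftrightarrow> (\<exists>h. real_polynomial_function h \<and>
     (\<forall>c y. h (c *\<^sub>R y) = c ^ k * h y) \<and> (\<forall>y. laplacian h y = 0) \<and>
     (\<forall>x\<in>sphere 0 1. g x = h x))"


section \<open>Lawson-Osserman maps, spheres and cones\<close>

definition lo_sphere :: "(real^'a \<Rightarrow> real^'b) \<Rightarrow> real \<Rightarrow> ((real^'a) \<times> (real^'b)) set" where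
  "lo_sphere f \<theta> = (\<lambda>x. (cos \<theta> *\<^sub>R x, sin \<theta> *\<^sub>R f x)) ` sphere 0 1"

definition lo_cone :: "(real^'a \<Rightarrow> real^'b) \<Rightarrow> real \<Rightarrow> ((real^'a) \<times> (real^'b)) set" where
  "lo_cone f \<theta> = {t *\<^sub>R q | t q. 0 \<le> t \<and> q \<in> lo_sphere f \<theta>}"

text \<open>\<open>f\<close> is a Lawson-Osserman map with associated angle \<open>\<theta>\<close>; the sphere in \<open>real^'a\<close> has dimension
  \<open>CARD('a) - 1\<close>.\<close>

definition lo_angle :: "(real^'a::finite \<Rightarrow> real^'b) \<Rightarrow> real \<Rightarrow> bool" where
  "lo_angle f \<theta> \<longleftrightarrow> 0 < \<theta> \<and> \<theta> < pi / 2 \<and> minimal_in_sphere (CARD('a) - 1) (lo_sphere f \<theta>)"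

definition LOM :: "(real^'a \<Rightarrow> real^'b) \<Rightarrow> bool" where
  "LOM f \<longleftrightarrow> smooth_sphere_map f \<and> (\<exists>\<theta>. lo_angle f \<theta>)"

definition sphere_singular_values :: "(real^'a \<Rightarrow> real^'b) \<Rightarrow> real^'a \<Rightarrow> real multiset" where
  "sphere_singular_values f x = singular_values (sphere_deriv f x) (sphere_tangent x)"

definition LOMSE :: "(real^'a \<Rightarrow> real^'b) \<Rightarrow> bool" where
  "LOMSE f \<longleftrightarrow> LOM f \<and> \<not> totally_geodesic_isometric_embedding f \<and>
     (\<forall>x\<in>sphere 0 1. \<forall>s\<in>#sphere_singular_values f x. \<forall>t\<in>#sphere_singular_values f x.
        s \<noteq> 0 \<longrightarrow> t \<noteq> 0 \<longrightarrow> s = t)"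

text \<open>The formulas for the singular value and for the angle in terms of \<open>(n,p,k)\<close> are consequences
  and not part of the definition.\<close>

definition LOMSE_of_type :: "nat \<Rightarrow> nat \<Rightarrow> nat \<Rightarrow> (real^'a::finite \<Rightarrow> real^'b) \<Rightarrow> bool" where
  "LOMSE_of_type n p k f \<longleftrightarrow> CARD('a) = n + 1 \<and> LOMSE f \<and> k \<ge> 2 \<and>
     (\<forall>i. spherical_harmonic k (\<lambda>x. f x $ i)) \<and>
     (\<forall>x\<in>sphere 0 1. size {#s \<in># sphere_singular_values f x. s \<noteq> 0#} = p)"

definition Q0 :: "((real^'a) \<times> (real^'b)) set" where
  "Q0 = {z. fst z = 0}"

definition Q0_perp :: "((real^'a) \<times> (real^'b)) set" where
  "Q0_perp = {z. snd z = 0}"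

definition tangent_jordan_angles ::
    "((real^'a) \<times> (real^'b)) set \<Rightarrow> (real^'a) \<times> (real^'b) \<Rightarrow> real multiset" where
  "tangent_jordan_angles C q = jordan_angles (tangent_space C q) Q0_perp"

definition slope_function ::
    "((real^'a) \<times> (real^'b)) set \<Rightarrow> (real^'a) \<times> (real^'b) \<Rightarrow> real" where
  "slope_function C q = (\<Prod>\<phi>\<in>#tangent_jordan_angles C q. 1 / cos \<phi>)"

end

theory Submission
  imports Defs
begin

text \<open>
  Put \<open>g y = f (y / |y|)\<close> and \<open>F y = tan \<theta> |y| g y\<close>; the cone is the graph of \<open>F\<close>, which is homogeneous
  of degree one. By homogeneity, minimality of the link says that the trace of \<open>D\<^sup>2F\<close> with respect to the
  inverse graph metric vanishes. Harmonicity gives \<open>\<Delta>g = - K g / |y|\<^sup>2\<close> with \<open>K = k (k + n - 1)\<close>, hence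
  \<open>|Dg|\<^sup>2 = K / |y|\<^sup>2\<close>, so the square of the nonzero singular value is \<open>K / p\<close>. Pairing the trace
  equation with \<open>F\<close> determines \<open>\<theta>\<close>, and with it all singular values of \<open>DF\<close>; this yields the angles, the
  slope and the volume. The inverse graph metric is the identity minus multiples of \<open>y y\<^sup>T / |y|\<^sup>2\<close> and
  \<open>|y|\<^sup>2 Dg\<^sup>T Dg\<close>. The divergences of these two fields are multiples of \<open>y / |y|\<^sup>2\<close> that cancel
  precisely for this \<open>\<theta>\<close>, and the vertex is a removable singularity for bounded divergence-free fields.
\<close>

section \<open>Calculus of smooth maps\<close>

text \<open>The differential of a degree-one map is constant along rays, so the position vector is
  tangent to the cone and contributes nothing to second derivatives. Hence the normal plane of the
  link inside its sphere is that of the cone, and a trace over the tangent space of the link is a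
  full trace. The projection to normal planes disappears because a tangent vector of a graph with
  zero horizontal part is zero. The obstacle is regularity: frames that diagonalize the differential
  are chosen point by point and need not be continuous. Algebraic identities may use them, but
  nothing can be differentiated along them. Equality of the nonzero singular values is the way out,
  as it expresses the inverse metric through y and Dg alone. The area density is the constant
  product of the eigenvalues and factors out of every divergence. The cutoff error at the vertex
  vanishes in dimension n + 1 >= 2, which follows from p < n; that strict bound is itself forced by
  the equation for the angle, since K > n for k >= 2.\<close>

lemma Ck_on_cong:
  assumes "open U" "Ck_on r U f" "\<And>x. x \<in> U \<Longrightarrow> f x = g x"
  shows "Ck_on r U g"
  using assms(2,3)
proof (induction r arbitrary: f g)
  case 0
  then show ?case by (simp cong: continuous_on_cong)
next
  case (Suc r)
  have d: "f differentiable (at x)" if "x \<in> U" for x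
    using Suc.prems(1) that assms(1) by (simp add: differentiable_on_eq_differentiable_at)
  have eq: "frechet_derivative f (at x) = frechet_derivative g (at x)" if "x \<in> U" for x
    by (rule frechet_derivative_transform_within_open[OF d assms(1)]) (use that Suc.prems(2) in auto)
  have "(g has_derivative frechet_derivative f (at x)) (at x)" if "x \<in> U" for x
    using has_derivative_transform_within_open[OF _ assms(1) that Suc.prems(2)] d[OF that]
    by (simp add: frechet_derivative_works)
  then have "g differentiable_on U"
    using assms(1) by (auto simp: differentiable_on_eq_differentiable_at differentiable_def)
  moreover have "Ck_on r U (\<lambda>x. frechet_derivative g (at x) v)" for v
    using Suc.IH[of "\<lambda>x. frechet_derivative f (at x) v"] Suc.prems(1) eq by simp
  ultimately show ?case by simp
qed

lemma Ck_on_SucI: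
  assumes "open U" "\<And>x. x \<in> U \<Longrightarrow> (f has_derivative f' x) (at x)" "\<And>v. Ck_on r U (\<lambda>x. f' x v)"
  shows "Ck_on (Suc r) U f"
proof -
  have "f' x = frechet_derivative f (at x)" if "x \<in> U" for x
    using assms(2)[OF that] by (rule frechet_derivative_at)
  then have "Ck_on r U (\<lambda>x. frechet_derivative f (at x) v)" for v
    by (intro Ck_on_cong[OF assms(1) assms(3)]) simp
  moreover have "f differentiable_on U"
    using assms(1,2) by (auto simp: differentiable_on_eq_differentiable_at differentiable_def)
  ultimately show ?thesis by simp
qed

lemma Ck_on_has_derivative:
  assumes "Ck_on (Suc r) U f" "open U" "x \<in> U"
  shows "(f has_derivative frechet_derivative f (at x)) (at x)"
  using assms by (simp add: differentiable_on_eq_differentiable_at frechet_derivative_works)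

lemma Ck_on_Suc_imp: "Ck_on (Suc r) U f \<Longrightarrow> Ck_on r U f"
  by (induction r arbitrary: f) (auto simp: differentiable_imp_continuous_on)

lemma Ck_on_continuous: "Ck_on r U f \<Longrightarrow> continuous_on U f"
  by (cases r) (auto simp: differentiable_imp_continuous_on)

lemma Ck_on_subset: "Ck_on r U f \<Longrightarrow> V \<subseteq> U \<Longrightarrow> Ck_on r V f"
  by (induction r arbitrary: f) (auto intro: continuous_on_subset differentiable_on_subset)

lemma Ck_on_const: "Ck_on r U (\<lambda>x. c)"
  by (induction r arbitrary: c) auto

lemma Ck_on_linear:
  assumes "bounded_linear f" "open U"
  shows "Ck_on r U f"
proof (cases r)
  case 0
  then show ?thesis by (simp add: assms linear_continuous_on)
next
  case (Suc s)
  then show ?thesis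
    using Ck_on_SucI[OF assms(2) bounded_linear.has_derivative[OF assms(1) has_derivative_ident]] Ck_on_const
    by blast
qed

section \<open>Closure of \<open>Ck_on\<close> under sums, bilinear products, composition, inverses
  and norms\<close>

lemma Ck_on_add:
  assumes "open U" "Ck_on r U f" "Ck_on r U g"
  shows "Ck_on r U (\<lambda>x. f x + g x)"
  using assms(2,3)
proof (induction r arbitrary: f g)
  case 0
  then show ?case by (simp add: continuous_on_add)
next
  case (Suc r)
  show ?case
    by (rule Ck_on_SucI[OF assms(1) has_derivative_add[OF
        Ck_on_has_derivative[OF Suc.prems(1) assms(1)] Ck_on_has_derivative[OF Suc.prems(2) assms(1)]]])
      (use Suc in auto)
qed

lemma Ck_on_sum:
  assumes "open U" "\<And>i. i \<in> I \<Longrightarrow> Ck_on r U (f i)"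
  shows "Ck_on r U (\<lambda>x. \<Sum>i\<in>I. f i x)"
  using assms(2) by (induction I rule: infinite_finite_induct) (auto intro: Ck_on_const Ck_on_add[OF assms(1)])

lemma Ck_on_bilinear:
  assumes "bounded_bilinear b" "open U" "Ck_on r U f" "Ck_on r U g"
  shows "Ck_on r U (\<lambda>x. b (f x) (g x))"
  using assms(3,4)
proof (induction r arbitrary: f g)
  case 0
  then show ?case using bounded_bilinear.continuous_on[OF assms(1)] by simp
next
  case (Suc r)
  show ?case
    apply (rule Ck_on_SucI[OF assms(2) bounded_bilinear.FDERIV[OF assms(1)
        Ck_on_has_derivative[OF Suc.prems(1) assms(2)] Ck_on_has_derivative[OF Suc.prems(2) assms(2)]]])
      apply assumption+
    apply (rule Ck_on_add[OF assms(2)])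
    using Suc Suc.prems[THEN Ck_on_Suc_imp] by auto
qed

lemmas Ck_on_scaleR = Ck_on_bilinear[OF bounded_bilinear_scaleR]
  and Ck_on_inner = Ck_on_bilinear[OF bounded_bilinear_inner]
  and Ck_on_mult = Ck_on_bilinear[OF bounded_bilinear_mult]

lemma linear_sum_Basis:
  fixes f :: "'e::euclidean_space \<Rightarrow> 'f::real_vector"
  assumes "linear f"
  shows "f v = (\<Sum>b\<in>Basis. (v \<bullet> b) *\<^sub>R f b)"
  by (subst euclidean_representation[of v, symmetric])
     (simp only: linear_sum[OF assms] linear_cmul[OF assms])

text \<open>The derivative of \<open>f\<close> at \<open>g x\<close> in the direction of the
  derivative of \<open>g\<close> moves with \<open>x\<close> in both places, while
  \<open>Ck_on\<close> speaks of fixed directions. Expanding over \<open>Basis\<close> gives a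
  finite sum of scalar coordinates times derivatives of \<open>f\<close> in fixed directions, to
  which the induction hypothesis applies.\<close>

lemma Ck_on_compose:
  assumes "open U" "open V" "g ` U \<subseteq> V" "Ck_on r V f" "Ck_on r U g"
  shows "Ck_on r U (\<lambda>x. f (g x))"
  using assms(4,5)
proof (induction r arbitrary: f)
  case 0
  then show ?case using assms(3) continuous_on_compose2 by fastforce
next
  case (Suc r)
  have g: "Ck_on r U g" using Suc.prems(2) by (rule Ck_on_Suc_imp)
  note df = Ck_on_has_derivative[OF Suc.prems(1) assms(2)]
  note dg = Ck_on_has_derivative[OF Suc.prems(2) assms(1)]
  have D: "((\<lambda>x. f (g x)) has_derivative
      (\<lambda>v. \<Sum>b\<in>Basis. (frechet_derivative g (at x) v \<bullet> b) *\<^sub>R frechet_derivative f (at (g x)) b)) (at x)"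
    if "x \<in> U" for x
  proof -
    have gx: "g x \<in> V" using that assms(3) by blast
    have "((\<lambda>x. f (g x)) has_derivative
      (\<lambda>v. frechet_derivative f (at (g x)) (frechet_derivative g (at x) v))) (at x)"
      using has_derivative_compose[OF dg[OF that] df[OF gx]] .
    then show ?thesis
      by (subst (asm) linear_sum_Basis[OF has_derivative_linear[OF df[OF gx]]])
  qed
  show ?case
    apply (rule Ck_on_SucI[OF assms(1) D], assumption)
    apply (rule Ck_on_sum[OF assms(1)])
    apply (rule Ck_on_scaleR[OF assms(1)])
     apply (rule Ck_on_inner[OF assms(1)])
    using Suc.prems g by (auto intro: Suc.IH Ck_on_const)
qed

text \<open>The derivative of the inverse is a product of inverses, so each order of smoothness
  yields the next one.\<close>

lemma Ck_on_real_inverse: "Ck_on r (- {0}) (inverse :: real \<Rightarrow> real)"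
proof (induction r)
  case 0
  then show ?case by (auto intro: continuous_intros)
next
  case (Suc r)
  have D: "(inverse has_derivative (\<lambda>h. (- h) * (inverse x * inverse x))) (at x)" if "x \<in> - {0}" for x :: real
    using has_derivative_inverse'[of x] that by (simp add: mult_ac)
  show ?case
    by (rule Ck_on_SucI[OF _ D]) (auto simp only: intro!: Ck_on_mult Suc Ck_on_const)
qed

lemma Ck_on_inverse:
  fixes g :: "'e::euclidean_space \<Rightarrow> real"
  assumes "open U" "Ck_on r U g" "\<And>x. x \<in> U \<Longrightarrow> g x \<noteq> 0"
  shows "Ck_on r U (\<lambda>x. inverse (g x))"
  by (rule Ck_on_compose[OF assms(1) _ _ Ck_on_real_inverse assms(2)]) (use assms(3) in auto)

text \<open>The same bootstrapping: the derivative in a fixed direction is linear in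
  \<open>x\<close> divided by \<open>norm x\<close> itself.\<close>

lemma Ck_on_norm: "Ck_on r (- {0}) (norm :: 'e::euclidean_space \<Rightarrow> real)"
proof (induction r)
  case 0
  then show ?case by (auto intro: continuous_intros)
next
  case (Suc r)
  have D: "(norm has_derivative (\<lambda>v. (v \<bullet> x) * inverse (norm x))) (at x)"
    if "x \<in> - {0}" for x :: 'e
    using has_derivative_norm[of x] that by (simp add: sgn_div_norm divide_inverse mult.commute inner_commute)
  show ?case
  proof (rule Ck_on_SucI[OF _ D])
    show "Ck_on r (- {0}) (\<lambda>x. v \<bullet> x * inverse (norm x))" for v :: 'e
      by (rule Ck_on_mult[OF _ Ck_on_inner[OF _ Ck_on_const Ck_on_linear[OF bounded_linear_ident]]
          Ck_on_inverse[OF _ Suc]]) auto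
  qed auto
qed

section \<open>The closure properties for smooth maps\<close>

lemma smooth_on_open_subset: "smooth_on U f \<Longrightarrow> V \<subseteq> U \<Longrightarrow> smooth_on V f"
  unfolding smooth_on_def using Ck_on_subset by blast

lemma smooth_on_cong: "open U \<Longrightarrow> smooth_on U f \<Longrightarrow> (\<And>x. x \<in> U \<Longrightarrow> f x = g x) \<Longrightarrow> smooth_on U g"
  unfolding smooth_on_def by (blast intro: Ck_on_cong)

lemma smooth_on_has_derivative:
  "smooth_on U f \<Longrightarrow> open U \<Longrightarrow> x \<in> U \<Longrightarrow> (f has_derivative frechet_derivative f (at x)) (at x)"
  unfolding smooth_on_def using Ck_on_has_derivative by blast

lemma smooth_on_frechet_derivative: "smooth_on U f \<Longrightarrow> smooth_on U (\<lambda>x. frechet_derivative f (at x) v)"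
  unfolding smooth_on_def using Ck_on.simps(2) by blast

lemma smooth_on_continuous: "smooth_on U f \<Longrightarrow> continuous_on U f"
  unfolding smooth_on_def using Ck_on_continuous by blast

named_theorems smooth_intros

lemma smooth_on_const [smooth_intros]: "smooth_on U (\<lambda>x. c)"
  and smooth_on_linear: "bounded_linear f \<Longrightarrow> open U \<Longrightarrow> smooth_on U f"
  and smooth_on_ident [smooth_intros]: "open U \<Longrightarrow> smooth_on U (\<lambda>x. x)"
  and smooth_on_norm_ident: "smooth_on (- {0}) (norm :: 'e::euclidean_space \<Rightarrow> real)"
  by (simp_all add: smooth_on_def Ck_on_const Ck_on_linear bounded_linear_ident Ck_on_norm)

lemma smooth_on_add [smooth_intros]:
    "open U \<Longrightarrow> smooth_on U f \<Longrightarrow> smooth_on U g \<Longrightarrow> smooth_on U (\<lambda>x. f x + g x)"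
  and smooth_on_scaleR [smooth_intros]:
    "open U \<Longrightarrow> smooth_on U a \<Longrightarrow> smooth_on U f \<Longrightarrow> smooth_on U (\<lambda>x. a x *\<^sub>R f x)"
  and smooth_on_inner [smooth_intros]:
    "open U \<Longrightarrow> smooth_on U h \<Longrightarrow> smooth_on U k \<Longrightarrow> smooth_on U (\<lambda>x. h x \<bullet> k x)"
  and smooth_on_mult [smooth_intros]:
    "open U \<Longrightarrow> smooth_on U a \<Longrightarrow> smooth_on U c \<Longrightarrow> smooth_on U (\<lambda>x. a x * c x :: real)"
  and smooth_on_sum [smooth_intros]:
    "open U \<Longrightarrow> (\<And>i. i \<in> I \<Longrightarrow> smooth_on U (F i)) \<Longrightarrow> smooth_on U (\<lambda>x. \<Sum>i\<in>I. F i x)"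
  and smooth_on_inverse [smooth_intros]:
    "open U \<Longrightarrow> smooth_on U a \<Longrightarrow> (\<And>x. x \<in> U \<Longrightarrow> a x \<noteq> 0) \<Longrightarrow> smooth_on U (\<lambda>x. inverse (a x))"
  for a c :: "'e::euclidean_space \<Rightarrow> real"
  by (simp_all add: smooth_on_def Ck_on_add Ck_on_scaleR Ck_on_inner Ck_on_mult Ck_on_sum Ck_on_inverse)

lemma smooth_on_compose:
  "open U \<Longrightarrow> open V \<Longrightarrow> smooth_on V f \<Longrightarrow> smooth_on U g \<Longrightarrow> g ` U \<subseteq> V \<Longrightarrow> smooth_on U (\<lambda>x. f (g x))"
  unfolding smooth_on_def using Ck_on_compose by blast

lemma smooth_on_bounded_linear:
  fixes f :: "'f::euclidean_space \<Rightarrow> 'g::real_normed_vector"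
  shows "open U \<Longrightarrow> bounded_linear f \<Longrightarrow> smooth_on U g \<Longrightarrow> smooth_on U (\<lambda>x. f (g x))"
  using smooth_on_compose[OF _ open_UNIV smooth_on_linear, where f = f and g = g] by blast

lemma smooth_on_diff [smooth_intros]:
  fixes f g :: "'e::euclidean_space \<Rightarrow> 'f::euclidean_space"
  shows "open U \<Longrightarrow> smooth_on U f \<Longrightarrow> smooth_on U g \<Longrightarrow> smooth_on U (\<lambda>x. f x - g x)"
  using smooth_on_add[of U f "\<lambda>x. - g x"] smooth_on_bounded_linear[OF _ bounded_linear_minus[OF bounded_linear_ident], of U g]
  by simp

lemma smooth_on_norm [smooth_intros]:
  fixes g :: "'e::euclidean_space \<Rightarrow> 'f::euclidean_space"
  shows "open U \<Longrightarrow> smooth_on U g \<Longrightarrow> (\<And>x. x \<in> U \<Longrightarrow> g x \<noteq> 0) \<Longrightarrow> smooth_on U (\<lambda>x. norm (g x))"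
  by (rule smooth_on_compose[OF _ _ smooth_on_norm_ident]) auto

lemma smooth_on_power [smooth_intros]:
  fixes a :: "'e::euclidean_space \<Rightarrow> real"
  shows "open U \<Longrightarrow> smooth_on U a \<Longrightarrow> smooth_on U (\<lambda>x. a x ^ j)"
  by (induction j) (auto intro: smooth_intros)

lemma smooth_on_Pair [smooth_intros]:
  fixes f :: "'e::euclidean_space \<Rightarrow> 'f::euclidean_space" and g :: "'e \<Rightarrow> 'g::euclidean_space"
  assumes "open U" "smooth_on U f" "smooth_on U g"
  shows "smooth_on U (\<lambda>x. (f x, g x))"
proof -
  have "smooth_on U (\<lambda>x. (f x, 0) + (0, g x))"
    by (rule smooth_on_add[OF assms(1) smooth_on_bounded_linear[OF assms(1) _ assms(2), of "\<lambda>y. (y, 0)"]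
          smooth_on_bounded_linear[OF assms(1) _ assms(3), of "Pair 0"]])
      (auto intro: bounded_linear_Pair bounded_linear_ident bounded_linear_zero)
  then show ?thesis by simp
qed

lemma frechet_derivative_eqI: "(f has_derivative f') (at x) \<Longrightarrow> frechet_derivative f (at x) v = f' v"
  using frechet_derivative_at fun_cong by fastforce

lemma smooth_on_frechet_linear:
  assumes "smooth_on U f" "open U" "x \<in> U"
  shows "frechet_derivative (\<lambda>z. \<Sum>i\<in>I. c i *\<^sub>R frechet_derivative f (at z) (w i)) (at x) u =
    (\<Sum>i\<in>I. c i *\<^sub>R frechet_derivative (\<lambda>z. frechet_derivative f (at z) (w i)) (at x) u)"
proof -
  have "((\<lambda>z. \<Sum>i\<in>I. c i *\<^sub>R frechet_derivative f (at z) (w i)) has_derivative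
      (\<lambda>u. \<Sum>i\<in>I. c i *\<^sub>R frechet_derivative (\<lambda>z. frechet_derivative f (at z) (w i)) (at x) u)) (at x)"
    by (intro has_derivative_sum has_derivative_scaleR_right
        smooth_on_has_derivative[OF smooth_on_frechet_derivative[OF assms(1)] assms(2,3)])
  then show ?thesis by (rule frechet_derivative_eqI)
qed

subsection \<open>The second derivative\<close>

definition D2 :: "('e::euclidean_space \<Rightarrow> 'f::real_normed_vector) \<Rightarrow> 'e \<Rightarrow> 'e \<Rightarrow> 'e \<Rightarrow> 'f" where
  "D2 f x u v = frechet_derivative (\<lambda>z. frechet_derivative f (at z) v) (at x) u"

lemma D2_has_derivative:
  "smooth_on U f \<Longrightarrow> open U \<Longrightarrow> x \<in> U \<Longrightarrow>
   ((\<lambda>z. frechet_derivative f (at z) v) has_derivative (\<lambda>u. D2 f x u v)) (at x)"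
  unfolding D2_def by (rule smooth_on_has_derivative[OF smooth_on_frechet_derivative])

lemma D2_linear_left: "smooth_on U f \<Longrightarrow> open U \<Longrightarrow> x \<in> U \<Longrightarrow> linear (\<lambda>u. D2 f x u v)"
  using D2_has_derivative has_derivative_linear by blast

text \<open>Linearity in the first slot is built into the derivative. For the second slot, the
  linearity of the first derivative holds at every point of the open set \<open>U\<close> and can
  therefore be differentiated.\<close>

lemma D2_expand_right:
  assumes "smooth_on U f" "open U" "x \<in> U"
  shows "D2 f x u v = (\<Sum>b\<in>Basis. (v \<bullet> b) *\<^sub>R D2 f x u b)"
proof -
  have "D2 f x u v = frechet_derivative (\<lambda>z. \<Sum>b\<in>Basis. (v \<bullet> b) *\<^sub>R frechet_derivative f (at z) b) (at x) u"
    unfolding D2_def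
  proof (rule fun_cong[OF frechet_derivative_transform_within_open, of _ x U])
    show "(\<lambda>z. frechet_derivative f (at z) v) differentiable at x"
      using D2_has_derivative[OF assms] differentiableI by blast
    show "frechet_derivative f (at z) v = (\<Sum>b\<in>Basis. (v \<bullet> b) *\<^sub>R frechet_derivative f (at z) b)"
      if "z \<in> U" for z
      by (rule linear_sum_Basis[OF has_derivative_linear[OF smooth_on_has_derivative[OF assms(1,2) that]]])
  qed (use assms in auto)
  then show ?thesis
    by (simp only: smooth_on_frechet_linear[OF assms] D2_def)
qed

lemma D2_linear_right:
  assumes "smooth_on U f" "open U" "x \<in> U"
  shows "linear (\<lambda>v. D2 f x u v)"
proof -
  have "linear (\<lambda>v. \<Sum>b\<in>Basis. (v \<bullet> b) *\<^sub>R D2 f x u b)"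
    by (intro linear_compose_sum ballI linearI) (auto simp: inner_left_distrib algebra_simps)
  then show ?thesis by (subst D2_expand_right[OF assms])
qed

section \<open>Symmetry of the second derivative\<close>

lemma has_derivative_line:
  assumes "(g has_derivative g') (at (x + t *\<^sub>R u))"
  shows "((\<lambda>t. g (x + t *\<^sub>R u)) has_vector_derivative g' u) (at t)"
proof -
  have "((\<lambda>t. x + t *\<^sub>R u) has_derivative (\<lambda>t. t *\<^sub>R u)) (at t)"
    by (auto intro!: derivative_eq_intros)
  from has_derivative_compose[OF this assms] show ?thesis
    by (simp add: has_vector_derivative_def linear_cmul[OF has_derivative_linear[OF assms]])
qed

text \<open>The mean value theorem is applied twice: along \<open>u\<close> to the difference of two
  parallel edges, then along \<open>v\<close> to the derivative in the direction \<open>u\<close>.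
  The box condition keeps the whole parallelogram inside \<open>U\<close>.\<close>

lemma second_difference_mean_value:
  fixes f :: "'e::euclidean_space \<Rightarrow> real"
  assumes f: "smooth_on U f" "open U" and s: "s > 0"
    and box: "\<And>a b. 0 \<le> a \<Longrightarrow> a \<le> s \<Longrightarrow> 0 \<le> b \<Longrightarrow> b \<le> s \<Longrightarrow> x + a *\<^sub>R u + b *\<^sub>R v \<in> U"
  obtains a b where "0 < a" "a < s" "0 < b" "b < s"
    "f (x + s *\<^sub>R u + s *\<^sub>R v) - f (x + s *\<^sub>R u) - f (x + s *\<^sub>R v) + f x = s * s * D2 f (x + a *\<^sub>R u + b *\<^sub>R v) v u"
proof -
  let ?p = "\<lambda>a b. x + a *\<^sub>R u + b *\<^sub>R v"
  let ?D = "\<lambda>z. frechet_derivative f (at z)"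
  have d1: "((\<lambda>a. f (?p a b)) has_real_derivative ?D (?p a b) u) (at a)"
    if "0 \<le> a" "a \<le> s" "0 \<le> b" "b \<le> s" for a b
    using has_derivative_line[of f "?D (?p a b)" "x + b *\<^sub>R v" a u]
      smooth_on_has_derivative[OF f box[OF that]]
    by (simp add: has_real_derivative_iff_has_vector_derivative algebra_simps)
  have d2: "((\<lambda>b. ?D (?p a b) u) has_real_derivative D2 f (?p a b) v u) (at b)"
    if "0 \<le> a" "a \<le> s" "0 \<le> b" "b \<le> s" for a b
    using has_derivative_line[of "\<lambda>z. ?D z u" "\<lambda>w. D2 f (?p a b) w u" "x + a *\<^sub>R u" b v]
      D2_has_derivative[OF f box[OF that]]
    by (simp add: has_real_derivative_iff_has_vector_derivative algebra_simps)
  have "\<exists>a>0. a < s \<and> (f (?p s s) - f (?p s 0)) - (f (?p 0 s) - f (?p 0 0)) = (s - 0) * (?D (?p a s) u - ?D (?p a 0) u)"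
    by (rule MVT2[OF s DERIV_diff[OF d1 d1]]) (use s in auto)
  then obtain a where a: "0 < a" "a < s" and
    1: "(f (?p s s) - f (?p s 0)) - (f (?p 0 s) - f (?p 0 0)) = (s - 0) * (?D (?p a s) u - ?D (?p a 0) u)"
    by blast
  have "\<exists>b>0. b < s \<and> ?D (?p a s) u - ?D (?p a 0) u = (s - 0) * D2 f (?p a b) v u"
    by (rule MVT2[OF s d2]) (use a in auto)
  then obtain b where b: "0 < b" "b < s" and
    2: "?D (?p a s) u - ?D (?p a 0) u = (s - 0) * D2 f (?p a b) v u"
    by blast
  show ?thesis using that[OF a b] 1 2 by (simp add: algebra_simps)
qed

text \<open>The second difference does not change when \<open>u\<close> and \<open>v\<close> are
  exchanged, so the two mixed derivatives agree when each is taken at a suitable point close to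
  \<open>x\<close>. Continuity then leaves no gap between them at \<open>x\<close>.\<close>

lemma D2_commute_real:
  fixes f :: "'e::euclidean_space \<Rightarrow> real"
  assumes f: "smooth_on U f" "open U" and x: "x \<in> U"
  shows "D2 f x u v = D2 f x v u"
proof (rule ccontr)
  assume ne: "D2 f x u v \<noteq> D2 f x v u"
  \<comment> \<open>Half the gap: two errors smaller than this cannot bridge it.\<close>
  define e where "e = \<bar>D2 f x u v - D2 f x v u\<bar> / 2"
  have e: "e > 0" using ne by (simp add: e_def)
  have cont: "continuous_on U (\<lambda>z. D2 f z u v)" for u v
    unfolding D2_def by (intro smooth_on_continuous smooth_on_frechet_derivative f)
  have nbhd: "\<exists>d>0. \<forall>z. dist z x < d \<longrightarrow> z \<in> U \<and> \<bar>D2 f z u v - D2 f x u v\<bar> < e" for u v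
  proof -
    obtain d1 where d1: "d1 > 0" "ball x d1 \<subseteq> U" using f(2) x openE by blast
    obtain d2 where d2: "d2 > 0" "\<forall>z\<in>U. dist z x < d2 \<longrightarrow> dist (D2 f z u v) (D2 f x u v) < e"
      using cont x e unfolding continuous_on_iff by metis
    show ?thesis
      by (rule exI[of _ "min d1 d2"]) (use d1 d2 in \<open>auto simp: dist_commute dist_real_def subset_iff mem_ball\<close>)
  qed
  obtain d1 where d1: "d1 > 0" "\<And>z. dist z x < d1 \<Longrightarrow> z \<in> U \<and> \<bar>D2 f z u v - D2 f x u v\<bar> < e"
    using nbhd by blast
  obtain d2 where d2: "d2 > 0" "\<And>z. dist z x < d2 \<Longrightarrow> z \<in> U \<and> \<bar>D2 f z v u - D2 f x v u\<bar> < e"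
    using nbhd by blast
  \<comment> \<open>Keeps the whole parallelogram within the smaller radius; the summand 1 covers
    the case of two zero vectors.\<close>
  define s where "s = min d1 d2 / (norm u + norm v + 1)"
  have s: "s > 0" using d1 d2 by (simp add: s_def add_nonneg_pos)
  have near: "dist (x + a *\<^sub>R u + b *\<^sub>R v) x < min d1 d2" if "0 \<le> a" "a \<le> s" "0 \<le> b" "b \<le> s" for a b
  proof -
    have "dist (x + a *\<^sub>R u + b *\<^sub>R v) x = norm (a *\<^sub>R u + b *\<^sub>R v)" by (simp add: dist_norm add.assoc)
    also have "\<dots> \<le> a * norm u + b * norm v" using norm_triangle_ineq[of "a *\<^sub>R u" "b *\<^sub>R v"] that by simp
    also have "\<dots> \<le> s * norm u + s * norm v" using that by (intro add_mono mult_right_mono) auto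
    also have "\<dots> < s * (norm u + norm v + 1)" using s by (simp add: algebra_simps)
    also have "\<dots> = min d1 d2" unfolding s_def by (simp add: add_nonneg_eq_0_iff)
    finally show ?thesis .
  qed
  have near': "dist (x + b *\<^sub>R v + a *\<^sub>R u) x < min d1 d2" if "0 \<le> a" "a \<le> s" "0 \<le> b" "b \<le> s" for a b
    using near[OF that] by (simp add: algebra_simps)
  obtain a b where ab: "0 < a" "a < s" "0 < b" "b < s" and
    1: "f (x + s *\<^sub>R u + s *\<^sub>R v) - f (x + s *\<^sub>R u) - f (x + s *\<^sub>R v) + f x = s * s * D2 f (x + a *\<^sub>R u + b *\<^sub>R v) v u"
    by (rule second_difference_mean_value[OF f s, of x u v]) (use d1 near in auto)
  obtain a' b' where ab': "0 < a'" "a' < s" "0 < b'" "b' < s" and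
    2: "f (x + s *\<^sub>R v + s *\<^sub>R u) - f (x + s *\<^sub>R v) - f (x + s *\<^sub>R u) + f x = s * s * D2 f (x + a' *\<^sub>R v + b' *\<^sub>R u) u v"
    by (rule second_difference_mean_value[OF f s, of x v u]) (use d1 near' in auto)
  have "D2 f (x + a *\<^sub>R u + b *\<^sub>R v) v u = D2 f (x + a' *\<^sub>R v + b' *\<^sub>R u) u v"
    using 1 2 s by (simp add: algebra_simps)
  moreover have "\<bar>D2 f (x + a *\<^sub>R u + b *\<^sub>R v) v u - D2 f x v u\<bar> < e" using d2 near[of a b] ab by auto
  moreover have "\<bar>D2 f (x + a' *\<^sub>R v + b' *\<^sub>R u) u v - D2 f x u v\<bar> < e" using d1 near'[of b' a'] ab' by auto
  moreover have "\<bar>p - q\<bar> \<le> \<bar>r - q\<bar> + \<bar>r - p\<bar>" for p q r :: real by linarith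
  ultimately show False unfolding e_def by (metis add_strict_mono field_sum_of_halves not_less)
qed

lemma D2_inner:
  fixes f :: "'e::euclidean_space \<Rightarrow> 'f::euclidean_space"
  assumes f: "smooth_on U f" "open U" and x: "x \<in> U"
  shows "D2 (\<lambda>z. f z \<bullet> w) x u v = D2 f x u v \<bullet> w"
proof -
  have d: "frechet_derivative (\<lambda>z. f z \<bullet> w) (at z) v = frechet_derivative f (at z) v \<bullet> w" if "z \<in> U" for z
    by (rule frechet_derivative_eqI[OF has_derivative_inner_left[OF smooth_on_has_derivative[OF f that]]])
  have "((\<lambda>z. frechet_derivative f (at z) v \<bullet> w) has_derivative (\<lambda>u. D2 f x u v \<bullet> w)) (at x)"
    by (rule has_derivative_inner_left[OF D2_has_derivative[OF f x]])
  then have "((\<lambda>z. frechet_derivative (\<lambda>z. f z \<bullet> w) (at z) v) has_derivative (\<lambda>u. D2 f x u v \<bullet> w)) (at x)"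
    by (rule has_derivative_transform_within_open[OF _ f(2) x]) (simp add: d)
  then show ?thesis unfolding D2_def[of "\<lambda>z. f z \<bullet> w"] by (rule frechet_derivative_eqI)
qed

lemma D2_commute:
  fixes f :: "'e::euclidean_space \<Rightarrow> 'f::euclidean_space"
  assumes f: "smooth_on U f" "open U" and x: "x \<in> U"
  shows "D2 f x u v = D2 f x v u"
proof (rule euclidean_eqI)
  fix w :: 'f
  show "D2 f x u v \<bullet> w = D2 f x v u \<bullet> w"
    using D2_commute_real[OF smooth_on_inner[OF f(2) f(1) smooth_on_const[of _ w]] f(2) x, of u v] D2_inner[OF f x, of w]
    by metis
qed

section \<open>Determinants over finite index sets\<close>

lemma det_on_cong:
  assumes "\<And>i j. i \<in> I \<Longrightarrow> j \<in> I \<Longrightarrow> A i j = B i j"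
  shows "det_on I A = det_on I B"
  unfolding det_on_def using assms
  by (intro sum.cong prod.cong arg_cong2[of _ _ _ _ "(*)"] refl) (auto simp: permutes_in_image)

lemma det_on_permute_rows:
  assumes "finite I" "p permutes I"
  shows "det_on I (\<lambda>i. B (p i)) = of_int (sign p) * det_on I B"
proof -
  have "(\<Sum>q | q permutes I. of_int (sign (q \<circ> p)) * (\<Prod>i\<in>I. B (p i) ((q \<circ> p) i))) =
        (\<Sum>q | q permutes I. of_int (sign p) * (of_int (sign q) * (\<Prod>i\<in>I. B i (q i))))"
  proof (rule sum.cong)
    fix q assume "q \<in> {q. q permutes I}"
    then have q: "q permutes I" by simp
    have "(\<Prod>i\<in>I. B (p i) ((q \<circ> p) i)) = (\<Prod>i\<in>I. B i (q i))"
      using prod.permute[OF assms(2), of "\<lambda>i. B i (q i)"] by (simp add: o_def)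
    moreover have "sign (q \<circ> p) = sign q * sign p"
      by (intro sign_compose permutes_imp_permutation[OF assms(1)] q assms(2))
    ultimately show "of_int (sign (q \<circ> p)) * (\<Prod>i\<in>I. B (p i) ((q \<circ> p) i)) =
        of_int (sign p) * (of_int (sign q) * (\<Prod>i\<in>I. B i (q i)))"
      by simp
  qed simp
  then show ?thesis
    unfolding det_on_def sum_distrib_left
    by (subst sum_permutations_compose_right[OF assms(2)])
qed

lemma det_on_identical_rows:
  assumes "finite I" "a \<in> I" "b \<in> I" "a \<noteq> b" "A a = A b"
  shows "det_on I A = 0"
proof -
  have "Transposition.transpose a b permutes I" using assms by (simp add: permutes_swap_id)
  from det_on_permute_rows[OF assms(1) this, of A]
  have "det_on I (\<lambda>i. A (Transposition.transpose a b i)) = - det_on I A"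
    using assms(4) by (simp add: sign_swap_id)
  moreover have "(\<lambda>i. A (Transposition.transpose a b i)) = A" using assms(5) by (auto simp: Transposition.transpose_def)
  ultimately show ?thesis by simp
qed

text \<open>Expanding the rows of the product gives a sum over all maps \<open>g\<close> from
  \<open>I\<close> to \<open>I\<close>. Maps that are not injective contribute determinants with two
  equal rows, hence zero; the injective ones are permutations and contribute a sign times
  \<open>det_on I B\<close>.\<close>

lemma det_on_mult:
  assumes I: "finite I"
  shows "det_on I (\<lambda>i j. \<Sum>k\<in>I. A i k * B k j) = det_on I A * det_on I B"
proof -
  have "det_on I (\<lambda>i j. \<Sum>k\<in>I. A i k * B k j) =
    (\<Sum>p | p permutes I. \<Sum>g\<in>I \<rightarrow>\<^sub>E I. of_int (sign p) * ((\<Prod>i\<in>I. A i (g i)) * (\<Prod>i\<in>I. B (g i) (p i))))"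
    unfolding det_on_def using I by (simp add: prod_sum_PiE prod.distrib sum_distrib_left)
  also have "\<dots> = (\<Sum>g\<in>I \<rightarrow>\<^sub>E I. (\<Prod>i\<in>I. A i (g i)) * det_on I (\<lambda>i. B (g i)))"
    unfolding det_on_def sum_distrib_left by (subst sum.swap) (simp add: mult_ac)
  also have "\<dots> = (\<Sum>g\<in>{g \<in> I \<rightarrow>\<^sub>E I. inj_on g I}. (\<Prod>i\<in>I. A i (g i)) * det_on I (\<lambda>i. B (g i)))"
  proof (rule sum.mono_neutral_right)
    show "finite (I \<rightarrow>\<^sub>E I)" using I by (intro finite_PiE)
    show "\<forall>g\<in>(I \<rightarrow>\<^sub>E I) - {g \<in> I \<rightarrow>\<^sub>E I. inj_on g I}. (\<Prod>i\<in>I. A i (g i)) * det_on I (\<lambda>i. B (g i)) = 0"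
    proof
      fix g assume "g \<in> (I \<rightarrow>\<^sub>E I) - {g \<in> I \<rightarrow>\<^sub>E I. inj_on g I}"
      then obtain a b where "a \<in> I" "b \<in> I" "a \<noteq> b" "g a = g b" by (auto simp: inj_on_def)
      then have "det_on I (\<lambda>i. B (g i)) = 0" by (intro det_on_identical_rows[OF I, of a b]) auto
      then show "(\<Prod>i\<in>I. A i (g i)) * det_on I (\<lambda>i. B (g i)) = 0" by simp
    qed
  qed auto
  also have "\<dots> = (\<Sum>p | p permutes I. (\<Prod>i\<in>I. A i (p i)) * det_on I (\<lambda>i. B (p i)))"
  \<comment> \<open>Extensional functions are \<open>undefined\<close> outside \<open>I\<close>
    whereas permutations are the identity there, so the bijection only changes values off
    \<open>I\<close>.\<close>
  proof (rule sum.reindex_bij_witness[where i = "\<lambda>p. restrict p I" and j = "\<lambda>g x. if x \<in> I then g x else x"])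
    fix g assume g: "g \<in> {g \<in> I \<rightarrow>\<^sub>E I. inj_on g I}"
    then show "restrict (\<lambda>x. if x \<in> I then g x else x) I = g"
      by (auto simp: fun_eq_iff restrict_def PiE_def extensional_def)
    have "bij_betw (\<lambda>x. if x \<in> I then g x else x) I I"
    proof -
      have "g ` I = I" using g I by (intro endo_inj_surj) auto
      then show ?thesis using g by (auto simp: bij_betw_def inj_on_def)
    qed
    then show "(\<lambda>x. if x \<in> I then g x else x) \<in> {p. p permutes I}"
      by (auto intro: bij_imp_permutes)
    show "(\<Prod>i\<in>I. A i (if i \<in> I then g i else i)) * det_on I (\<lambda>i. B (if i \<in> I then g i else i)) =
        (\<Prod>i\<in>I. A i (g i)) * det_on I (\<lambda>i. B (g i))"
      by (intro arg_cong2[of _ _ _ _ "(*)"] prod.cong det_on_cong) auto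
  next
    fix p assume p: "p \<in> {p. p permutes I}"
    then show "(\<lambda>x. if x \<in> I then restrict p I x else x) = p"
      by (auto simp: fun_eq_iff permutes_not_in)
    show "restrict p I \<in> {g \<in> I \<rightarrow>\<^sub>E I. inj_on g I}"
      using p permutes_inj_on[of p I] by (auto simp: permutes_in_image inj_on_def)
  qed
  also have "\<dots> = det_on I A * det_on I B"
    using det_on_permute_rows[OF I] unfolding det_on_def[of I A] sum_distrib_right
    by (intro sum.cong) auto
  finally show ?thesis .
qed

lemma det_on_transpose:
  assumes I: "finite I"
  shows "det_on I (\<lambda>i j. A j i) = det_on I A"
proof -
  have "(\<Prod>i\<in>I. A (inv p i) i) = (\<Prod>i\<in>I. A i (p i))" if "p permutes I" for p
    using prod.permute[OF that, of "\<lambda>i. A (inv p i) i"] permutes_inverses[OF that] by (simp add: o_def)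
  then show ?thesis
    unfolding det_on_def
    by (subst sum_permutations_inverse) (auto intro!: sum.cong simp: sign_inverse permutes_imp_permutation[OF I])
qed

lemma det_on_diagonal:
  assumes I: "finite I"
  shows "det_on I (\<lambda>i j. if i = j then d i else 0) = (\<Prod>i\<in>I. d i)"
proof -
  have "(\<Prod>i\<in>I. if i = p i then d i else 0) = 0" if p: "p permutes I" and "p \<noteq> id" for p
  proof -
    obtain i where "p i \<noteq> i" using \<open>p \<noteq> id\<close> by (auto simp: fun_eq_iff)
    then have "i \<in> I" using p permutes_not_in by metis
    then show ?thesis using I \<open>p i \<noteq> i\<close> by (intro prod_zero bexI[of _ i]) auto
  qed
  then have "det_on I (\<lambda>i j. if i = j then d i else 0) =
      (\<Sum>p\<in>{id}. of_int (sign p) * (\<Prod>i\<in>I. if i = p i then d i else 0))"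
    unfolding det_on_def using I
    by (intro sum.mono_neutral_right) (auto simp: finite_permutations permutes_id)
  then show ?thesis by simp
qed

text \<open>Conjugation by \<open>h\<close> maps permutations of \<open>I\<close> to those of
  \<open>J\<close> and keeps the sign. This allows Gram determinants to be compared whose index sets
  are bases of different spaces.\<close>

lemma det_on_reindex:
  assumes h: "bij_betw h I J" and I: "finite I"
  shows "det_on J A = det_on I (\<lambda>i j. A (h i) (h j))"
proof -
  let ?m = "\<lambda>p x. if x \<in> J then h (p (inv_into I h x)) else x"
  have J: "h ` I = J" "inj_on h I" using h by (auto simp: bij_betw_def)
  have m: "?m p = map_permutation I h p" for p
    by (auto simp: map_permutation_def restrict_id_def J fun_eq_iff)
  have "det_on J A = (\<Sum>p | p permutes I. of_int (sign (?m p)) * (\<Prod>j\<in>J. A j (?m p j)))"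
    unfolding det_on_def by (rule sum.reindex_bij_betw[OF bij_betw_permutations[OF h], symmetric])
  also have "\<dots> = det_on I (\<lambda>i j. A (h i) (h j))"
    unfolding det_on_def
  proof (rule sum.cong)
    fix p assume "p \<in> {p. p permutes I}"
    then have p: "p permutes I" by simp
    have "(\<Prod>j\<in>J. A j (?m p j)) = (\<Prod>i\<in>I. A (h i) (?m p (h i)))"
      by (rule prod.reindex_bij_betw[OF h, symmetric])
    also have "\<dots> = (\<Prod>i\<in>I. A (h i) (h (p i)))"
      using J by (intro prod.cong) auto
    finally show "of_int (sign (?m p)) * (\<Prod>j\<in>J. A j (?m p j)) =
        of_int (sign p) * (\<Prod>i\<in>I. A (h i) (h (p i)))"
      by (simp only: m sign_map_permutation[OF J(2) p I])
  qed simp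
  finally show ?thesis .
qed

lemma continuous_on_det_on:
  assumes "\<And>i j. i \<in> I \<Longrightarrow> j \<in> I \<Longrightarrow> continuous_on S (\<lambda>x. A x i j)"
  shows "continuous_on S (\<lambda>x. det_on I (A x))"
  unfolding det_on_def using assms
  by (intro continuous_intros) (auto simp: permutes_in_image)

section \<open>Orthonormal families\<close>

text \<open>The index set is arbitrary, so that bases indexed by themselves, by numbers or by
  parameter directions are treated alike. Keeping an index, instead of a mere set of vectors, is
  what determinants of matrices of inner products require.\<close>

definition orthonormal_family :: "'i set \<Rightarrow> ('i \<Rightarrow> 'e::euclidean_space) \<Rightarrow> 'e set \<Rightarrow> bool" where
  "orthonormal_family I u V \<longleftrightarrow> finite I \<and> (\<forall>i\<in>I. \<forall>j\<in>I. u i \<bullet> u j = (if i = j then 1 else 0)) \<and> span (u ` I) = V"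

lemma orthonormal_familyD:
  assumes "orthonormal_family I u V"
  shows "finite I" "\<And>i j. i \<in> I \<Longrightarrow> j \<in> I \<Longrightarrow> u i \<bullet> u j = (if i = j then 1 else 0)" "span (u ` I) = V"
    "inj_on u I" "subspace V" "\<And>i. i \<in> I \<Longrightarrow> u i \<in> V" "pairwise orthogonal (u ` I)" "\<And>i. i \<in> I \<Longrightarrow> norm (u i) = 1"
proof -
  show 1: "finite I" and 2: "\<And>i j. i \<in> I \<Longrightarrow> j \<in> I \<Longrightarrow> u i \<bullet> u j = (if i = j then 1 else 0)"
    and 3: "span (u ` I) = V"
    using assms by (auto simp: orthonormal_family_def)
  show "inj_on u I" by (rule inj_onI) (metis 2 zero_neq_one)
  show "subspace V" "\<And>i. i \<in> I \<Longrightarrow> u i \<in> V" using 3 by (auto intro: span_base)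
  show "pairwise orthogonal (u ` I)" by (auto simp: pairwise_def orthogonal_def 2)
  show "\<And>i. i \<in> I \<Longrightarrow> norm (u i) = 1" by (simp add: norm_eq_sqrt_inner 2)
qed

lemma orthonormal_family_expand:
  assumes "orthonormal_family I u V" "x \<in> V"
  shows "x = (\<Sum>i\<in>I. (x \<bullet> u i) *\<^sub>R u i)"
proof -
  note u = orthonormal_familyD[OF assms(1)]
  have "(\<Sum>b\<in>u ` I. (x \<bullet> b) *\<^sub>R b) = x"
    by (rule orthonormal_basis_expand) (use u assms(2) in auto)
  then show ?thesis by (simp add: sum.reindex[OF u(4)])
qed

lemma orthonormal_family_inner:
  assumes "orthonormal_family I u V" "x \<in> V"
  shows "x \<bullet> y = (\<Sum>i\<in>I. (x \<bullet> u i) * (y \<bullet> u i))"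
  by (subst orthonormal_family_expand[OF assms]) (simp add: inner_sum_left inner_commute[of y])

lemma orthonormal_family_card:
  assumes "orthonormal_family I u V"
  shows "card I = dim V"
proof -
  note u = orthonormal_familyD[OF assms]
  have "0 \<notin> u ` I" using u(8) by fastforce
  then have "independent (u ` I)" using u(7) by (intro pairwise_orthogonal_independent)
  then show ?thesis using u(3,4) by (metis card_image dim_span_eq_card_independent)
qed

text \<open>Counting dimensions replaces a proof that the family spans.\<close>

lemma orthonormal_family_subset_dim:
  assumes "subspace V" "finite I" "\<And>i. i \<in> I \<Longrightarrow> u i \<in> V" "card I = dim V"
    "\<And>i j. i \<in> I \<Longrightarrow> j \<in> I \<Longrightarrow> u i \<bullet> u j = (if i = j then 1 else 0)"
  shows "orthonormal_family I u V"
proof -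
  have f: "orthonormal_family I u (span (u ` I))" using assms(2,5) by (simp add: orthonormal_family_def)
  have "dim (span (u ` I)) = dim V" using orthonormal_family_card[OF f] assms(4) by simp
  moreover have "span (u ` I) \<subseteq> V" using assms(1,3) by (intro span_minimal) auto
  ultimately have "span (u ` I) = V" using assms(1) by (intro subspace_dim_equal) auto
  with f show ?thesis by simp
qed

lemma orthonormal_basis_family:
  assumes "orthonormal_basis B V"
  shows "orthonormal_family B (\<lambda>b. b) V"
proof -
  have "0 \<notin> B" using assms by (auto simp: orthonormal_basis_def)
  then have "independent B" using assms by (intro pairwise_orthogonal_independent) (auto simp: orthonormal_basis_def)
  then have "finite B" using independent_imp_finite by blast
  then show ?thesis using assms
    by (auto simp: orthonormal_basis_def orthonormal_family_def pairwise_def orthogonal_def norm_eq_1)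
qed

lemma orthonormal_family_basis: "orthonormal_family I u V \<Longrightarrow> orthonormal_basis (u ` I) V"
  using orthonormal_familyD(3,7,8)[of I u V] by (auto simp: orthonormal_basis_def)

lemma orthonormal_family_reindex:
  assumes "orthonormal_family I u V" "bij_betw h J I"
  shows "orthonormal_family J (\<lambda>j. u (h j)) V"
proof -
  have "(\<lambda>j. u (h j)) ` J = u ` I" using assms(2) by (auto simp: bij_betw_def)
  moreover have "finite J" using assms bij_betw_finite by (auto simp: orthonormal_family_def)
  ultimately show ?thesis using assms
    by (auto simp: orthonormal_family_def bij_betw_def inj_on_def)
qed

lemma orthonormal_family_nat: "orthonormal_frame r \<nu> V \<longleftrightarrow> orthonormal_family {..<r} \<nu> V"
  by (auto simp: orthonormal_frame_def orthonormal_family_def)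

lemma linear_orthonormal_expand:
  assumes "orthonormal_family I u V" "linear A" "x \<in> V"
  shows "A x = (\<Sum>i\<in>I. (x \<bullet> u i) *\<^sub>R A (u i))"
  by (subst orthonormal_family_expand[OF assms(1,3)]) (simp add: linear_sum[OF assms(2)] linear_cmul[OF assms(2)])

lemma orthogonal_images_inner:
  assumes u: "orthonormal_family I u V" and A: "linear A" and "x \<in> V" "y \<in> V"
    and s: "\<And>i j. i \<in> I \<Longrightarrow> j \<in> I \<Longrightarrow> A (u i) \<bullet> A (u j) = (if i = j then s i else 0)"
  shows "A x \<bullet> A y = (\<Sum>i\<in>I. s i * (x \<bullet> u i) * (y \<bullet> u i))"
proof -
  have "A x \<bullet> A y = (\<Sum>i\<in>I. \<Sum>j\<in>I. (x \<bullet> u i) * ((y \<bullet> u j) * (A (u i) \<bullet> A (u j))))"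
    by (subst linear_orthonormal_expand[OF u A \<open>x \<in> V\<close>], subst linear_orthonormal_expand[OF u A \<open>y \<in> V\<close>])
      (simp add: inner_sum_left inner_sum_right sum_distrib_left, subst sum.swap, simp add: mult.left_commute)
  also have "\<dots> = (\<Sum>i\<in>I. \<Sum>j\<in>I. if i = j then s i * (x \<bullet> u i) * (y \<bullet> u i) else 0)"
    by (intro sum.cong) (auto simp: s)
  finally show ?thesis using orthonormal_familyD(1)[OF u] by simp
qed

text \<open>With \<open>U\<close> the coordinate matrix of \<open>u\<close> in the frame
  \<open>v\<close>, the matrix of images is \<open>U\<close> times a diagonal matrix times the
  transpose of \<open>U\<close>, and \<open>U\<close> times its transpose is the Gram matrix of
  \<open>u\<close>. The distortion of volume by \<open>A\<close> is therefore the same for all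
  families \<open>u\<close>.\<close>

lemma det_on_gram:
  assumes v: "orthonormal_family I v V" and A: "linear A" and u: "\<And>i. i \<in> I \<Longrightarrow> u i \<in> V"
    and s: "\<And>i j. i \<in> I \<Longrightarrow> j \<in> I \<Longrightarrow> A (v i) \<bullet> A (v j) = (if i = j then s i else 0)"
  shows "det_on I (\<lambda>i j. A (u i) \<bullet> A (u j)) = (\<Prod>i\<in>I. s i) * det_on I (\<lambda>i j. u i \<bullet> u j)"
proof -
  have I: "finite I" using v by (simp add: orthonormal_family_def)
  let ?U = "\<lambda>i k. u i \<bullet> v k"
  have "det_on I (\<lambda>i j. A (u i) \<bullet> A (u j)) =
      det_on I (\<lambda>i j. \<Sum>k\<in>I. ?U i k * (\<Sum>l\<in>I. (if k = l then s k else 0) * ?U j l))"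
    by (rule det_on_cong, subst orthogonal_images_inner[OF v A u u s])
      (auto simp: I if_distrib[of "\<lambda>x. x * _"] cong: if_cong intro!: sum.cong)
  also have "\<dots> = (\<Prod>i\<in>I. s i) * (det_on I ?U * det_on I ?U)"
    using det_on_mult[OF I, of ?U "\<lambda>k j. \<Sum>l\<in>I. (if k = l then s k else 0) * ?U j l"]
      det_on_mult[OF I, of "\<lambda>k l. if k = l then s k else 0" "\<lambda>l j. ?U j l"]
      det_on_diagonal[OF I, of s] det_on_transpose[OF I, of ?U] by simp
  also have "det_on I ?U * det_on I ?U = det_on I (\<lambda>i j. u i \<bullet> u j)"
  proof -
    have "det_on I (\<lambda>i j. u i \<bullet> u j) = det_on I (\<lambda>i j. \<Sum>k\<in>I. ?U i k * ?U j k)"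
      by (rule det_on_cong) (rule orthonormal_family_inner[OF v u])
    then show ?thesis using det_on_mult[OF I, of ?U "\<lambda>k j. ?U j k"] det_on_transpose[OF I, of ?U] by simp
  qed
  finally show ?thesis .
qed

text \<open>A change of orthonormal basis has an orthogonal matrix. Only the square is determined,
  since the orientations may differ.\<close>

lemma det_on_orthonormal_square:
  assumes v: "orthonormal_family I v V" and e: "orthonormal_family I e V"
  shows "(det_on I (\<lambda>i j. v i \<bullet> e j))\<^sup>2 = 1"
proof -
  have I: "finite I" using v by (simp add: orthonormal_family_def)
  let ?U = "\<lambda>i k. v i \<bullet> e k"
  have "1 = det_on I (\<lambda>i j. v i \<bullet> v j)"
    using det_on_diagonal[OF I, of "\<lambda>_. 1"] orthonormal_familyD(2)[OF v]
    by (subst det_on_cong[of I "\<lambda>i j. v i \<bullet> v j" "\<lambda>i j. if i = j then 1 else 0"]) auto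
  also have "\<dots> = det_on I (\<lambda>i j. \<Sum>k\<in>I. ?U i k * ?U j k)"
    by (rule det_on_cong) (rule orthonormal_family_inner[OF e orthonormal_familyD(6)[OF v]])
  finally show ?thesis
    using det_on_mult[OF I, of ?U "\<lambda>k j. ?U j k"] det_on_transpose[OF I, of ?U] by (simp add: power2_eq_square)
qed

subsection \<open>Orthogonal projections\<close>

lemma orth_proj_eqI:
  assumes "subspace S" "y \<in> S" "\<And>s. s \<in> S \<Longrightarrow> orthogonal (x - y) s"
  shows "orth_proj S x = y"
  unfolding orth_proj_def
proof (rule the_equality)
  show "z = y" if "z \<in> S \<and> (\<forall>s\<in>S. orthogonal (x - z) s)" for z
  proof -
    have "y - z \<in> S" using that assms(1,2) by (simp add: subspace_diff)
    then have "(x - z) \<bullet> (y - z) = 0" "(x - y) \<bullet> (y - z) = 0" using that assms(3) by (auto simp: orthogonal_def)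
    then have "(y - z) \<bullet> (y - z) = 0" by (simp add: inner_diff)
    then show ?thesis by simp
  qed
qed (use assms in auto)

lemma orth_proj:
  assumes "subspace S"
  shows "orth_proj S x \<in> S" "s \<in> S \<Longrightarrow> orthogonal (x - orth_proj S x) s"
proof -
  obtain y z where yz: "y \<in> span S" "\<And>w. w \<in> span S \<Longrightarrow> orthogonal z w" "x = y + z"
    using orthogonal_subspace_decomp_exists[of S x] by metis
  have "orth_proj S x = y"
    using yz span_eq_iff[THEN iffD2, OF assms] by (intro orth_proj_eqI[OF assms]) auto
  then show "orth_proj S x \<in> S" "s \<in> S \<Longrightarrow> orthogonal (x - orth_proj S x) s"
    using yz span_eq_iff[THEN iffD2, OF assms] by auto
qed

lemma linear_orth_proj:
  assumes "subspace S"
  shows "linear (orth_proj S)"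
proof (rule linearI)
  note p = orth_proj[OF assms]
  show "orth_proj S (x + y) = orth_proj S x + orth_proj S y" for x y
  proof (rule orth_proj_eqI[OF assms])
    show "orthogonal (x + y - (orth_proj S x + orth_proj S y)) s" if "s \<in> S" for s
      using p(2)[OF that, of x] p(2)[OF that, of y] by (simp add: orthogonal_def inner_diff inner_add)
  qed (simp add: assms subspace_add p)
  show "orth_proj S (c *\<^sub>R x) = c *\<^sub>R orth_proj S x" for c x
  proof (rule orth_proj_eqI[OF assms])
    show "orthogonal (c *\<^sub>R x - c *\<^sub>R orth_proj S x) s" if "s \<in> S" for s
      using p(2)[OF that, of x] by (simp add: orthogonal_def inner_diff)
  qed (simp add: assms subspace_scale p)
qed

subsection \<open>Singular values\<close>

text \<open>The adjoint of \<open>A\<close> composed with \<open>A\<close> is diagonal in the frame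
  \<open>u\<close>, so a vector of the singular space has no component along \<open>u j\<close>
  unless the squares of \<open>s j\<close> and \<open>t\<close> agree; nonnegativity turns this into
  \<open>s j = t\<close>.\<close>

lemma singular_space_orthogonal_images:
  assumes u: "orthonormal_family I u V" and A: "linear A" and nonneg: "\<And>i. i \<in> I \<Longrightarrow> 0 \<le> s i" "0 \<le> t"
    and s: "\<And>i j. i \<in> I \<Longrightarrow> j \<in> I \<Longrightarrow> A (u i) \<bullet> A (u j) = (if i = j then (s i)\<^sup>2 else 0)"
  shows "singular_space A V t = span (u ` {i\<in>I. s i = t})"
proof
  let ?J = "{i\<in>I. s i = t}"
  note uD = orthonormal_familyD[OF u]
  have inner: "A x \<bullet> A y = (\<Sum>i\<in>I. (s i)\<^sup>2 * (x \<bullet> u i) * (y \<bullet> u i))" if "x \<in> V" "y \<in> V" for x y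
    using orthogonal_images_inner[OF u A that, of "\<lambda>i. (s i)\<^sup>2"] s by simp
  have coeff: "A x \<bullet> A (u j) = (s j)\<^sup>2 * (x \<bullet> u j)" if "x \<in> V" "j \<in> I" for x j
  proof -
    have "A x \<bullet> A (u j) = (\<Sum>i\<in>I. if i = j then (s j)\<^sup>2 * (x \<bullet> u j) else 0)"
      unfolding inner[OF that(1) uD(6)[OF that(2)]] by (intro sum.cong) (use that uD(2) in auto)
    then show ?thesis using uD(1) that by simp
  qed
  show "singular_space A V t \<subseteq> span (u ` ?J)"
  proof
    fix x assume "x \<in> singular_space A V t"
    then have x: "x \<in> V" "\<And>y. y \<in> V \<Longrightarrow> A x \<bullet> A y = t\<^sup>2 * (x \<bullet> y)" by (auto simp: singular_space_def)
    have "x \<bullet> u j = 0" if "j \<in> I" "s j \<noteq> t" for j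
    proof -
      have "(s j)\<^sup>2 \<noteq> t\<^sup>2" using nonneg that by (simp add: power2_eq_iff_nonneg)
      then show ?thesis using coeff[OF x(1) that(1)] x(2)[OF uD(6)[OF that(1)]] by simp
    qed
    then have "(\<Sum>i\<in>I. (x \<bullet> u i) *\<^sub>R u i) = (\<Sum>i\<in>?J. (x \<bullet> u i) *\<^sub>R u i)"
      using uD(1) by (intro sum.mono_neutral_right) auto
    then have "x = (\<Sum>i\<in>?J. (x \<bullet> u i) *\<^sub>R u i)" using orthonormal_family_expand[OF u x(1)] by simp
    also have "\<dots> \<in> span (u ` ?J)" by (intro span_sum span_scale span_base) auto
    finally show "x \<in> span (u ` ?J)" .
  qed
  have "u ` ?J \<subseteq> singular_space A V t"
    using coeff uD(6) by (auto simp: singular_space_def) (metis inner_commute)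
  moreover have "subspace (singular_space A V t)"
    unfolding singular_space_def using uD(5) linear_add[OF A] linear_cmul[OF A] linear_0[OF A]
    by (auto simp: subspace_def inner_add_left algebra_simps)
  ultimately show "span (u ` ?J) \<subseteq> singular_space A V t" by (rule span_minimal)
qed

text \<open>All singular values and Jordan angles below are computed from this: it suffices to
  exhibit an orthonormal frame with pairwise orthogonal images and to read off the lengths of
  these.\<close>

lemma singular_values_orthogonal_images:
  assumes u: "orthonormal_family I u V" and A: "linear A" and nonneg: "\<And>i. i \<in> I \<Longrightarrow> 0 \<le> s i"
    and s: "\<And>i j. i \<in> I \<Longrightarrow> j \<in> I \<Longrightarrow> A (u i) \<bullet> A (u j) = (if i = j then (s i)\<^sup>2 else 0)"
  shows "singular_values A V = image_mset s (mset_set I)"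
proof -
  note uD = orthonormal_familyD[OF u]
  let ?J = "\<lambda>t. {i\<in>I. s i = t}"
  have fam: "orthonormal_family (?J t) u (span (u ` ?J t))" for t
    using u by (auto simp: orthonormal_family_def)
  have sp: "singular_space A V t = span (u ` ?J t)" if "0 \<le> t" for t
    by (rule singular_space_orthogonal_images[OF u A nonneg that s])
  have dim: "dim (singular_space A V t) = card (?J t)" if "0 \<le> t" for t
    unfolding sp[OF that] using orthonormal_family_card[OF fam] by simp
  have triv: "singular_space A V t \<noteq> {0} \<longleftrightarrow> t \<in> s ` I" if "0 \<le> t" for t
  proof -
    have "subspace (singular_space A V t)"
      unfolding sp[OF that] by simp
    then have "singular_space A V t = {0} \<longleftrightarrow> card (?J t) = 0"
      unfolding dim[OF that, symmetric] by (auto simp: subspace_0)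
    then show ?thesis using uD(1) by auto
  qed
  have "{t. 0 \<le> t \<and> singular_space A V t \<noteq> {0}} = s ` I"
    using triv nonneg by auto
  then have "singular_values A V = (\<Sum>t\<in>s ` I. replicate_mset (card (?J t)) t)"
    unfolding singular_values_def by (intro sum.cong) (auto simp: dim nonneg)
  also have "\<dots> = image_mset s (mset_set I)"
  proof (rule multiset_eqI)
    fix t
    have "count (\<Sum>t\<in>s ` I. replicate_mset (card (?J t)) t) t = (\<Sum>r\<in>s ` I. if r = t then card (?J t) else 0)"
      unfolding count_sum by (intro sum.cong) auto
    also have "\<dots> = card (?J t)" using uD(1) by auto
    also have "\<dots> = count (image_mset s (mset_set I)) t"
    proof -
      have "{x \<in> set_mset (mset_set I). t = s x} = ?J t" using uD(1) by auto
      moreover have "(\<Sum>x\<in>?J t. count (mset_set I) x) = (\<Sum>x\<in>?J t. 1)"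
        using uD(1) by (intro sum.cong) auto
      ultimately show ?thesis by (simp add: count_image_mset')
    qed
    finally show "count (\<Sum>t\<in>s ` I. replicate_mset (card (?J t)) t) t = count (image_mset s (mset_set I)) t" .
  qed
  finally show ?thesis .
qed

text \<open>A unit vector that maximizes the length of its image has, by first variation, an image
  orthogonal to the images of its orthogonal complement in \<open>V\<close>. Induction on the
  dimension treats that complement.\<close>

lemma exists_orthogonal_images:
  fixes A :: "'e::euclidean_space \<Rightarrow> 'f::euclidean_space"
  assumes "linear A" "subspace V"
  obtains B where "orthonormal_basis B V" "\<And>b c. b \<in> B \<Longrightarrow> c \<in> B \<Longrightarrow> b \<noteq> c \<Longrightarrow> A b \<bullet> A c = 0"
proof -
  have "\<exists>B. orthonormal_basis B V \<and> (\<forall>b\<in>B. \<forall>c\<in>B. b \<noteq> c \<longrightarrow> A b \<bullet> A c = 0)"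
    using assms(2)
  proof (induction "dim V" arbitrary: V rule: less_induct)
    case less
    show ?case
    proof (cases "V = {0}")
      case True
      then show ?thesis by (intro exI[of _ "{}"]) (auto simp: orthonormal_basis_def)
    next
      case False
      let ?K = "V \<inter> sphere 0 1"
      obtain v where v: "v \<in> V" "v \<noteq> 0" using False less.prems by (auto simp: subspace_0)
      then have "v /\<^sub>R norm v \<in> ?K" using less.prems by (auto simp: subspace_scale)
      then have ne: "?K \<noteq> {}" by blast
      have "compact ?K" using closed_subspace[OF less.prems] by (simp add: closed_Int_compact)
      moreover have "continuous_on ?K (\<lambda>x. A x \<bullet> A x)"
        by (intro continuous_intros linear_continuous_on linear_conv_bounded_linear[THEN iffD1] assms(1))
      ultimately obtain b where b: "b \<in> ?K" and max: "\<And>x. x \<in> ?K \<Longrightarrow> A x \<bullet> A x \<le> A b \<bullet> A b"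
        using continuous_attains_sup[OF _ ne] by blast
      have bound: "A x \<bullet> A x \<le> (A b \<bullet> A b) * (x \<bullet> x)" if "x \<in> V" for x
      proof (cases "x = 0")
        case True
        then show ?thesis by (simp add: linear_0[OF assms(1)])
      next
        case False
        have "x /\<^sub>R norm x \<in> ?K" using that False less.prems by (auto simp: subspace_scale)
        from max[OF this] have "(A x \<bullet> A x) / (norm x)\<^sup>2 \<le> A b \<bullet> A b"
          by (simp add: linear_cmul[OF assms(1)] power2_eq_square divide_inverse mult_ac)
        then show ?thesis using False by (simp add: power2_norm_eq_inner field_simps)
      qed
      \<comment> \<open>The first variation of \<open>|A x|\<^sup>2 / |x|\<^sup>2\<close> vanishes at the maximum.\<close>
      have crit: "A b \<bullet> A w = 0" if w: "w \<in> V" "b \<bullet> w = 0" for w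
      proof -
        define a where "a = A b \<bullet> A w"
        define c where "c = (A b \<bullet> A b) * (w \<bullet> w)"
        have ineq: "2 * t * a \<le> t\<^sup>2 * c" for t
        proof -
          have "b + t *\<^sub>R w \<in> V" using b w less.prems by (auto simp: subspace_add subspace_scale)
          from bound[OF this] have "A b \<bullet> A b + 2 * t * a + t\<^sup>2 * (A w \<bullet> A w) \<le> (A b \<bullet> A b) * (1 + t\<^sup>2 * (w \<bullet> w))"
            using b w by (simp add: linear_add[OF assms(1)] linear_cmul[OF assms(1)] inner_add a_def
                power2_eq_square inner_commute norm_eq_1 algebra_simps)
          moreover have "0 \<le> t\<^sup>2 * (A w \<bullet> A w)" by simp
          ultimately have "A b \<bullet> A b + 2 * t * a \<le> (A b \<bullet> A b) * (1 + t\<^sup>2 * (w \<bullet> w))" by linarith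
          then show ?thesis by (simp add: c_def algebra_simps)
        qed
        have c0: "0 \<le> c" by (simp add: c_def)
        have "a * a \<le> 0"
        proof -
          \<comment> \<open>For this small \<open>t\<close> the linear term beats the quadratic one;
            the summand 1 avoids division by zero.\<close>
          have "2 * (a / (c + 1)) * a \<le> (a / (c + 1))\<^sup>2 * c" by (rule ineq)
          also have "\<dots> \<le> (a / (c + 1))\<^sup>2 * (c + 1)" by (intro mult_left_mono) auto
          also have "\<dots> = (a / (c + 1)) * a" using c0 by (simp add: power2_eq_square field_simps add_nonneg_eq_0_iff)
          finally have "(a * a) / (c + 1) + (a * a) / (c + 1) \<le> (a * a) / (c + 1)" by (simp add: mult_ac)
          then have "(a * a) / (c + 1) \<le> 0" by linarith
          then show ?thesis using c0 by (simp add: divide_le_0_iff)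
        qed
        then show ?thesis unfolding a_def[symmetric] by (metis mult_eq_0_iff not_square_less_zero order_le_less)
      qed
      define W where "W = {w \<in> V. b \<bullet> w = 0}"
      have W: "subspace W" using less.prems unfolding W_def by (auto simp: subspace_def inner_add_right)
      have "b \<notin> W" using b by (auto simp: W_def norm_eq_1)
      moreover have "W \<subseteq> V" by (auto simp: W_def)
      ultimately have "W \<subset> V" using b by blast
      then have "dim W < dim V" using W less.prems by (metis dim_psubset span_eq_iff)
      from less.hyps[OF this W] obtain B where B: "orthonormal_basis B W"
        "\<forall>b\<in>B. \<forall>c\<in>B. b \<noteq> c \<longrightarrow> A b \<bullet> A c = 0" by blast
      have BW: "B \<subseteq> W" using B(1) span_superset by (auto simp: orthonormal_basis_def)
      have "span (insert b B) = V"
      proof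
        show "span (insert b B) \<subseteq> V" using b BW less.prems by (intro span_minimal) (auto simp: W_def)
        show "V \<subseteq> span (insert b B)"
        proof
          fix x assume "x \<in> V"
          then have "x - (x \<bullet> b) *\<^sub>R b \<in> W" using b less.prems
            by (auto simp: W_def subspace_diff subspace_scale inner_diff_right inner_commute norm_eq_1)
          then have "x - (x \<bullet> b) *\<^sub>R b \<in> span B" using B(1) by (simp add: orthonormal_basis_def)
          then have "x - (x \<bullet> b) *\<^sub>R b \<in> span (insert b B)" using span_mono[of B "insert b B"] by blast
          moreover have "(x \<bullet> b) *\<^sub>R b \<in> span (insert b B)" by (intro span_scale span_base) auto
          ultimately have "x - (x \<bullet> b) *\<^sub>R b + (x \<bullet> b) *\<^sub>R b \<in> span (insert b B)"
            by (rule span_add)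
          then show "x \<in> span (insert b B)" by simp
        qed
      qed
      then have "orthonormal_basis (insert b B) V"
        using B(1) BW b by (auto simp: orthonormal_basis_def pairwise_insert W_def orthogonal_def inner_commute)
      moreover have "\<forall>x\<in>insert b B. \<forall>y\<in>insert b B. x \<noteq> y \<longrightarrow> A x \<bullet> A y = 0"
        using B(2) BW crit by (auto simp: W_def inner_commute)
      ultimately show ?thesis by blast
    qed
  qed
  then show ?thesis using that by blast
qed

section \<open>Curves\<close>

lemma vector_derivative_cong_open:
  assumes "open S" "t \<in> S" "\<And>s. s \<in> S \<Longrightarrow> g s = h s"
  shows "vector_derivative g (at t) = vector_derivative h (at t)"
  using assms by (intro vector_derivative_cong_eq) (auto simp: eventually_nhds)

lemma velocity_cong:
  assumes "\<epsilon> > 0" "\<And>s. s \<in> {-\<epsilon><..<\<epsilon>} \<Longrightarrow> g s = h s"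
  shows "velocity g = velocity h"
  unfolding velocity_def by (rule vector_derivative_cong_open[of "{-\<epsilon><..<\<epsilon>}"]) (use assms in auto)

lemma acceleration_cong:
  assumes "\<epsilon> > 0" "\<And>s. s \<in> {-\<epsilon><..<\<epsilon>} \<Longrightarrow> g s = h s"
  shows "acceleration g = acceleration h"
  unfolding acceleration_def
  by (rule vector_derivative_cong_open[of "{-\<epsilon><..<\<epsilon>}"], (use assms(1) in auto)[2],
      rule vector_derivative_cong_open[of "{-\<epsilon><..<\<epsilon>}"]) (use assms in auto)

lemma smooth_curve_vector_derivative:
  fixes c :: "real \<Rightarrow> 'e::euclidean_space"
  assumes "smooth_on S c" "open S" "t \<in> S"
  shows "vector_derivative c (at t) = frechet_derivative c (at t) 1"
    and "(c has_vector_derivative vector_derivative c (at t)) (at t)"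
proof -
  have "c differentiable (at t)" using smooth_on_has_derivative[OF assms] by (auto simp: differentiable_def)
  then show 1: "(c has_vector_derivative vector_derivative c (at t)) (at t)"
    by (simp add: vector_derivative_works)
  then show "vector_derivative c (at t) = frechet_derivative c (at t) 1"
    unfolding has_vector_derivative_def using frechet_derivative_eqI by fastforce
qed

lemma smooth_on_vector_derivative:
  fixes c :: "real \<Rightarrow> 'e::euclidean_space"
  assumes "smooth_on S c" "open S"
  shows "smooth_on S (\<lambda>t. vector_derivative c (at t))"
  by (rule smooth_on_cong[OF assms(2) smooth_on_frechet_derivative[OF assms(1), of 1]])
    (simp add: smooth_curve_vector_derivative[OF assms])

lemma vector_derivative_compose_smooth:
  fixes c :: "real \<Rightarrow> 'e::euclidean_space" and F :: "'e \<Rightarrow> 'f::euclidean_space"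
  assumes F: "smooth_on U F" "open U" and c: "smooth_on S c" "open S" and t: "t \<in> S" "c t \<in> U"
  shows "((\<lambda>t. F (c t)) has_vector_derivative frechet_derivative F (at (c t)) (vector_derivative c (at t))) (at t)"
proof -
  note dF = smooth_on_has_derivative[OF F t(2)]
  have "(c has_derivative (\<lambda>s. s *\<^sub>R vector_derivative c (at t))) (at t)"
    using smooth_curve_vector_derivative(2)[OF c t(1)] by (simp add: has_vector_derivative_def)
  from has_derivative_compose[OF this dF] show ?thesis
    by (simp add: has_vector_derivative_def linear_cmul[OF has_derivative_linear[OF dF]])
qed

lemma velocity_compose:
  fixes c :: "real \<Rightarrow> 'e::euclidean_space" and F :: "'e \<Rightarrow> 'f::euclidean_space"
  assumes F: "smooth_on U F" "open U" and c: "smooth_on {-\<epsilon><..<\<epsilon>} c" "\<epsilon> > 0" and "c 0 \<in> U"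
  shows "velocity (\<lambda>t. F (c t)) = frechet_derivative F (at (c 0)) (velocity c)"
  unfolding velocity_def
  by (rule vector_derivative_at[OF vector_derivative_compose_smooth[OF F c(1)]]) (use assms in auto)

text \<open>Both the base point and the direction of the first derivative vary in \<open>t\<close>.
  Expanded over \<open>Basis\<close>, the velocity is a sum of scalars times derivatives in fixed
  directions, and the product rule yields the two terms.\<close>

lemma acceleration_compose:
  fixes c :: "real \<Rightarrow> 'e::euclidean_space" and F :: "'e \<Rightarrow> 'f::euclidean_space"
  assumes F: "smooth_on U F" "open U" and c: "smooth_on {-\<epsilon><..<\<epsilon>} c" "\<epsilon> > 0" and img: "c ` {-\<epsilon><..<\<epsilon>} \<subseteq> U"
  shows "acceleration (\<lambda>t. F (c t)) =
    D2 F (c 0) (velocity c) (velocity c) + frechet_derivative F (at (c 0)) (acceleration c)"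
proof -
  let ?S = "{-\<epsilon><..<\<epsilon>}"
  let ?D = "\<lambda>y. frechet_derivative F (at y)"
  define c' where "c' = (\<lambda>t. vector_derivative c (at t))"
  have 0: "0 \<in> ?S" "c 0 \<in> U" using c(2) img by auto
  have c': "smooth_on ?S c'" unfolding c'_def by (rule smooth_on_vector_derivative[OF c(1)]) simp
  have d0: "(c' has_vector_derivative acceleration c) (at 0)"
    using smooth_curve_vector_derivative(2)[OF c' _ 0(1)] by (simp add: acceleration_def c'_def)
  have d1: "vector_derivative (\<lambda>t. F (c t)) (at t) = (\<Sum>b\<in>Basis. (c' t \<bullet> b) *\<^sub>R ?D (c t) b)" if "t \<in> ?S" for t
  proof -
    have ct: "c t \<in> U" using that img by blast
    have "vector_derivative (\<lambda>t. F (c t)) (at t) = ?D (c t) (c' t)"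
      unfolding c'_def by (rule vector_derivative_at[OF vector_derivative_compose_smooth[OF F c(1)]]) (use that ct in auto)
    then show ?thesis
      using linear_sum_Basis[OF has_derivative_linear[OF smooth_on_has_derivative[OF F ct]]] by metis
  qed
  have db: "((\<lambda>t. ?D (c t) b) has_vector_derivative D2 F (c 0) (c' 0) b) (at 0)" for b
    using vector_derivative_compose_smooth[OF smooth_on_frechet_derivative[OF F(1)] F(2) c(1) _ 0]
    by (simp add: D2_def c'_def)
  have "((\<lambda>t. \<Sum>b\<in>Basis. (c' t \<bullet> b) *\<^sub>R ?D (c t) b) has_vector_derivative
     (\<Sum>b\<in>Basis. (c' 0 \<bullet> b) *\<^sub>R D2 F (c 0) (c' 0) b + (acceleration c \<bullet> b) *\<^sub>R ?D (c 0) b)) (at 0)"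
  proof (intro has_vector_derivative_sum has_vector_derivative_scaleR db)
    fix b :: 'e
    show "((\<lambda>t. c' t \<bullet> b) has_real_derivative acceleration c \<bullet> b) (at 0)"
      using bounded_linear.has_vector_derivative[OF bounded_linear_inner_left d0]
      by (simp add: has_real_derivative_iff_has_vector_derivative)
  qed
  then have "acceleration (\<lambda>t. F (c t)) =
     (\<Sum>b\<in>Basis. (c' 0 \<bullet> b) *\<^sub>R D2 F (c 0) (c' 0) b + (acceleration c \<bullet> b) *\<^sub>R ?D (c 0) b)"
    unfolding acceleration_def[of "\<lambda>t. F (c t)"]
    by (subst vector_derivative_cong_open[OF _ 0(1) d1]) (auto intro: vector_derivative_at)
  also have "\<dots> = D2 F (c 0) (c' 0) (c' 0) + ?D (c 0) (acceleration c)"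
    by (simp add: sum.distrib D2_expand_right[OF F 0(2), of "c' 0" "c' 0", symmetric]
        linear_sum_Basis[OF has_derivative_linear[OF smooth_on_has_derivative[OF F 0(2)]], symmetric])
  finally show ?thesis by (simp add: c'_def velocity_def)
qed

section \<open>Graphs of maps that are homogeneous of degree one\<close>

locale conic_graph =
  fixes F :: "'e::euclidean_space \<Rightarrow> 'f::euclidean_space"
  assumes smooth_F: "smooth_on (- {0}) F"
    and homogeneous: "\<And>c y. c > 0 \<Longrightarrow> F (c *\<^sub>R y) = c *\<^sub>R F y"
begin

abbreviation "DF y \<equiv> frechet_derivative F (at y)"

definition G :: "'e \<Rightarrow> 'e \<times> 'f" where "G y = (y, F y)"
definition DG :: "'e \<Rightarrow> 'e \<Rightarrow> 'e \<times> 'f" where "DG y v = (v, DF y v)"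
text \<open>The normal space of the cone at \<open>G y\<close>. It will also be the normal plane of
  the link in its sphere, so that both kinds of normal planes share one description.\<close>

definition N :: "'e \<Rightarrow> ('e \<times> 'f) set" where "N y = {z. \<forall>v. orthogonal z (DG y v)}"

lemma F_has_derivative: "y \<noteq> 0 \<Longrightarrow> (F has_derivative DF y) (at y)"
  by (rule smooth_on_has_derivative[OF smooth_F]) auto

lemma linear_DF: "y \<noteq> 0 \<Longrightarrow> linear (DF y)"
  using F_has_derivative has_derivative_linear by blast

lemma linear_DG: "y \<noteq> 0 \<Longrightarrow> linear (DG y)"
  using linear_DF[of y] by (auto intro!: linearI simp: DG_def linear_add linear_cmul)

lemma smooth_G: "smooth_on (- {0}) G"
  unfolding G_def by (intro smooth_intros smooth_F) auto

lemma G_has_derivative: "y \<noteq> 0 \<Longrightarrow> (G has_derivative DG y) (at y)"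
  unfolding G_def DG_def by (intro derivative_intros F_has_derivative)

lemma frechet_derivative_G: "y \<noteq> 0 \<Longrightarrow> frechet_derivative G (at y) v = DG y v"
  by (rule frechet_derivative_eqI[OF G_has_derivative])

lemma D2_G: "y \<noteq> 0 \<Longrightarrow> D2 G y u v = (0, D2 F y u v)"
  unfolding D2_def[of G]
proof (rule frechet_derivative_eqI)
  assume "y \<noteq> 0"
  then have "((\<lambda>z. DG z v) has_derivative (\<lambda>u. (0, D2 F y u v))) (at y)"
    unfolding DG_def by (auto intro!: derivative_intros D2_has_derivative[OF smooth_F])
  then show "((\<lambda>z. frechet_derivative G (at z) v) has_derivative (\<lambda>u. (0, D2 F y u v))) (at y)"
    by (rule has_derivative_transform_within_open[of _ _ _ _ "- {0}"]) (use \<open>y \<noteq> 0\<close> frechet_derivative_G in auto)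
qed

text \<open>Euler's identity for degree one; geometrically, the position vector is tangent to the
  cone.\<close>

lemma DG_self:
  assumes "y \<noteq> 0"
  shows "DG y y = G y"
proof -
  have "((\<lambda>t. G (y + t *\<^sub>R y)) has_vector_derivative DG y y) (at 0)"
    using has_derivative_line[of G "DG y" y 0 y] G_has_derivative[OF assms] by simp
  moreover have "((\<lambda>t. G (y + t *\<^sub>R y)) has_vector_derivative G y) (at 0)"
  proof (rule has_vector_derivative_transform_within_open)
    show "((\<lambda>t. (1 + t) *\<^sub>R G y) has_vector_derivative G y) (at 0)"
      by (auto intro!: derivative_eq_intros)
    show "(1 + t) *\<^sub>R G y = G (y + t *\<^sub>R y)" if "t \<in> {-1<..}" for t
      using homogeneous[of "1 + t" y] that by (simp add: G_def algebra_simps)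
  qed auto
  ultimately show ?thesis using vector_derivative_unique_at by blast
qed

lemma DF_scale:
  assumes "c > 0" "y \<noteq> 0"
  shows "DF (c *\<^sub>R y) v = DF y v"
proof -
  have "((\<lambda>z. (1 / c) *\<^sub>R F (c *\<^sub>R z)) has_derivative (\<lambda>v. (1 / c) *\<^sub>R DF (c *\<^sub>R y) (c *\<^sub>R v))) (at y)"
    by (intro has_derivative_scaleR_right has_derivative_compose[OF _ F_has_derivative])
      (use assms in \<open>auto intro!: derivative_eq_intros\<close>)
  moreover have "(\<lambda>z. (1 / c) *\<^sub>R F (c *\<^sub>R z)) = F" using homogeneous[of c] assms(1) by auto
  ultimately have "DF y v = (1 / c) *\<^sub>R DF (c *\<^sub>R y) (c *\<^sub>R v)" using frechet_derivative_eqI by fastforce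
  then show ?thesis using assms linear_cmul[OF linear_DF[of "c *\<^sub>R y"]] by simp
qed

lemma D2_scale:
  assumes "c > 0" "y \<noteq> 0"
  shows "D2 F (c *\<^sub>R y) u v = (1 / c) *\<^sub>R D2 F y u v"
proof -
  have "((\<lambda>z. DF (c *\<^sub>R z) v) has_derivative (\<lambda>u. D2 F (c *\<^sub>R y) (c *\<^sub>R u) v)) (at y)"
    by (rule has_derivative_compose[OF _ D2_has_derivative[OF smooth_F]])
      (use assms in \<open>auto intro!: derivative_eq_intros\<close>)
  then have "((\<lambda>z. DF z v) has_derivative (\<lambda>u. D2 F (c *\<^sub>R y) (c *\<^sub>R u) v)) (at y)"
    by (rule has_derivative_transform_within_open[of _ _ _ _ "- {0}"]) (use assms DF_scale in auto)
  then have "D2 F y u v = D2 F (c *\<^sub>R y) (c *\<^sub>R u) v"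
    unfolding D2_def[of F y] by (rule frechet_derivative_eqI)
  also have "\<dots> = c *\<^sub>R D2 F (c *\<^sub>R y) u v"
    by (rule linear_cmul[OF D2_linear_left[OF smooth_F]]) (use assms in auto)
  finally show ?thesis using assms by simp
qed

text \<open>The first derivative is constant along rays. As a consequence the radial direction can
  be added to any trace over the link without changing it.\<close>

lemma D2_radial:
  assumes "y \<noteq> 0"
  shows "D2 F y y v = 0"
proof -
  have "((\<lambda>t. DF (y + t *\<^sub>R y) v) has_vector_derivative D2 F y y v) (at 0)"
    using has_derivative_line[of "\<lambda>z. DF z v" "\<lambda>u. D2 F y u v" y 0 y] D2_has_derivative[OF smooth_F open_Compl[OF closed_singleton], of y] assms
    by simp
  moreover have "((\<lambda>t. DF (y + t *\<^sub>R y) v) has_vector_derivative 0) (at 0)"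
  proof (rule has_vector_derivative_transform_within_open)
    show "((\<lambda>t. DF y v) has_vector_derivative 0) (at 0)" by simp
    show "DF y v = DF (y + t *\<^sub>R y) v" if "t \<in> {-1<..}" for t
      using DF_scale[of "1 + t" y v] that assms by (simp add: algebra_simps)
  qed auto
  ultimately show ?thesis using vector_derivative_unique_at by blast
qed

lemma subspace_N: "subspace (N y)"
  unfolding N_def by (auto simp: subspace_def orthogonal_clauses)

text \<open>In finite dimension the double orthogonal complement of a subspace is the subspace
  itself.\<close>

lemma orthogonal_N_imp_tangent:
  assumes "y \<noteq> 0" "\<And>z. z \<in> N y \<Longrightarrow> orthogonal w z"
  shows "w \<in> range (DG y)"
proof -
  have sub: "subspace (range (DG y))" using linear_subspace_image[OF linear_DG[OF assms(1)] subspace_UNIV] .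
  obtain a b where ab: "a \<in> span (range (DG y))" "\<And>v. v \<in> span (range (DG y)) \<Longrightarrow> orthogonal b v" "w = a + b"
    using orthogonal_subspace_decomp_exists[of "range (DG y)" w] by metis
  have "b \<in> N y" using ab(2) by (auto simp: N_def span_base)
  then have "orthogonal w b" by (rule assms(2))
  moreover have "orthogonal a b" using ab(1,2) orthogonal_commute by blast
  ultimately have "b \<bullet> b = 0" using ab(3) by (simp add: orthogonal_def inner_add)
  then show ?thesis using ab span_eq_iff[THEN iffD2, OF sub] by simp
qed

subsection \<open>Curves in the graph\<close>

lemma curve_in_graph:
  assumes "curve_at M q \<gamma>" "M \<subseteq> range G"
  obtains \<epsilon> where "\<epsilon> > 0" "smooth_on {-\<epsilon><..<\<epsilon>} (\<lambda>t. fst (\<gamma> t))"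
    "\<And>t. t \<in> {-\<epsilon><..<\<epsilon>} \<Longrightarrow> \<gamma> t = G (fst (\<gamma> t))" "\<And>t. t \<in> {-\<epsilon><..<\<epsilon>} \<Longrightarrow> \<gamma> t \<in> M"
proof -
  obtain \<epsilon> where e: "\<epsilon> > 0" "smooth_on {-\<epsilon><..<\<epsilon>} \<gamma>" "\<gamma> ` {-\<epsilon><..<\<epsilon>} \<subseteq> M"
    using assms(1) unfolding curve_at_def by blast
  show thesis
  proof (rule that[OF e(1)])
    show "smooth_on {-\<epsilon><..<\<epsilon>} (\<lambda>t. fst (\<gamma> t))"
      by (rule smooth_on_bounded_linear[OF _ bounded_linear_fst e(2)]) simp
    show "\<gamma> t = G (fst (\<gamma> t))" "\<gamma> t \<in> M" if "t \<in> {-\<epsilon><..<\<epsilon>}" for t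
    proof -
      show "\<gamma> t \<in> M" using e(3) that by blast
      then show "\<gamma> t = G (fst (\<gamma> t))" using assms(2) by (auto simp: G_def)
    qed
  qed
qed

text \<open>\<open>F\<close> is smooth only off the origin, so the chain rule needs a shorter
  interval on which the base curve does not vanish.\<close>

lemma curve_avoiding_zero:
  fixes k :: "real \<Rightarrow> 'e"
  assumes "smooth_on {-\<epsilon><..<\<epsilon>} k" "\<epsilon> > 0" "k 0 \<noteq> 0"
  obtains \<delta> where "0 < \<delta>" "\<delta> \<le> \<epsilon>" "k ` {-\<delta><..<\<delta>} \<subseteq> - {0}"
proof -
  have "continuous_on {-\<epsilon><..<\<epsilon>} k" using assms(1) by (rule smooth_on_continuous)
  then have "open ({-\<epsilon><..<\<epsilon>} \<inter> k -` (- {0}))" by (rule continuous_open_preimage) auto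
  moreover have "0 \<in> {-\<epsilon><..<\<epsilon>} \<inter> k -` (- {0})" using assms(2,3) by auto
  ultimately obtain \<delta> where "\<delta> > 0" "ball 0 \<delta> \<subseteq> {-\<epsilon><..<\<epsilon>} \<inter> k -` (- {0})"
    using openE by blast
  then have "\<delta> > 0" "\<And>t. dist t 0 < \<delta> \<Longrightarrow> k t \<noteq> 0" by (auto simp: dist_commute subset_iff)
  then show thesis using assms(2) by (intro that[of "min \<delta> \<epsilon>"]) auto
qed

text \<open>A curve in a graph is the lift of its base curve. The second derivative of
  \<open>G\<close> has no horizontal part, so the acceleration splits into a vertical vector and a
  tangent one.\<close>

lemma velocity_in_graph:
  assumes \<gamma>: "curve_at M (G y) \<gamma>" and M: "M \<subseteq> range G" and y: "y \<noteq> 0"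
  shows "velocity \<gamma> = DG y (velocity (\<lambda>t. fst (\<gamma> t)))"
    and "acceleration \<gamma> = (0, D2 F y (velocity (\<lambda>t. fst (\<gamma> t))) (velocity (\<lambda>t. fst (\<gamma> t))))
           + DG y (acceleration (\<lambda>t. fst (\<gamma> t)))"
proof -
  let ?k = "\<lambda>t. fst (\<gamma> t)"
  obtain \<epsilon> where e: "\<epsilon> > 0" "smooth_on {-\<epsilon><..<\<epsilon>} ?k" "\<And>t. t \<in> {-\<epsilon><..<\<epsilon>} \<Longrightarrow> \<gamma> t = G (?k t)"
    using curve_in_graph[OF \<gamma> M] by metis
  have k0: "?k 0 = y" using \<gamma> by (simp add: curve_at_def G_def)
  obtain \<delta> where d: "0 < \<delta>" "\<delta> \<le> \<epsilon>" "?k ` {-\<delta><..<\<delta>} \<subseteq> - {0}"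
    using curve_avoiding_zero[OF e(2,1)] k0 y by metis
  have sm: "smooth_on {-\<delta><..<\<delta>} ?k" by (rule smooth_on_open_subset[OF e(2)]) (use d in auto)
  have eq: "\<gamma> t = G (?k t)" if "t \<in> {-\<delta><..<\<delta>}" for t using e(3) that d(2) by auto
  have U: "open (- {0::'e})" by auto
  show "velocity \<gamma> = DG y (velocity ?k)"
    using velocity_cong[OF d(1) eq] velocity_compose[OF smooth_G U sm d(1)] k0 y
    by (simp add: frechet_derivative_G)
  show "acceleration \<gamma> = (0, D2 F y (velocity ?k) (velocity ?k)) + DG y (acceleration ?k)"
    using acceleration_cong[OF d(1) eq] acceleration_compose[OF smooth_G U sm d(1,3)] k0 y
    by (simp add: frechet_derivative_G D2_G)
qed

lemma tangent_space_cone: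
  assumes y: "y \<noteq> 0"
  shows "tangent_space (range G) (G y) = range (DG y)"
proof
  show "tangent_space (range G) (G y) \<subseteq> range (DG y)"
    unfolding tangent_space_def using velocity_in_graph(1)[OF _ _ y] by auto
  show "range (DG y) \<subseteq> tangent_space (range G) (G y)"
  proof
    fix z assume "z \<in> range (DG y)"
    then obtain v where v: "z = DG y v" by blast
    let ?k = "\<lambda>t::real. y + t *\<^sub>R v"
    have sm: "smooth_on UNIV ?k" by (intro smooth_intros) auto
    then have sm1: "smooth_on {-1<..<1} ?k" by (rule smooth_on_open_subset) simp
    obtain \<delta> where d: "0 < \<delta>" "?k ` {-\<delta><..<\<delta>} \<subseteq> - {0}"
      using curve_avoiding_zero[OF sm1] y by auto
    have smd: "smooth_on {-\<delta><..<\<delta>} ?k" by (rule smooth_on_open_subset[OF sm]) simp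
    have U: "open (- {0::'e})" by auto
    have "smooth_on {-\<delta><..<\<delta>} (\<lambda>t. G (?k t))"
      by (rule smooth_on_compose[OF _ U smooth_G smd d(2)]) simp
    then have "curve_at (range G) (G y) (\<lambda>t. G (?k t))"
      unfolding curve_at_def using d by auto
    moreover have "velocity ?k = v"
      unfolding velocity_def by (rule vector_derivative_at) (auto intro!: derivative_eq_intros)
    then have "velocity (\<lambda>t. G (?k t)) = z"
      using velocity_compose[OF smooth_G U smd d(1)] y by (simp add: frechet_derivative_G v)
    ultimately show "z \<in> tangent_space (range G) (G y)" unfolding tangent_space_def by force
  qed
qed

lemma normal_plane_cone: "y \<noteq> 0 \<Longrightarrow> normal_plane (range G) (G y) = N y"
  unfolding normal_plane_def N_def by (simp add: tangent_space_cone)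

text \<open>The line through \<open>y\<close> in the direction \<open>v\<close> is rescaled to
  constant norm. Orthogonality keeps the line away from the origin and makes its norm stationary at
  0, so the rescaled curve still has velocity \<open>v\<close>.\<close>

lemma exists_curve_in_sphere:
  assumes y: "y \<noteq> 0" and v: "orthogonal y v"
  obtains \<gamma> where "curve_at (G ` sphere 0 (norm y)) (G y) \<gamma>" "velocity \<gamma> = DG y v"
proof -
  let ?k = "\<lambda>t::real. (norm y * inverse (norm (y + t *\<^sub>R v))) *\<^sub>R (y + t *\<^sub>R v)"
  have nz: "y + t *\<^sub>R v \<noteq> 0" for t
  proof
    assume "y + t *\<^sub>R v = 0"
    then have "y \<bullet> (y + t *\<^sub>R v) = 0" by simp
    then show False using v y by (simp add: orthogonal_def inner_add_right)
  qed
  have sm: "smooth_on UNIV ?k" by (intro smooth_intros nz) (use nz in auto)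
  have k0: "?k 0 = y" using y by simp
  have knz: "?k t \<noteq> 0" for t using nz y by simp
  have "((\<lambda>t. norm (y + t *\<^sub>R v)) has_real_derivative sgn y \<bullet> v) (at 0)"
    using has_derivative_line[OF has_derivative_norm, of y 0 v] y
    by (simp add: has_real_derivative_iff_has_vector_derivative inner_commute)
  then have nd: "((\<lambda>t. norm (y + t *\<^sub>R v)) has_real_derivative 0) (at 0)"
    using v by (simp add: sgn_div_norm orthogonal_def)
  have "((\<lambda>t. norm y * inverse (norm (y + t *\<^sub>R v))) has_real_derivative 0) (at 0)"
    by (rule derivative_eq_intros nd refl)+ (use y in auto)
  then have "(?k has_vector_derivative v) (at 0)"
    by (rule has_vector_derivative_scaleR[THEN has_vector_derivative_eq_rhs])
       (use y in \<open>auto intro!: derivative_eq_intros\<close>)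
  then have vel: "velocity ?k = v" unfolding velocity_def by (rule vector_derivative_at)
  have U: "open (- {0::'e})" by auto
  have sm1: "smooth_on {-1<..<1} ?k" by (rule smooth_on_open_subset[OF sm]) simp
  show thesis
  proof (rule that[of "\<lambda>t. G (?k t)"])
    have "smooth_on {-1<..<1} (\<lambda>t. G (?k t))"
      by (rule smooth_on_compose[OF _ U smooth_G sm1]) (use knz in auto)
    moreover have "?k t \<in> sphere 0 (norm y)" for t using nz y by simp
    ultimately show "curve_at (G ` sphere 0 (norm y)) (G y) (\<lambda>t. G (?k t))"
      unfolding curve_at_def k0 by (intro conjI exI[of _ 1]) auto
    show "velocity (\<lambda>t. G (?k t)) = DG y v"
      using velocity_compose[OF smooth_G U sm1] y unfolding k0 vel by (simp add: frechet_derivative_G)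
  qed
qed

lemma velocity_in_sphere:
  fixes k :: "real \<Rightarrow> 'e"
  assumes "smooth_on {-\<epsilon><..<\<epsilon>} k" "\<epsilon> > 0" "\<And>t. t \<in> {-\<epsilon><..<\<epsilon>} \<Longrightarrow> norm (k t) = r"
  shows "orthogonal (k 0) (velocity k)"
proof -
  have "(k has_vector_derivative velocity k) (at 0)"
    unfolding velocity_def by (rule smooth_curve_vector_derivative(2)[OF assms(1)]) (use assms(2) in auto)
  then have "((\<lambda>t. k t \<bullet> k t) has_vector_derivative k 0 \<bullet> velocity k + velocity k \<bullet> k 0) (at 0)"
    by (intro bounded_bilinear.has_vector_derivative[OF bounded_bilinear_inner])
  moreover have "((\<lambda>t. k t \<bullet> k t) has_vector_derivative 0) (at 0)"
  proof (rule has_vector_derivative_transform_within_open)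
    show "((\<lambda>t. r\<^sup>2) has_vector_derivative 0) (at 0)" by simp
    show "r\<^sup>2 = k t \<bullet> k t" if "t \<in> {-\<epsilon><..<\<epsilon>}" for t
      using assms(3)[OF that] by (simp add: power2_norm_eq_inner[symmetric])
  qed (use assms(2) in auto)
  ultimately have "k 0 \<bullet> velocity k + velocity k \<bullet> k 0 = 0" using vector_derivative_unique_at by blast
  then show ?thesis by (simp add: orthogonal_def inner_commute)
qed

lemma tangent_space_link:
  assumes y: "y \<noteq> 0"
  shows "tangent_space (G ` sphere 0 (norm y)) (G y) = DG y ` {v. orthogonal y v}"
proof
  let ?M = "G ` sphere 0 (norm y)"
  show "tangent_space ?M (G y) \<subseteq> DG y ` {v. orthogonal y v}"
  proof
    fix z assume "z \<in> tangent_space ?M (G y)"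
    then obtain \<gamma> where \<gamma>: "curve_at ?M (G y) \<gamma>" "velocity \<gamma> = z" by (auto simp: tangent_space_def)
    have M: "?M \<subseteq> range G" by blast
    obtain \<epsilon> where e: "\<epsilon> > 0" "smooth_on {-\<epsilon><..<\<epsilon>} (\<lambda>t. fst (\<gamma> t))" "\<And>t. t \<in> {-\<epsilon><..<\<epsilon>} \<Longrightarrow> \<gamma> t \<in> ?M"
      using curve_in_graph[OF \<gamma>(1) M] by metis
    have "orthogonal (fst (\<gamma> 0)) (velocity (\<lambda>t. fst (\<gamma> t)))"
      by (rule velocity_in_sphere[OF e(2,1), of "norm y"]) (use e(3) in \<open>force simp: G_def\<close>)
    moreover have "fst (\<gamma> 0) = y" using \<gamma>(1) by (simp add: curve_at_def G_def)
    ultimately show "z \<in> DG y ` {v. orthogonal y v}"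
      using velocity_in_graph(1)[OF \<gamma>(1) M y] \<gamma>(2) by auto
  qed
  show "DG y ` {v. orthogonal y v} \<subseteq> tangent_space ?M (G y)"
  proof
    fix z assume "z \<in> DG y ` {v. orthogonal y v}"
    then obtain v where v: "z = DG y v" "orthogonal y v" by blast
    obtain \<gamma> where "curve_at ?M (G y) \<gamma>" "velocity \<gamma> = DG y v" using exists_curve_in_sphere[OF y v(2)] .
    then show "z \<in> tangent_space ?M (G y)" unfolding tangent_space_def v(1) by force
  qed
qed

text \<open>By Euler's identity the tangent space of the cone is that of the link plus the position
  vector, and orthogonality to the position vector is exactly the additional condition for a normal
  vector to be tangent to the sphere.\<close>

lemma sphere_normal_plane_link:
  assumes y: "y \<noteq> 0"
  shows "sphere_normal_plane (G ` sphere 0 (norm y)) (G y) = N y"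
proof
  show "N y \<subseteq> sphere_normal_plane (G ` sphere 0 (norm y)) (G y)"
    unfolding sphere_normal_plane_def normal_plane_def tangent_space_link[OF y] N_def
    using DG_self[OF y] by (auto, metis)
  show "sphere_normal_plane (G ` sphere 0 (norm y)) (G y) \<subseteq> N y"
  proof
    fix z assume z: "z \<in> sphere_normal_plane (G ` sphere 0 (norm y)) (G y)"
    have "orthogonal z (DG y v)" for v
    proof -
      define c where "c = (v \<bullet> y) / (y \<bullet> y)"
      have "orthogonal y (v - c *\<^sub>R y)" using y by (simp add: orthogonal_def inner_diff_right inner_commute c_def)
      then have "orthogonal z (DG y (v - c *\<^sub>R y))" "orthogonal z (G y)"
        using z unfolding sphere_normal_plane_def normal_plane_def tangent_space_link[OF y] by auto
      then show ?thesis unfolding linear_diff[OF linear_DG[OF y]] linear_cmul[OF linear_DG[OF y]] DG_self[OF y]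
        by (simp add: orthogonal_def inner_diff_right)
    qed
    then show "z \<in> N y" by (simp add: N_def)
  qed
qed

text \<open>The acceleration of every admissible curve differs from the vertical vector
  \<open>(0, D2 F y v v)\<close> by a tangent vector of the cone, which the projection kills. All
  curves give the same value, so the definite description is meaningful.\<close>

lemma second_fundamental_form_link:
  assumes y: "y \<noteq> 0" and v: "orthogonal y v"
  shows "second_fundamental_form (G ` sphere 0 (norm y)) (G y) (DG y v) = orth_proj (N y) (0, D2 F y v v)"
proof -
  let ?M = "G ` sphere 0 (norm y)"
  note lin = linear_orth_proj[OF subspace_N[of y]]
  have tang: "orth_proj (N y) (DG y w) = 0" for w
    by (rule orth_proj_eqI[OF subspace_N]) (auto simp: subspace_N subspace_0 N_def orthogonal_def inner_commute)
  have *: "orth_proj (N y) (acceleration \<gamma>) = orth_proj (N y) (0, D2 F y v v)"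
    if \<gamma>: "curve_at ?M (G y) \<gamma>" "velocity \<gamma> = DG y v" for \<gamma>
  proof -
    have M: "?M \<subseteq> range G" by blast
    have "velocity (\<lambda>t. fst (\<gamma> t)) = v" using velocity_in_graph(1)[OF \<gamma>(1) M y] \<gamma>(2) by (simp add: DG_def)
    then show ?thesis
      using velocity_in_graph(2)[OF \<gamma>(1) M y] tang by (simp add: linear_add[OF lin])
  qed
  obtain \<gamma> where "curve_at ?M (G y) \<gamma>" "velocity \<gamma> = DG y v" using exists_curve_in_sphere[OF y v] .
  then show ?thesis
    unfolding second_fundamental_form_def sphere_normal_plane_link[OF y]
  proof (intro the_equality exI conjI)
    show "orth_proj (N y) (0, D2 F y v v) = orth_proj (N y) (acceleration \<gamma>)"
      using *[OF \<open>curve_at ?M (G y) \<gamma>\<close> \<open>velocity \<gamma> = DG y v\<close>] ..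
  qed (use * in auto)
qed

text \<open>The vectors \<open>DG y (v i)\<close> are orthogonal with squared length
  \<open>1 + s i\<close>; normalizing them gives an orthonormal basis of the tangent space of the
  link. By bilinearity the squared normalizing factors come out in front of the second derivatives,
  as eigenvalues of the inverse metric.\<close>

lemma minimal_link_trace:
  assumes min: "minimal_in_sphere d (G ` sphere 0 (norm y))" and y: "y \<noteq> 0"
    and v: "orthonormal_family I v {w. orthogonal y w}"
    and s: "\<And>i j. i \<in> I \<Longrightarrow> j \<in> I \<Longrightarrow> DF y (v i) \<bullet> DF y (v j) = (if i = j then s i else 0)"
  shows "(\<Sum>i\<in>I. (1 / (1 + s i)) *\<^sub>R D2 F y (v i) (v i)) = 0"
proof -
  let ?M = "G ` sphere 0 (norm y)"
  note vD = orthonormal_familyD[OF v]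
  have s0: "0 \<le> s i" if "i \<in> I" for i using s[OF that that] by (metis inner_ge_zero)
  then have pos: "0 < 1 + s i" if "i \<in> I" for i using that by (simp add: add_pos_nonneg)
  define a where "a i = 1 / sqrt (1 + s i)" for i
  define w where "w i = a i *\<^sub>R v i" for i
  have a2: "a i * a i = 1 / (1 + s i)" if "i \<in> I" for i
    using pos[OF that] by (simp add: a_def)
  have wv: "orthogonal y (w i)" if "i \<in> I" for i
    using vD(6)[OF that] by (simp add: w_def orthogonal_clauses)
  have inner: "DG y (w i) \<bullet> DG y (w j) = (if i = j then 1 else 0)" if "i \<in> I" "j \<in> I" for i j
  proof -
    have "DG y (w i) \<bullet> DG y (w j) = a i * a j * (v i \<bullet> v j + DF y (v i) \<bullet> DF y (v j))"
      unfolding w_def linear_cmul[OF linear_DG[OF y]] by (simp add: DG_def algebra_simps)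
    moreover have "a i * a i * (1 + s i) = 1" using a2[OF that(1)] pos[OF that(1)] by simp
    ultimately show ?thesis using that s vD(2) by (cases "i = j") auto
  qed
  have "span ((\<lambda>i. DG y (w i)) ` I) = DG y ` span (w ` I)"
    using linear_span_image[OF linear_DG[OF y], of "w ` I"] by (simp add: image_image)
  also have "span (w ` I) = span (v ` I)"
  proof
    have "w i \<in> span (v ` I)" if "i \<in> I" for i
      unfolding w_def using that by (intro span_scale span_base) auto
    then show "span (w ` I) \<subseteq> span (v ` I)" by (intro span_minimal) auto
    have "v i \<in> span (w ` I)" if "i \<in> I" for i
    proof -
      have "v i = sqrt (1 + s i) *\<^sub>R w i" using pos[OF that] by (simp add: w_def a_def)
      then show ?thesis using that by (auto intro: span_scale span_base)
    qed
    then show "span (v ` I) \<subseteq> span (w ` I)" by (intro span_minimal) auto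
  qed
  finally have fam: "orthonormal_family I (\<lambda>i. DG y (w i)) (tangent_space ?M (G y))"
    using inner vD(1,3) by (auto simp: orthonormal_family_def tangent_space_link[OF y])
  have "(\<Sum>z\<in>(\<lambda>i. DG y (w i)) ` I. second_fundamental_form ?M (G y) z) = 0"
    using min orthonormal_family_basis[OF fam] by (auto simp: minimal_in_sphere_def)
  then have "0 = (\<Sum>i\<in>I. orth_proj (N y) (0, D2 F y (w i) (w i)))"
    by (simp add: sum.reindex[OF orthonormal_familyD(4)[OF fam]] second_fundamental_form_link[OF y wv])
  also have "\<dots> = orth_proj (N y) (\<Sum>i\<in>I. (0, D2 F y (w i) (w i)))"
    by (simp add: linear_sum[OF linear_orth_proj[OF subspace_N]])
  also have "(\<Sum>i\<in>I. (0::'e, D2 F y (w i) (w i))) = (0, \<Sum>i\<in>I. D2 F y (w i) (w i))"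
    by (simp add: prod_eq_iff fst_sum snd_sum)
  finally have "orth_proj (N y) (0, \<Sum>i\<in>I. D2 F y (w i) (w i)) = 0" ..
  \<comment> \<open>A vector with zero projection to \<open>N y\<close> is tangent, hence the lift
    of its horizontal part; that part is zero here, and so is the vector.\<close>
  then have "(0, \<Sum>i\<in>I. D2 F y (w i) (w i)) \<in> range (DG y)"
    using orth_proj(2)[OF subspace_N, of _ y "(0, \<Sum>i\<in>I. D2 F y (w i) (w i))"]
    by (intro orthogonal_N_imp_tangent[OF y]) auto
  then have "(\<Sum>i\<in>I. D2 F y (w i) (w i)) = 0"
    using linear_0[OF linear_DF[OF y]] by (auto simp: DG_def)
  moreover have "D2 F y (w i) (w i) = (1 / (1 + s i)) *\<^sub>R D2 F y (v i) (v i)" if "i \<in> I" for i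
  proof -
    have U: "open (- {0::'e})" "y \<in> - {0}" using y by auto
    show ?thesis unfolding w_def a2[OF that, symmetric]
      using linear_cmul[OF D2_linear_left[OF smooth_F U]] linear_cmul[OF D2_linear_right[OF smooth_F U]] by simp
  qed
  ultimately show ?thesis by simp
qed

end

section \<open>Lawson-Osserman maps with one nonzero singular value\<close>

lemma D2_cong:
  assumes f: "smooth_on U f" "open U" and x: "x \<in> U" and eq: "\<And>z. z \<in> U \<Longrightarrow> f z = g z"
  shows "D2 f x u v = D2 g x u v"
proof -
  have g: "smooth_on U g" using smooth_on_cong[OF f(2,1) eq] .
  have "frechet_derivative f (at z) = frechet_derivative g (at z)" if "z \<in> U" for z
    by (rule frechet_derivative_transform_within_open[OF _ f(2) that eq])
      (use smooth_on_has_derivative[OF f that] in \<open>auto simp: differentiable_def\<close>)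
  then have "((\<lambda>z. frechet_derivative f (at z) v) has_derivative (\<lambda>u. D2 g x u v)) (at x)"
    by (intro has_derivative_transform_within_open[OF D2_has_derivative[OF g f(2) x] f(2) x]) simp
  then show ?thesis unfolding D2_def[of f] by (rule frechet_derivative_eqI)
qed

lemma D2_bilinear_product:
  fixes g :: "'e::euclidean_space \<Rightarrow> 'f::real_normed_vector" and h :: "'e \<Rightarrow> 'g::real_normed_vector"
  assumes b: "bounded_bilinear b" and g: "smooth_on U g" and h: "smooth_on U h" and U: "open U" and x: "x \<in> U"
  shows "D2 (\<lambda>z. b (g z) (h z)) x u v =
    b (D2 g x u v) (h x) + b (frechet_derivative g (at x) v) (frechet_derivative h (at x) u)
    + (b (frechet_derivative g (at x) u) (frechet_derivative h (at x) v) + b (g x) (D2 h x u v))"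
proof -
  note prod = bounded_bilinear.FDERIV[OF b]
  have 1: "frechet_derivative (\<lambda>z. b (g z) (h z)) (at z) v =
      b (frechet_derivative g (at z) v) (h z) + b (g z) (frechet_derivative h (at z) v)" if "z \<in> U" for z
    using frechet_derivative_eqI[OF prod[OF smooth_on_has_derivative[OF g U that] smooth_on_has_derivative[OF h U that]]]
    by simp
  have "((\<lambda>z. b (frechet_derivative g (at z) v) (h z) + b (g z) (frechet_derivative h (at z) v)) has_derivative
    (\<lambda>u. (b (frechet_derivative g (at x) v) (frechet_derivative h (at x) u) + b (D2 g x u v) (h x))
      + (b (g x) (D2 h x u v) + b (frechet_derivative g (at x) u) (frechet_derivative h (at x) v)))) (at x)"
    by (intro has_derivative_add prod D2_has_derivative[OF g U x] D2_has_derivative[OF h U x]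
        smooth_on_has_derivative[OF g U x] smooth_on_has_derivative[OF h U x])
  then have "((\<lambda>z. frechet_derivative (\<lambda>z. b (g z) (h z)) (at z) v) has_derivative
    (\<lambda>u. (b (frechet_derivative g (at x) v) (frechet_derivative h (at x) u) + b (D2 g x u v) (h x))
      + (b (g x) (D2 h x u v) + b (frechet_derivative g (at x) u) (frechet_derivative h (at x) v)))) (at x)"
    by (rule has_derivative_transform_within_open[OF _ U x]) (simp add: 1)
  then show ?thesis unfolding D2_def[of "\<lambda>z. b (g z) (h z)"]
    by (subst frechet_derivative_eqI) (auto simp: algebra_simps)
qed

text \<open>Traces do not depend on the orthonormal basis; the energy, given as a sum over
  \<open>Basis\<close>, can thus be evaluated in a frame adapted to the map.\<close>

lemma bilinear_trace:
  fixes B :: "'e::euclidean_space \<Rightarrow> 'e \<Rightarrow> 'f::real_vector"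
  assumes B: "bilinear B" and u: "orthonormal_family I u UNIV"
  shows "(\<Sum>b\<in>Basis. B b b) = (\<Sum>i\<in>I. B (u i) (u i))"
proof -
  have l: "linear (\<lambda>x. B x y)" "linear (B x)" for x y using B by (auto simp: bilinear_def)
  note uD = orthonormal_familyD[OF u]
  have "B b b = (\<Sum>i\<in>I. \<Sum>j\<in>I. ((u i \<bullet> b) * (u j \<bullet> b)) *\<^sub>R B (u i) (u j))" for b
    by (subst linear_orthonormal_expand[OF u l(1), of b], simp, subst linear_orthonormal_expand[OF u l(2), of b], simp)
      (simp add: scaleR_sum_right inner_commute)
  then have "(\<Sum>b\<in>Basis. B b b) = (\<Sum>i\<in>I. \<Sum>j\<in>I. (\<Sum>b\<in>Basis. (u i \<bullet> b) * (u j \<bullet> b)) *\<^sub>R B (u i) (u j))"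
    by (simp add: scaleR_sum_left sum.swap[of _ _ Basis])
  also have "\<dots> = (\<Sum>i\<in>I. \<Sum>j\<in>I. if i = j then B (u i) (u i) else 0)"
    by (intro sum.cong refl) (auto simp: euclidean_inner[symmetric] uD(2))
  finally show ?thesis using uD(1) by simp
qed

text \<open>Rewriting the power of the norm as a real power of the squared norm lets a single rule
  differentiate it twice, and at a unit vector all these powers become 1. The formulas serve to
  strip the factor \<open>norm z ^ k\<close> off a homogeneous harmonic polynomial.\<close>

lemma D2_norm_power_unit:
  fixes y :: "'e::euclidean_space"
  assumes y: "norm y = 1"
  shows "smooth_on (- {0}) (\<lambda>z::'e. norm z ^ k)"
    and "frechet_derivative (\<lambda>z. norm z ^ k) (at y) v = real k * (y \<bullet> v)"
    and "D2 (\<lambda>z. norm z ^ k) y v v = real k * (real k - 2) * (y \<bullet> v)\<^sup>2 + real k * (v \<bullet> v)"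
proof -
  show "smooth_on (- {0}) (\<lambda>z::'e. norm z ^ k)" by (intro smooth_intros) auto
  have sq: "norm z ^ k = (z \<bullet> z) powr (real k / 2)" if "z \<noteq> 0" for z :: 'e
  proof -
    have "(z \<bullet> z) powr (real k / 2) = (norm z ^ 2) powr (real k / 2)" by (simp add: power2_norm_eq_inner)
    also have "\<dots> = norm z powr (real k)" using that by (simp add: powr_powr flip: powr_numeral)
    finally show ?thesis using that by (simp add: powr_realpow)
  qed
  have d: "((\<lambda>z::'e. (z \<bullet> z) powr a) has_derivative (\<lambda>v. (2 * a) * ((z \<bullet> z) powr (a - 1)) * (z \<bullet> v))) (at z)"
    if "z \<noteq> 0" for z a
    by (rule derivative_eq_intros refl)+ (use that in \<open>auto simp: powr_diff fun_eq_iff inner_commute\<close>)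
  have U: "open (- {0::'e})" by auto
  have fd: "frechet_derivative (\<lambda>z. norm z ^ k) (at z) v = real k * ((z \<bullet> z) powr (real k / 2 - 1)) * (z \<bullet> v)"
    if "z \<noteq> 0" for z v :: 'e
  proof -
    have "((\<lambda>z::'e. norm z ^ k) has_derivative (\<lambda>v. (2 * (real k / 2)) * ((z \<bullet> z) powr (real k / 2 - 1)) * (z \<bullet> v))) (at z)"
      by (rule has_derivative_transform_within_open[OF d[OF that] U]) (use that sq in auto)
    from frechet_derivative_eqI[OF this] show ?thesis by simp
  qed
  have y0: "y \<noteq> 0" "y \<bullet> y = 1" using y by (auto simp: norm_eq_1)
  show "frechet_derivative (\<lambda>z. norm z ^ k) (at y) v = real k * (y \<bullet> v)"
    using fd[OF y0(1)] y0 by simp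
  have "((\<lambda>z. real k * ((z \<bullet> z) powr (real k / 2 - 1)) * (z \<bullet> v)) has_derivative
      (\<lambda>u. real k * (real k - 2) * (y \<bullet> u) * (y \<bullet> v) + real k * (u \<bullet> v))) (at y)"
    by (rule derivative_eq_intros d[OF y0(1)] refl)+ (use y0 in \<open>auto simp: fun_eq_iff algebra_simps\<close>)
  then have "((\<lambda>z. frechet_derivative (\<lambda>z. norm z ^ k) (at z) v) has_derivative
      (\<lambda>u. real k * (real k - 2) * (y \<bullet> u) * (y \<bullet> v) + real k * (u \<bullet> v))) (at y)"
    by (rule has_derivative_transform_within_open[OF _ U]) (use y0 fd in auto)
  from frechet_derivative_eqI[OF this]
  show "D2 (\<lambda>z. norm z ^ k) y v v = real k * (real k - 2) * (y \<bullet> v)\<^sup>2 + real k * (v \<bullet> v)"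
    unfolding D2_def by (simp add: power2_eq_square mult_ac)
qed

locale lomse =
  fixes f :: "real^'a::finite \<Rightarrow> real^'b::finite" and n p k :: nat and \<theta> :: real
  assumes card_a: "CARD('a) = n + 1"
    and type: "LOMSE_of_type n p k f"
    and angle: "lo_angle f \<theta>"
begin

section \<open>The extensions of \<open>f\<close> of degree zero and one, and the cone as a
  graph\<close>

definition ft :: "real^'a \<Rightarrow> real^'b" where "ft = radial_ext f"
definition F :: "real^'a \<Rightarrow> real^'b" where "F y = (tan \<theta> * norm y) *\<^sub>R ft y"
text \<open>Up to sign, the eigenvalue of the Laplacian of the n-sphere on spherical harmonics of
  degree \<open>k\<close>.\<close>

definition K :: real where "K = real k * (real k + real n - 1)"

lemma theta: "0 < \<theta>" "\<theta> < pi / 2" and tan_pos: "tan \<theta> > 0" and cos_pos: "cos \<theta> > 0"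
  and tan_cos: "tan \<theta> * cos \<theta> = sin \<theta>"
proof -
  show 1: "0 < \<theta>" "\<theta> < pi / 2" using angle by (auto simp: lo_angle_def)
  then show "tan \<theta> > 0" "cos \<theta> > 0" by (auto simp: tan_gt_zero cos_gt_zero)
  then show "tan \<theta> * cos \<theta> = sin \<theta>" by (simp add: tan_def)
qed

lemma smooth_ft: "smooth_on (- {0}) ft" and f_sphere: "norm x = 1 \<Longrightarrow> norm (f x) = 1"
proof -
  have *: "smooth_sphere_map f" using type by (auto simp: LOMSE_of_type_def LOMSE_def LOM_def)
  then show "smooth_on (- {0}) ft" by (simp add: ft_def smooth_sphere_map_def)
  show "norm (f x) = 1" if "norm x = 1"
  proof -
    have "x \<in> sphere 0 1" using that by simp
    then have "f x \<in> sphere 0 1" using * unfolding smooth_sphere_map_def by blast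
    then show ?thesis by simp
  qed
qed

lemma open_nonzero: "open (- {0 :: real^'a})"
  by auto

lemma ft_scale: "c > 0 \<Longrightarrow> ft (c *\<^sub>R y) = ft y"
proof -
  assume "c > 0"
  then have "inverse (norm (c *\<^sub>R y)) * c = inverse (norm y)" by (cases "y = 0") (auto simp: field_simps)
  then show ?thesis by (simp only: ft_def radial_ext_def scaleR_scaleR)
qed

lemma ft_unit: "norm x = 1 \<Longrightarrow> ft x = f x"
  by (simp add: ft_def radial_ext_def)

lemma norm_ft: "y \<noteq> 0 \<Longrightarrow> norm (ft y) = 1"
  unfolding ft_def radial_ext_def by (intro f_sphere) simp

lemma F_unit: "norm x = 1 \<Longrightarrow> F x = tan \<theta> *\<^sub>R f x"
  by (simp add: F_def ft_unit)

lemma smooth_F: "smooth_on (- {0}) F"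
  unfolding F_def by (intro smooth_intros smooth_ft) auto

sublocale conic_graph F
proof
  show "F (c *\<^sub>R y) = c *\<^sub>R F y" if "c > 0" for c y
    using that by (simp add: F_def ft_scale)
qed (rule smooth_F)

abbreviation "Dft y \<equiv> frechet_derivative ft (at y)"

lemma ft_has_derivative: "y \<noteq> 0 \<Longrightarrow> (ft has_derivative Dft y) (at y)"
  by (rule smooth_on_has_derivative[OF smooth_ft]) auto

lemma linear_Dft: "y \<noteq> 0 \<Longrightarrow> linear (Dft y)"
  using ft_has_derivative has_derivative_linear by blast

lemma F_0: "F 0 = 0" by (simp add: F_def)

text \<open>The point over \<open>x\<close> has the base point
  \<open>cos \<theta> *\<^sub>R x\<close>, so the link lies over the sphere of radius
  \<open>cos \<theta>\<close> instead of the unit sphere.\<close>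

lemma lo_sphere_eq: "lo_sphere f \<theta> = G ` sphere 0 (cos \<theta>)"
proof -
  have "(cos \<theta> *\<^sub>R x, sin \<theta> *\<^sub>R f x) = G (cos \<theta> *\<^sub>R x)" if "norm x = 1" for x
    using homogeneous[OF cos_pos, of x] that by (simp add: G_def F_unit mult.commute tan_cos[symmetric])
  then have "lo_sphere f \<theta> = (\<lambda>x. G (cos \<theta> *\<^sub>R x)) ` sphere 0 1"
    unfolding lo_sphere_def by (intro image_cong) auto
  also have "\<dots> = G ` ((\<lambda>x. cos \<theta> *\<^sub>R x) ` sphere 0 1)" by (simp add: image_image)
  also have "(\<lambda>x. cos \<theta> *\<^sub>R x) ` sphere (0::real^'a) 1 = sphere 0 (cos \<theta>)"
    using sphere_scale[of "cos \<theta>" "0::real^'a" 1] cos_pos by simp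
  finally show ?thesis .
qed

lemma lo_cone_eq: "lo_cone f \<theta> = range G"
proof
  show "lo_cone f \<theta> \<subseteq> range G"
  proof
    fix z assume "z \<in> lo_cone f \<theta>"
    then obtain t q where "z = t *\<^sub>R q" "0 \<le> t" "q \<in> G ` sphere 0 (cos \<theta>)"
      unfolding lo_cone_def lo_sphere_eq by blast
    then obtain y where ty: "z = t *\<^sub>R G y" "0 \<le> t" by blast
    then have "z = G (t *\<^sub>R y)"
      using homogeneous[of t y] by (cases "t = 0") (auto simp: G_def F_0 zero_prod_def)
    then show "z \<in> range G" by blast
  qed
  show "range G \<subseteq> lo_cone f \<theta>"
  proof
    fix z assume "z \<in> range G"
    then obtain y where y: "z = G y" by blast
    \<comment> \<open>The vertex is zero times any point of the link; for \<open>y = 0\<close> some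
      point has to be picked, hence the coordinate vector.\<close>
    define x where "x = (if y = 0 then (cos \<theta> / norm (axis undefined 1 :: real^'a)) *\<^sub>R axis undefined 1 else (cos \<theta> / norm y) *\<^sub>R y)"
    have x: "x \<in> sphere 0 (cos \<theta>)" using cos_pos by (simp add: x_def)
    have "G y = (norm y / cos \<theta>) *\<^sub>R G x"
    proof (cases "y = 0")
      case True
      then show ?thesis by (simp add: G_def F_0 zero_prod_def)
    next
      case False
      then have "y = (norm y / cos \<theta>) *\<^sub>R x" using cos_pos by (simp add: x_def)
      then show ?thesis using homogeneous[of "norm y / cos \<theta>" x] False cos_pos
        by (metis G_def divide_pos_pos scaleR_Pair zero_less_norm_iff)
    qed
    then show "z \<in> lo_cone f \<theta>" unfolding lo_cone_def lo_sphere_eq y using x cos_pos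
      by (intro CollectI exI[of _ "norm y / cos \<theta>"] exI[of _ "G x"]) auto
  qed
qed

lemma Dft_self:
  assumes "y \<noteq> 0"
  shows "Dft y y = 0"
proof -
  have "((\<lambda>t. ft (y + t *\<^sub>R y)) has_vector_derivative Dft y y) (at 0)"
    using has_derivative_line[of ft "Dft y" y 0 y] ft_has_derivative[OF assms] by simp
  moreover have "((\<lambda>t. ft (y + t *\<^sub>R y)) has_vector_derivative 0) (at 0)"
  proof (rule has_vector_derivative_transform_within_open)
    show "((\<lambda>t. ft y) has_vector_derivative 0) (at 0)" by simp
    show "ft y = ft (y + t *\<^sub>R y)" if "t \<in> {-1<..}" for t
      using ft_scale[of "1 + t" y] that by (simp add: algebra_simps)
  qed auto
  ultimately show ?thesis using vector_derivative_unique_at by blast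
qed

lemma Dft_scale:
  assumes "c > 0" "y \<noteq> 0"
  shows "Dft (c *\<^sub>R y) v = (1 / c) *\<^sub>R Dft y v"
proof -
  have "((\<lambda>z. ft (c *\<^sub>R z)) has_derivative (\<lambda>v. Dft (c *\<^sub>R y) (c *\<^sub>R v))) (at y)"
    by (rule has_derivative_compose[OF _ ft_has_derivative]) (use assms in \<open>auto intro!: derivative_eq_intros\<close>)
  moreover have "(\<lambda>z. ft (c *\<^sub>R z)) = ft" using ft_scale[OF assms(1)] by auto
  ultimately have "Dft y v = Dft (c *\<^sub>R y) (c *\<^sub>R v)" using frechet_derivative_eqI by fastforce
  then show ?thesis using assms linear_cmul[OF linear_Dft[of "c *\<^sub>R y"]] by simp
qed

lemma D2_ft_scale:
  assumes "c > 0" "y \<noteq> 0"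
  shows "D2 ft (c *\<^sub>R y) u v = (1 / c\<^sup>2) *\<^sub>R D2 ft y u v"
proof -
  have "((\<lambda>z. c *\<^sub>R Dft (c *\<^sub>R z) v) has_derivative (\<lambda>u. c *\<^sub>R D2 ft (c *\<^sub>R y) (c *\<^sub>R u) v)) (at y)"
    by (rule has_derivative_scaleR_right, rule has_derivative_compose[OF _ D2_has_derivative[OF smooth_ft]])
      (use assms in \<open>auto intro!: derivative_eq_intros\<close>)
  then have "((\<lambda>z. Dft z v) has_derivative (\<lambda>u. c *\<^sub>R D2 ft (c *\<^sub>R y) (c *\<^sub>R u) v)) (at y)"
    by (rule has_derivative_transform_within_open[of _ _ _ _ "- {0}"]) (use assms Dft_scale in auto)
  then have "D2 ft y u v = c *\<^sub>R D2 ft (c *\<^sub>R y) (c *\<^sub>R u) v"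
    unfolding D2_def[of ft y] by (rule frechet_derivative_eqI)
  also have "\<dots> = c\<^sup>2 *\<^sub>R D2 ft (c *\<^sub>R y) u v"
    using linear_cmul[OF D2_linear_left[OF smooth_ft open_nonzero, of "c *\<^sub>R y" v], of c u] assms
    by (simp add: power2_eq_square)
  finally show ?thesis using assms by simp
qed

lemma inner_ft_Dft:
  assumes "y \<noteq> 0"
  shows "ft y \<bullet> Dft y v = 0"
proof -
  have "((\<lambda>z. ft z \<bullet> ft z) has_derivative (\<lambda>v. ft y \<bullet> Dft y v + Dft y v \<bullet> ft y)) (at y)"
    by (intro has_derivative_inner ft_has_derivative assms)
  moreover have "((\<lambda>z. ft z \<bullet> ft z) has_derivative (\<lambda>v. 0)) (at y)"
    by (rule has_derivative_transform_within_open[OF has_derivative_const[of 1] open_nonzero])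
      (use assms norm_ft in \<open>auto simp: norm_eq_1\<close>)
  ultimately have "(\<lambda>v. ft y \<bullet> Dft y v + Dft y v \<bullet> ft y) = (\<lambda>v. 0)" by (rule has_derivative_unique)
  then show ?thesis using fun_cong by (fastforce simp: inner_commute)
qed

lemma DF_eq:
  assumes "y \<noteq> 0"
  shows "DF y v = (tan \<theta> * norm y) *\<^sub>R Dft y v + (tan \<theta> * (y \<bullet> v) / norm y) *\<^sub>R ft y"
proof -
  have "(F has_derivative (\<lambda>v. (tan \<theta> * norm y) *\<^sub>R Dft y v + (tan \<theta> * (v \<bullet> sgn y)) *\<^sub>R ft y)) (at y)"
    unfolding F_def
    by (rule has_derivative_scaleR[OF has_derivative_mult_right[OF has_derivative_norm] ft_has_derivative]) (use assms in auto)
  from frechet_derivative_eqI[OF this] show ?thesis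
    by (simp add: sgn_div_norm inner_commute divide_inverse mult_ac)
qed

subsection \<open>The energy of the map\<close>

text \<open>On nonzero \<open>z\<close>, each component of \<open>ft\<close> times
  \<open>norm z ^ k\<close> is a harmonic polynomial. In its Laplacian at a unit vector the cross
  terms add up to \<open>2 * k\<close> times the radial derivative of \<open>ft\<close>, which
  vanishes, and the terms of order zero have the factor k (k - 2) + k (n + 1) = K, where n + 1 is
  the dimension of the ambient space.\<close>

lemma laplace_ft_unit:
  assumes x: "norm x = 1"
  shows "(\<Sum>b\<in>Basis. D2 ft x b b) = - K *\<^sub>R f x"
proof -
  have x0: "x \<noteq> 0" "x \<in> - {0}" using x by auto
  have k2: "k \<ge> 2" using type by (simp add: LOMSE_of_type_def)
  have "(\<Sum>b\<in>Basis. D2 ft x b b) $ i = - K * f x $ i" for i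
  proof -
    have "spherical_harmonic k (\<lambda>x. f x $ i)" using type by (simp add: LOMSE_of_type_def)
    then obtain h where h: "\<And>c y. h (c *\<^sub>R y) = c ^ k * h y" "\<And>y. laplacian h y = 0"
      and hs: "\<forall>x\<in>sphere 0 1. f x $ i = h x"
      unfolding spherical_harmonic_def by blast
    have h3: "f z $ i = h z" if "norm z = 1" for z using hs that by simp
    define \<phi> where "\<phi> = (\<lambda>z. ft z \<bullet> axis i 1)"
    have h_eq: "norm z ^ k *\<^sub>R \<phi> z = h z" if "z \<in> - {0}" for z
    proof -
      have "h z = norm z ^ k * h (z /\<^sub>R norm z)"
        using h(1)[of "norm z" "z /\<^sub>R norm z"] that by simp
      also have "h (z /\<^sub>R norm z) = f (z /\<^sub>R norm z) $ i" using that by (intro h3[symmetric]) simp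
      finally show ?thesis by (simp add: \<phi>_def ft_def radial_ext_def inner_axis)
    qed
    note N = D2_norm_power_unit[OF x, of k]
    have \<phi>: "smooth_on (- {0}) \<phi>" unfolding \<phi>_def by (intro smooth_intros smooth_ft open_nonzero)
    have D\<phi>: "frechet_derivative \<phi> (at x) v = Dft x v \<bullet> axis i 1" for v
      unfolding \<phi>_def by (rule frechet_derivative_eqI[OF has_derivative_inner_left[OF ft_has_derivative[OF x0(1)]]])
    have D2\<phi>: "D2 \<phi> x u v = D2 ft x u v \<bullet> axis i 1" for u v
      unfolding \<phi>_def by (rule D2_inner[OF smooth_ft open_nonzero x0(2)])
    have "D2 h x b b = (real k * (real k - 2) * (x \<bullet> b)\<^sup>2 + real k) * \<phi> x
        + 2 * real k * ((x \<bullet> b) * (Dft x b \<bullet> axis i 1)) + D2 ft x b b \<bullet> axis i 1" if "b \<in> Basis" for b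
    proof -
      have "D2 h x b b = D2 (\<lambda>z. norm z ^ k *\<^sub>R \<phi> z) x b b"
        by (rule D2_cong[OF smooth_on_scaleR[OF open_nonzero N(1) \<phi>] open_nonzero x0(2) h_eq, symmetric])
      then show ?thesis
        using D2_bilinear_product[OF bounded_bilinear_scaleR N(1) \<phi> open_nonzero x0(2), of b b] that x
        by (simp add: N(2,3) D\<phi> D2\<phi> algebra_simps)
    qed
    then have "0 = (\<Sum>b\<in>Basis. (real k * (real k - 2) * (x \<bullet> b)\<^sup>2 + real k) * \<phi> x
        + 2 * real k * ((x \<bullet> b) * (Dft x b \<bullet> axis i 1)) + D2 ft x b b \<bullet> axis i 1)"
      using h(2)[of x] unfolding laplacian_def D2_def[symmetric] by simp
    also have "\<dots> = (real k * (real k - 2) * (\<Sum>b\<in>Basis. (x \<bullet> b)\<^sup>2) + real k * real DIM(real^'a)) * \<phi> x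
        + 2 * real k * ((\<Sum>b\<in>Basis. (x \<bullet> b) *\<^sub>R Dft x b) \<bullet> axis i 1) + (\<Sum>b\<in>Basis. D2 ft x b b) \<bullet> axis i 1"
    proof -
      have "(\<Sum>b\<in>Basis. (A * (x \<bullet> b)\<^sup>2 + c) * \<phi> x + d * ((x \<bullet> b) * (Dft x b \<bullet> axis i 1)) + D2 ft x b b \<bullet> axis i 1)
        = (A * (\<Sum>b\<in>Basis. (x \<bullet> b)\<^sup>2) + c * real DIM(real^'a)) * \<phi> x
          + d * ((\<Sum>b\<in>Basis. (x \<bullet> b) *\<^sub>R Dft x b) \<bullet> axis i 1) + (\<Sum>b\<in>Basis. D2 ft x b b) \<bullet> axis i 1"
        for A c d :: real
        by (simp add: sum.distrib sum_distrib_left sum_distrib_right inner_sum_left algebra_simps)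
      then show ?thesis .
    qed
    also have "(\<Sum>b\<in>Basis. (x \<bullet> b) *\<^sub>R Dft x b) = Dft x x"
      by (rule linear_sum_Basis[OF linear_Dft[OF x0(1)], symmetric])
    also have "(\<Sum>b\<in>Basis. (x \<bullet> b)\<^sup>2) = 1"
      using x euclidean_inner[of x x] by (simp add: norm_eq_1 power2_eq_square)
    finally have "0 = K * \<phi> x + (\<Sum>b\<in>Basis. D2 ft x b b) \<bullet> axis i 1"
      using Dft_self[OF x0(1)] card_a by (simp add: K_def algebra_simps)
    then show ?thesis using ft_unit[OF x] by (simp add: \<phi>_def inner_axis)
  qed
  then show ?thesis by (simp add: vec_eq_iff)
qed

lemma laplace_ft:
  assumes "y \<noteq> 0"
  shows "(\<Sum>b\<in>Basis. D2 ft y b b) = - (K / (norm y)\<^sup>2) *\<^sub>R ft y"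
proof -
  define x where "x = y /\<^sub>R norm y"
  have x: "norm x = 1" "x \<noteq> 0" "y = norm y *\<^sub>R x" using assms by (auto simp: x_def)
  have "(\<Sum>b\<in>Basis. D2 ft y b b) = (1 / (norm y)\<^sup>2) *\<^sub>R (\<Sum>b\<in>Basis. D2 ft x b b)"
    using D2_ft_scale[of "norm y" x] x(2,3) assms by (metis (no_types, lifting) scaleR_sum_right sum.cong zero_less_norm_iff)
  also have "\<dots> = - (K / (norm y)\<^sup>2) *\<^sub>R ft x" using laplace_ft_unit[OF x(1)] ft_unit[OF x(1)] by simp
  also have "ft x = ft y" using ft_scale[of "norm y" x] x(3) assms by simp
  finally show ?thesis .
qed

text \<open>Because \<open>ft\<close> has constant length, the Laplacian of its square vanishes, and
  the product rule equates the energy with minus the pairing of \<open>ft\<close> with its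
  Laplacian.\<close>

lemma energy_ft:
  assumes "y \<noteq> 0"
  shows "(\<Sum>b\<in>Basis. Dft y b \<bullet> Dft y b) = K / (norm y)\<^sup>2"
proof -
  have y: "y \<in> - {0}" using assms by simp
  have "D2 (\<lambda>z. ft z \<bullet> ft z) y b b = 0" for b
  proof -
    have "D2 (\<lambda>z. ft z \<bullet> ft z) y b b = D2 (\<lambda>z. 1) y b b"
      by (rule D2_cong[OF smooth_on_inner[OF open_nonzero smooth_ft smooth_ft] open_nonzero y])
        (use norm_ft in \<open>auto simp: norm_eq_1\<close>)
    then show ?thesis by (simp add: D2_def)
  qed
  then have "Dft y b \<bullet> Dft y b = - (D2 ft y b b \<bullet> ft y)" for b
    using D2_bilinear_product[OF bounded_bilinear_inner smooth_ft smooth_ft open_nonzero y, of b b]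
    by (simp add: inner_commute)
  then have "(\<Sum>b\<in>Basis. Dft y b \<bullet> Dft y b) = - ((\<Sum>b\<in>Basis. D2 ft y b b) \<bullet> ft y)"
    by (simp add: inner_sum_left sum_negf)
  then show ?thesis unfolding laplace_ft[OF assms] using norm_ft[OF assms] by (simp add: norm_eq_1)
qed

section \<open>Singular values of the differential\<close>

lemma k_ge_2: "real k \<ge> 2"
  using type by (simp add: LOMSE_of_type_def)

lemma K_pos: "K > 0"
  unfolding K_def using k_ge_2 by (intro mult_pos_pos) auto

lemma K_gt_n: "n \<ge> 1 \<Longrightarrow> K > real n"
proof -
  assume "n \<ge> 1"
  have "2 * (2 + real n - 1) \<le> K" unfolding K_def using k_ge_2 by (intro mult_mono) auto
  then show "K > real n" by simp
qed

text \<open>\<open>case_nat\<close> puts the radial vector at index 0 and shifts the tangent frame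
  by one.\<close>

lemma tangent_orthonormal_extend:
  fixes x :: "real^'a"
  assumes x: "norm x = 1" and v: "orthonormal_family {..<n} v {w. orthogonal x w}"
  shows "orthonormal_family {..n} (case_nat x v) UNIV"
proof (rule orthonormal_family_subset_dim)
  note vD = orthonormal_familyD[OF v]
  show "card {..n} = dim (UNIV :: (real^'a) set)" using card_a by simp
  show "case_nat x v i \<bullet> case_nat x v j = (if i = j then 1 else 0)" if "i \<in> {..n}" "j \<in> {..n}" for i j
    using that x vD(2) vD(6) by (auto split: nat.split simp: norm_eq_1 orthogonal_def inner_commute)
qed auto

text \<open>A frame of the tangent space with orthogonal images exists for every linear map; the
  type of \<open>f\<close> makes the nonzero lengths equal and their number \<open>p\<close>. After
  reordering they come first. The squared lengths add up to the energy \<open>K\<close>, so each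
  nonzero one is \<open>K / p\<close>, and \<open>p = 0\<close> is impossible because
  \<open>K > 0\<close>.\<close>

lemma exists_singular_tangent_basis:
  assumes x: "norm x = 1"
  obtains v where "orthonormal_family {..<n} v {w. orthogonal x w}" "p \<le> n" "p > 0"
    "\<And>i j. i < n \<Longrightarrow> j < n \<Longrightarrow> Dft x (v i) \<bullet> Dft x (v j) = (if i = j \<and> i < p then K / p else 0)"
proof -
  let ?T = "{w. orthogonal x w}" and ?A = "Dft x"
  have x0: "x \<noteq> 0" and xs: "x \<in> sphere 0 1" using x by auto
  note lin = linear_Dft[OF x0]
  have sub: "subspace ?T" by (auto simp: subspace_def orthogonal_clauses)
  obtain B where B: "orthonormal_basis B ?T" "\<And>b c. b \<in> B \<Longrightarrow> c \<in> B \<Longrightarrow> b \<noteq> c \<Longrightarrow> ?A b \<bullet> ?A c = 0"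
    using exists_orthogonal_images[OF lin sub] by blast
  have fam: "orthonormal_family B (\<lambda>b. b) ?T" by (rule orthonormal_basis_family[OF B(1)])
  note BD = orthonormal_familyD[OF fam]
  have dimT: "dim ?T = n"
    using dim_hyperplane[OF x0] card_a by (simp add: orthogonal_def)
  then have cardB: "card B = n" using orthonormal_family_card[OF fam] by simp
  have sv: "sphere_singular_values f x = image_mset (\<lambda>b. norm (?A b)) (mset_set B)"
    unfolding sphere_singular_values_def sphere_deriv_def sphere_tangent_def ft_def[symmetric]
    by (rule singular_values_orthogonal_images[OF fam lin]) (use B(2) in \<open>auto simp: power2_norm_eq_inner\<close>)
  define S where "S = {b\<in>B. ?A b \<noteq> 0}"
  have "size {#s \<in># sphere_singular_values f x. s \<noteq> 0#} = p"
    using type x by (auto simp: LOMSE_of_type_def)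
  then have cardS: "card S = p"
    unfolding sv filter_mset_image_mset using BD(1) by (simp add: filter_mset_mset_set S_def)
  have eq: "norm (?A b) = norm (?A c)" if "b \<in> S" "c \<in> S" for b c
  proof -
    have "LOMSE f" using type by (simp add: LOMSE_of_type_def)
    then have *: "\<forall>s\<in>#sphere_singular_values f x. \<forall>t\<in>#sphere_singular_values f x. s \<noteq> 0 \<longrightarrow> t \<noteq> 0 \<longrightarrow> s = t"
      using bspec[of "sphere 0 1" _ x] xs unfolding LOMSE_def by blast
    have "norm (?A b) \<in># sphere_singular_values f x" "norm (?A c) \<in># sphere_singular_values f x"
      unfolding sv using that BD(1) by (auto simp: S_def)
    with * that show ?thesis by (auto simp: S_def)
  qed
  have finS: "finite S" and SB: "S \<subseteq> B" using BD(1) by (auto simp: S_def)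
  obtain h where h: "bij_betw h {..<n} B" "h ` {..<p} = S"
  proof -
    obtain h1 where h1: "bij_betw h1 {..<p} S"
      using finS cardS by (metis card_lessThan finite_lessThan finite_same_card_bij)
    have pn: "p \<le> n" using cardS cardB SB BD(1) card_mono by metis
    have "card (B - S) = card {p..<n}" using cardS cardB SB finS by (simp add: card_Diff_subset)
    then obtain h2 where h2: "bij_betw h2 {p..<n} (B - S)"
      using BD(1) by (metis finite_Diff finite_atLeastLessThan finite_same_card_bij)
    let ?h = "\<lambda>i. if i \<in> {..<p} then h1 i else h2 i"
    have "bij_betw ?h ({..<p} \<union> {p..<n}) (S \<union> (B - S))"
      by (rule bij_betw_disjoint_Un[OF h1 h2]) auto
    moreover have "{..<p} \<union> {p..<n} = {..<n}" "S \<union> (B - S) = B" using pn SB by auto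
    moreover have "?h ` {..<p} = S" using h1 by (auto simp: bij_betw_def)
    ultimately show thesis using that by metis
  qed
  have v: "orthonormal_family {..<n} h ?T" using orthonormal_family_reindex[OF fam h(1)] .
  have pn: "p \<le> n" using cardS cardB SB BD(1) card_mono by metis
  have hS: "h i \<in> S \<longleftrightarrow> i < p" if "i < n" for i
  proof
    assume "h i \<in> S"
    then obtain j where "j < p" "h i = h j" using h(2) by auto
    moreover have "i = j"
      by (rule inj_onD[OF bij_betw_imp_inj_on[OF h(1)] \<open>h i = h j\<close>]) (use that pn \<open>j < p\<close> in auto)
    ultimately show "i < p" by simp
  qed (use h(2) in auto)
  have hB: "h i \<in> B" if "i < n" for i using h(1) that by (auto simp: bij_betw_def)
  have sumK: "(\<Sum>i<n. ?A (h i) \<bullet> ?A (h i)) = K"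
  proof -
    have "bilinear (\<lambda>u v. ?A u \<bullet> ?A v)"
      unfolding bilinear_def using lin
      by (auto intro!: linearI simp: linear_add[OF lin] linear_cmul[OF lin] inner_add)
    from bilinear_trace[OF this tangent_orthonormal_extend[OF x v]]
    have "(\<Sum>b\<in>Basis. ?A b \<bullet> ?A b) = (\<Sum>i\<le>n. ?A (case_nat x h i) \<bullet> ?A (case_nat x h i))" .
    also have "\<dots> = (\<Sum>i<n. ?A (h i) \<bullet> ?A (h i))"
      unfolding sum.atMost_shift using Dft_self[OF x0] by simp
    finally show ?thesis using energy_ft[OF x0] x by simp
  qed
  have split: "(\<Sum>i<n. ?A (h i) \<bullet> ?A (h i)) = (\<Sum>i<p. ?A (h i) \<bullet> ?A (h i))"
  proof (intro sum.mono_neutral_right ballI)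
    fix i assume "i \<in> {..<n} - {..<p}"
    then have "h i \<in> B - S" using hS[of i] hB[of i] by simp
    then show "?A (h i) \<bullet> ?A (h i) = 0" by (simp add: S_def)
  qed (use pn in auto)
  have p0: "p > 0"
  proof (rule ccontr)
    assume "\<not> p > 0"
    then have "K = 0" using sumK split by simp
    then show False using K_pos by simp
  qed
  have const: "?A (h i) \<bullet> ?A (h i) = ?A (h 0) \<bullet> ?A (h 0)" if "i < p" for i
    using eq[of "h i" "h 0"] hS[of i] hS[of 0] that p0 pn by (simp add: power2_norm_eq_inner[symmetric])
  have "(\<Sum>i<p. ?A (h i) \<bullet> ?A (h i)) = (\<Sum>i<p. ?A (h 0) \<bullet> ?A (h 0))"
    by (rule sum.cong[OF refl]) (rule const, simp)
  then have val: "?A (h i) \<bullet> ?A (h i) = K / p" if "i < p" for i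
    using sumK split const[OF that] p0 by (simp add: field_simps)
  show thesis
  proof (rule that[OF v pn p0])
    fix i j assume ij: "i < n" "j < n"
    show "?A (h i) \<bullet> ?A (h j) = (if i = j \<and> i < p then K / p else 0)"
    proof (cases "i = j")
      case True
      then show ?thesis using val hS[OF ij(1)] hB[OF ij(1)] by (auto simp: S_def)
    next
      case False
      then have "h i \<noteq> h j" using h(1) ij by (auto simp: bij_betw_def inj_on_def)
      then show ?thesis using B(2) hB ij False by auto
    qed
  qed
qed

lemma unit_exists: obtains x :: "real^'a" where "norm x = 1"
  by (rule that[of "axis undefined 1"]) simp

lemma p_le_n: "p \<le> n" and p_pos: "p > 0"
proof -
  obtain x :: "real^'a" where "norm x = 1" using unit_exists .
  then show "p \<le> n" "p > 0" using exists_singular_tangent_basis by metis+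
qed

text \<open>\<open>sv i\<close> is the square of the \<open>i\<close>-th singular value of \<open>DF\<close>; the radial direction has index \<open>0\<close>.\<close>

definition sv :: "nat \<Rightarrow> real" where
  "sv i = (if i = 0 then (tan \<theta>)\<^sup>2 else if i \<le> p then (tan \<theta>)\<^sup>2 * (K / p) else 0)"

text \<open>One frame diagonalizes \<open>DF y\<close> and \<open>Dft y\<close> at once, with the
  radial direction at index 0 and the directions of nonzero singular value of \<open>f\<close> at
  the indices 1 to \<open>p\<close>. It is a condition at a single point; no regularity in
  \<open>y\<close> is asserted.\<close>

definition singular_frame :: "real^'a \<Rightarrow> (nat \<Rightarrow> real^'a) \<Rightarrow> bool" where
  "singular_frame y u \<longleftrightarrow> orthonormal_family {..n} u UNIV \<and> u 0 = y /\<^sub>R norm y \<and>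
     (\<forall>i\<le>n. \<forall>j\<le>n. DF y (u i) \<bullet> DF y (u j) = (if i = j then sv i else 0)) \<and>
     (\<forall>i\<le>n. \<forall>j\<le>n. Dft y (u i) \<bullet> Dft y (u j) = (if i = j \<and> 1 \<le> i \<and> i \<le> p then K / p / (norm y)\<^sup>2 else 0)) \<and>
     orthonormal_family {..<n} (\<lambda>i. u (Suc i)) {w. orthogonal y w}"

text \<open>\<open>DF\<close> maps the radial vector to a multiple of \<open>f x\<close>, and
  tangent vectors to multiples of their images under \<open>Dft\<close>. The two kinds of images are
  orthogonal because \<open>ft\<close> has constant length, so a frame for \<open>Dft\<close> also
  serves \<open>DF\<close>. Homogeneity carries it from the unit vector \<open>x\<close> to
  \<open>y\<close>.\<close>

lemma exists_singular_frame:
  assumes y: "y \<noteq> 0"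
  obtains u where "singular_frame y u"
proof -
  define x where "x = y /\<^sub>R norm y"
  have x: "norm x = 1" "x \<noteq> 0" "y = norm y *\<^sub>R x" using y by (auto simp: x_def)
  obtain v where v: "orthonormal_family {..<n} v {w. orthogonal x w}"
    "\<And>i j. i < n \<Longrightarrow> j < n \<Longrightarrow> Dft x (v i) \<bullet> Dft x (v j) = (if i = j \<and> i < p then K / p else 0)"
    using exists_singular_tangent_basis[OF x(1)] by metis
  let ?u = "case_nat x v"
  note vD = orthonormal_familyD[OF v(1)]
  have Dy: "Dft y w = (1 / norm y) *\<^sub>R Dft x w" for w
    using Dft_scale[of "norm y" x w] x y by simp
  have DFy: "DF y w = DF x w" for w using DF_scale[of "norm y" x w] x y by simp
  have D0: "Dft x x = 0" by (rule Dft_self[OF x(2)])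
  have DF0: "DF x x = tan \<theta> *\<^sub>R f x"
    using DF_eq[OF x(2), of x] D0 x(1) by (simp add: ft_unit norm_eq_1)
  have DFv: "DF x (v i) = tan \<theta> *\<^sub>R Dft x (v i)" if "i < n" for i
    using DF_eq[OF x(2), of "v i"] vD(6)[of i] that x(1) by (simp add: orthogonal_def)
  have orth: "f x \<bullet> Dft x w = 0" for w using inner_ft_Dft[OF x(2)] ft_unit[OF x(1)] by simp
  have orth': "Dft x w \<bullet> f x = 0" for w using orth by (simp add: inner_commute)
  have ff: "f x \<bullet> f x = 1" using f_sphere[OF x(1)] by (simp add: norm_eq_1)
  have Suc_lt: "Suc i \<le> n \<longleftrightarrow> i < n" for i by auto
  show thesis
  proof (rule that)
    show "singular_frame y ?u"
      unfolding singular_frame_def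
    proof (intro conjI allI impI)
      show "orthonormal_family {..n} ?u UNIV" by (rule tangent_orthonormal_extend[OF x(1) v(1)])
      show "?u 0 = y /\<^sub>R norm y" by (simp add: x_def)
      have "{w. orthogonal y w} = {w. orthogonal x w}" using y by (auto simp: x_def orthogonal_def)
      then show "orthonormal_family {..<n} (\<lambda>i. ?u (Suc i)) {w. orthogonal y w}" using v(1) by simp
      fix i j assume ij: "i \<le> n" "j \<le> n"
      show "DF y (?u i) \<bullet> DF y (?u j) = (if i = j then sv i else 0)"
        unfolding DFy using ij
        by (cases i; cases j) (auto simp: DF0 DFv Suc_lt v(2) sv_def ff orth orth' power2_eq_square)
      show "Dft y (?u i) \<bullet> Dft y (?u j) = (if i = j \<and> 1 \<le> i \<and> i \<le> p then K / p / (norm y)\<^sup>2 else 0)"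
        unfolding Dy using ij 
        by (cases i; cases j) (auto simp: D0 Suc_lt v(2) power2_eq_square)
    qed
  qed
qed

lemma singular_frameD:
  assumes "singular_frame y u"
  shows "orthonormal_family {..n} u UNIV" "u 0 = y /\<^sub>R norm y"
    "\<And>i j. i \<le> n \<Longrightarrow> j \<le> n \<Longrightarrow> DF y (u i) \<bullet> DF y (u j) = (if i = j then sv i else 0)"
    "\<And>i j. i \<le> n \<Longrightarrow> j \<le> n \<Longrightarrow> Dft y (u i) \<bullet> Dft y (u j) = (if i = j \<and> 1 \<le> i \<and> i \<le> p then K / p / (norm y)\<^sup>2 else 0)"
    "orthonormal_family {..<n} (\<lambda>i. u (Suc i)) {w. orthogonal y w}"
  using assms unfolding singular_frame_def by auto

section \<open>Minimality determines the angle\<close>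

lemma sv_nonneg: "sv i \<ge> 0" and one_plus_sv: "1 + sv i > 0"
proof -
  show "sv i \<ge> 0" using K_pos by (auto simp: sv_def)
  then show "1 + sv i > 0" by simp
qed

text \<open>Minimality is known on the link, whose base points have norm
  \<open>cos \<theta>\<close>. As the second derivative is homogeneous of degree -1, the relation
  spreads to every nonzero point, and the radial summand may be included because it is zero.\<close>

lemma minimal_trace:
  assumes y: "y \<noteq> 0" and u: "singular_frame y u"
  shows "(\<Sum>i\<le>n. (1 / (1 + sv i)) *\<^sub>R D2 F y (u i) (u i)) = 0"
proof -
  note uD = singular_frameD[OF u]
  define c where "c = cos \<theta> / norm y"
  have c: "c > 0" using cos_pos y by (simp add: c_def)
  define z where "z = c *\<^sub>R y"
  have z: "norm z = cos \<theta>" "z \<noteq> 0" using y cos_pos by (auto simp: z_def c_def)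
  have min: "minimal_in_sphere (CARD('a) - 1) (G ` sphere 0 (norm z))"
    using angle unfolding lo_angle_def lo_sphere_eq z by simp
  have "{w. orthogonal z w} = {w. orthogonal y w}" using c by (auto simp: z_def orthogonal_def)
  then have fam: "orthonormal_family {..<n} (\<lambda>i. u (Suc i)) {w. orthogonal z w}" using uD(5) by simp
  have "(\<Sum>i<n. (1 / (1 + sv (Suc i))) *\<^sub>R D2 F z (u (Suc i)) (u (Suc i))) = 0"
    by (rule minimal_link_trace[OF min z(2) fam]) (use uD(3) DF_scale[OF c y] in \<open>auto simp: z_def\<close>)
  then have "(1 / c) *\<^sub>R (\<Sum>i<n. (1 / (1 + sv (Suc i))) *\<^sub>R D2 F y (u (Suc i)) (u (Suc i))) = 0"
    unfolding z_def D2_scale[OF c y] by (simp add: scaleR_sum_right mult.commute)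
  moreover have "D2 F y (u 0) (u 0) = 0"
    using D2_radial[OF y] linear_cmul[OF D2_linear_left[OF smooth_F open_nonzero], of y] y by (simp add: uD(2))
  ultimately show ?thesis unfolding sum.atMost_shift using c by simp
qed

text \<open>Off the origin the squared norm of \<open>F\<close> is a constant multiple of the
  squared norm of \<open>y\<close>, so its second derivative is explicit; the product rule then
  isolates the pairing of \<open>F\<close> with \<open>D2 F\<close>.\<close>

lemma inner_F_D2F:
  assumes y: "y \<noteq> 0"
  shows "F y \<bullet> D2 F y v v = (tan \<theta>)\<^sup>2 * (v \<bullet> v) - DF y v \<bullet> DF y v"
proof -
  have yU: "y \<in> - {0}" using y by simp
  have id: "frechet_derivative (\<lambda>z::real^'a. z) (at w) = (\<lambda>v. v)" for w by simp
  have "D2 (\<lambda>z. F z \<bullet> F z) y v v = D2 (\<lambda>z. (tan \<theta> *\<^sub>R z) \<bullet> (tan \<theta> *\<^sub>R z)) y v v"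
  proof (rule D2_cong[OF smooth_on_inner[OF open_nonzero smooth_F smooth_F] open_nonzero yU])
    show "F z \<bullet> F z = (tan \<theta> *\<^sub>R z) \<bullet> (tan \<theta> *\<^sub>R z)" if "z \<in> - {0}" for z
    proof -
      have "F z \<bullet> F z = (tan \<theta> * norm z)\<^sup>2 * (ft z \<bullet> ft z)" by (simp add: F_def power2_eq_square)
      also have "ft z \<bullet> ft z = 1" using norm_ft[of z] that by (simp add: norm_eq_1)
      finally show ?thesis by (simp add: power_mult_distrib power2_norm_eq_inner power2_eq_square[of "tan \<theta>"])
    qed
  qed
  also have "\<dots> = 2 * ((tan \<theta> *\<^sub>R v) \<bullet> (tan \<theta> *\<^sub>R v))"
  proof -
    have sm: "smooth_on (- {0}) (\<lambda>z::real^'a. tan \<theta> *\<^sub>R z)" by (intro smooth_intros open_nonzero)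
    have d: "frechet_derivative (\<lambda>z::real^'a. tan \<theta> *\<^sub>R z) (at w) v = tan \<theta> *\<^sub>R v" for w v
      by (rule frechet_derivative_eqI) (auto intro!: derivative_eq_intros)
    then have "D2 (\<lambda>z::real^'a. tan \<theta> *\<^sub>R z) y v v = 0" by (simp add: D2_def)
    then show ?thesis using D2_bilinear_product[OF bounded_bilinear_inner sm sm open_nonzero yU, of v v] d by simp
  qed
  finally show ?thesis
    using D2_bilinear_product[OF bounded_bilinear_inner smooth_F smooth_F open_nonzero yU, of v v]
    by (simp add: inner_commute power2_eq_square algebra_simps)
qed

text \<open>Pairing the minimal surface equation with \<open>F\<close> itself determines the angle.\<close>

lemma angle_relation: "(real n - real p) * (1 + (tan \<theta>)\<^sup>2 * (K / p)) = K - real p"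
proof -
  obtain x :: "real^'a" where x: "norm x = 1" using unit_exists .
  then have x0: "x \<noteq> 0" by auto
  obtain u where u: "singular_frame x u" using exists_singular_frame[OF x0] .
  note uD = singular_frameD[OF u]
  define T where "T = (tan \<theta>)\<^sup>2"
  have T: "T > 0" using tan_pos by (simp add: T_def)
  define P where "P = 1 + T * (K / p)"
  have P: "P > 0" using T K_pos p_pos by (simp add: P_def add_pos_pos)
  have "0 = F x \<bullet> (\<Sum>i\<le>n. (1 / (1 + sv i)) *\<^sub>R D2 F x (u i) (u i))"
    using minimal_trace[OF x0 u] by simp
  also have "\<dots> = (\<Sum>i\<le>n. (T - sv i) / (1 + sv i))"
    unfolding inner_sum_right using orthonormal_familyD(2)[OF uD(1)] uD(3)
    by (intro sum.cong) (auto simp: inner_F_D2F[OF x0] T_def)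
  \<comment> \<open>The radial summand drops out because \<open>sv 0 = T\<close>. Of the others,
    \<open>p\<close> have the common nonzero singular value of \<open>f\<close>, and the remaining
    \<open>n - p\<close> have \<open>sv = 0\<close> and contribute \<open>T\<close> each.\<close>
  also have "\<dots> = (\<Sum>i<n. (T - sv (Suc i)) / (1 + sv (Suc i)))"
    unfolding sum.atMost_shift by (simp add: sv_def T_def)
  also have "\<dots> = (\<Sum>i<n. if i < p then (T - T * (K / p)) / P else T)"
    by (intro sum.cong) (auto simp: sv_def T_def P_def)
  also have "\<dots> = real p * ((T - T * (K / p)) / P) + (real n - real p) * T"
    using p_le_n sum.atLeastLessThan_concat[of 0 p n "\<lambda>i. if i < p then (T - T * (K / p)) / P else T"]
    by (simp add: lessThan_atLeast0 of_nat_diff)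
  finally have "0 = P * (real p * ((T - T * (K / p)) / P) + (real n - real p) * T)" by simp
  also have "\<dots> = T * ((real p - K) + (real n - real p) * P)"
    using P p_pos by (simp add: field_simps)
  finally show ?thesis using T unfolding P_def T_def by simp
qed

text \<open>If \<open>p\<close> were \<open>n\<close>, the relation for the angle would force
  \<open>K = p\<close>, against \<open>K > n\<close>.\<close>

lemma p_less_n: "p < n" and n_less_K: "real n < K"
proof -
  have "n \<ge> 1" using p_le_n p_pos by simp
  then show 1: "real n < K" by (rule K_gt_n)
  show "p < n"
  proof (rule ccontr)
    assume "\<not> p < n"
    then have "real p = real n" using p_le_n by simp
    then show False using angle_relation 1 by simp
  qed
qed

lemma tau_eq: "1 / (1 + (tan \<theta>)\<^sup>2 * (K / p)) = (real n - real p) / (K - real p)"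
proof -
  have "K - real p \<noteq> 0" using n_less_K p_less_n by simp
  moreover have "1 + (tan \<theta>)\<^sup>2 * (K / p) > 0" using K_pos by (simp add: add_pos_nonneg)
  ultimately show ?thesis using angle_relation by (subst frac_eq_eq) auto
qed

lemma cos_theta_square: "(cos \<theta>)\<^sup>2 = (1 - p / n) / (1 - p / K)"
proof -
  have r: "real n > real p" "K > real n" "real p > 0" using p_less_n n_less_K p_pos by auto
  have "(tan \<theta>)\<^sup>2 * K * (real n - real p) = (K - real n) * p"
    using angle_relation r by (simp add: field_simps)
  then have "(1 + (tan \<theta>)\<^sup>2) * (K * (real n - real p)) = real n * (K - real p)"
    by (simp add: algebra_simps)
  moreover have "1 + (tan \<theta>)\<^sup>2 = inverse ((cos \<theta>)\<^sup>2)"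
    using tan_sec[of \<theta>] cos_pos by (simp add: power_inverse)
  ultimately have "K * (real n - real p) = (cos \<theta>)\<^sup>2 * (real n * (K - real p))"
    using cos_pos by (simp add: field_simps)
  then show ?thesis using r by (simp add: field_simps)
qed

end

section \<open>Jordan angles and the normal angle\<close>

text \<open>Meant for completing the normalized images of a singular frame to an orthonormal basis
  of the target; the bound on \<open>r\<close> is what later yields
  \<open>p \<le> m\<close>.\<close>

lemma orthonormal_family_extend:
  fixes w :: "nat \<Rightarrow> 'e::euclidean_space"
  assumes w: "\<And>i j. i < r \<Longrightarrow> j < r \<Longrightarrow> w i \<bullet> w j = (if i = j then 1 else 0)"
  obtains w' where "orthonormal_family {..<DIM('e)} w' UNIV" "\<And>i. i < r \<Longrightarrow> w' i = w i" "r \<le> DIM('e)"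
proof -
  have fam: "orthonormal_family {..<r} w (span (w ` {..<r}))" using w by (simp add: orthonormal_family_def)
  define V where "V = {x. \<forall>i<r. orthogonal (w i) x}"
  have V: "subspace V" by (auto simp: V_def subspace_def orthogonal_clauses)
  obtain B where B: "B \<subseteq> V" "pairwise orthogonal B" "\<And>x. x \<in> B \<Longrightarrow> norm x = 1"
    "independent B" "card B = dim V" "span B = V"
    using orthonormal_basis_subspace[OF V] by blast
  have finB: "finite B" using B(4) independent_imp_finite by blast
  obtain h where h: "bij_betw h {r..<r + card B} B"
    using finB by (metis add_diff_cancel_left' card_atLeastLessThan finite_atLeastLessThan finite_same_card_bij)
  define w' where "w' i = (if i < r then w i else h i)" for i
  have hB: "h i \<in> B" if "r \<le> i" "i < r + card B" for i using h that by (auto simp: bij_betw_def)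
  have on: "w' i \<bullet> w' j = (if i = j then 1 else 0)" if ij: "i < r + card B" "j < r + card B" for i j
  proof -
    have 1: "w i \<bullet> h j = 0" if "i < r" "r \<le> j" "j < r + card B" for i j
      using hB[OF that(2,3)] B(1) that(1) by (auto simp: V_def orthogonal_def)
    have 2: "h i \<bullet> h j = (if i = j then 1 else 0)" if "r \<le> i" "i < r + card B" "r \<le> j" "j < r + card B" for i j
    proof (cases "i = j")
      case True
      then show ?thesis using B(3)[OF hB[OF that(1,2)]] by (simp add: norm_eq_1)
    next
      case False
      then have "h i \<noteq> h j" using bij_betw_imp_inj_on[OF h] that by (auto dest: inj_onD)
      then show ?thesis using B(2) hB[OF that(1,2)] hB[OF that(3,4)] False by (auto simp: pairwise_def orthogonal_def)
    qed
    show ?thesis using w 1 2 ij by (auto simp: w'_def inner_commute)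
  qed
  have "x \<in> span (w' ` {..<r + card B})" for x
  proof -
    obtain a b where ab: "a \<in> span (w ` {..<r})" "\<And>v. v \<in> span (w ` {..<r}) \<Longrightarrow> orthogonal b v" "x = a + b"
      using orthogonal_subspace_decomp_exists[of "w ` {..<r}" x] by metis
    have "w ` {..<r} \<subseteq> w' ` {..<r + card B}"
    proof
      fix z assume "z \<in> w ` {..<r}"
      then obtain i where "i < r" "z = w' i" by (auto simp: w'_def)
      then show "z \<in> w' ` {..<r + card B}" by auto
    qed
    then have 1: "a \<in> span (w' ` {..<r + card B})" using ab(1) span_mono by blast
    have "b \<in> span B" unfolding B(6) V_def using ab(2)[OF span_base] orthogonal_commute by blast
    moreover have "B \<subseteq> w' ` {..<r + card B}"
    proof
      fix z assume "z \<in> B"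
      then obtain i where "i \<in> {r..<r + card B}" "z = h i" using bij_betw_imp_surj_on[OF h] by blast
      then show "z \<in> w' ` {..<r + card B}" by (intro image_eqI[of _ _ i]) (auto simp: w'_def)
    qed
    ultimately have "b \<in> span (w' ` {..<r + card B})" using span_mono by blast
    then show ?thesis using 1 ab(3) by (simp add: span_add)
  qed
  then have "orthonormal_family {..<r + card B} w' UNIV" using on by (auto simp: orthonormal_family_def)
  moreover from orthonormal_family_card[OF this] have "r + card B = DIM('e)" by simp
  ultimately show thesis by (intro that[of w']) (auto simp: w'_def)
qed

lemma orth_proj_Q0: "orth_proj Q0 z = (0, snd z)"
  by (rule orth_proj_eqI) (auto simp: Q0_def subspace_def orthogonal_def inner_prod_def)

lemma orth_proj_Q0_perp: "orth_proj Q0_perp z = (fst z, 0)"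
  by (rule orth_proj_eqI) (auto simp: Q0_perp_def subspace_def orthogonal_def inner_prod_def)

lemma linear_Pair_0_snd: "linear (\<lambda>z. (0, snd z))" and linear_fst_Pair_0: "linear (\<lambda>z. (fst z, 0))"
  by (auto intro!: linearI)

locale lomse_target = lomse f n p k \<theta> for f :: "real^'a::finite \<Rightarrow> real^'b::finite" and n p k \<theta> +
  fixes m :: nat
  assumes card_b: "CARD('b) = m + 1"
begin

text \<open>The cosine of the Jordan angle belonging to \<open>u i\<close>: the lift
  \<open>DG y (u i)\<close> has length \<open>1 / \<tau> i\<close> and its horizontal part has
  length 1. At index 0 this is \<open>cos \<theta>\<close>.\<close>

definition \<tau> :: "nat \<Rightarrow> real" where "\<tau> i = 1 / sqrt (1 + sv i)"

lemma tau_pos: "\<tau> i > 0" and tau_square: "\<tau> i * \<tau> i = 1 / (1 + sv i)"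
  using one_plus_sv[of i] by (auto simp: \<tau>_def)

lemma tau_cases:
  "\<tau> i = (if i = 0 then sqrt ((1 - p / n) / (1 - p / K))
     else if i \<le> p then sqrt ((real n - real p) / (K - real p)) else 1)"
proof -
  have "1 + (tan \<theta>)\<^sup>2 = (1 / cos \<theta>)\<^sup>2"
    using tan_sec[of \<theta>] cos_pos by (simp add: power_divide inverse_eq_divide)
  then have "\<tau> 0 = cos \<theta>" using cos_pos by (simp add: \<tau>_def sv_def real_sqrt_divide)
  also have "\<dots> = sqrt ((1 - p / n) / (1 - p / K))"
    using cos_theta_square cos_pos by (metis abs_of_pos real_sqrt_abs)
  finally show ?thesis
    using tau_eq[symmetric] by (auto simp: \<tau>_def sv_def real_sqrt_divide)
qed

lemma tau_less_1: "0 < i \<Longrightarrow> i \<le> p \<Longrightarrow> \<tau> i \<le> 1" and tau_0_less_1: "\<tau> 0 < 1"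
proof -
  show "\<tau> i \<le> 1" using sv_nonneg[of i] by (auto simp: \<tau>_def)
  have "1 < sqrt (1 + sv 0)" using tan_pos by (simp add: sv_def)
  then show "\<tau> 0 < 1" unfolding \<tau>_def by (subst divide_less_eq_1_pos) linarith+
qed

subsection \<open>The tangent Jordan angles\<close>

lemma scaled_orthonormal_family:
  assumes y: "y \<noteq> 0" and u: "singular_frame y u"
  shows "orthonormal_family {..n} (\<lambda>i. \<tau> i *\<^sub>R DG y (u i)) (range (DG y))"
proof -
  note uD = singular_frameD[OF u]
  note U = orthonormal_familyD[OF uD(1)]
  have on: "(\<tau> i *\<^sub>R DG y (u i)) \<bullet> (\<tau> j *\<^sub>R DG y (u j)) = (if i = j then 1 else 0)"
    if "i \<le> n" "j \<le> n" for i j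
  proof -
    have "(\<tau> i *\<^sub>R DG y (u i)) \<bullet> (\<tau> j *\<^sub>R DG y (u j)) = \<tau> i * \<tau> j * (u i \<bullet> u j + DF y (u i) \<bullet> DF y (u j))"
      by (simp add: DG_def algebra_simps)
    also have "\<dots> = (if i = j then (\<tau> i * \<tau> i) * (1 + sv i) else 0)"
      using that U(2) uD(3) by simp
    finally show ?thesis unfolding tau_square using one_plus_sv[of i] by (cases "i = j") auto
  qed
  have "span ((\<lambda>i. \<tau> i *\<^sub>R DG y (u i)) ` {..n}) = range (DG y)"
  proof
    have "subspace (range (DG y))" by (rule linear_subspace_image[OF linear_DG[OF y] subspace_UNIV])
    then show "span ((\<lambda>i. \<tau> i *\<^sub>R DG y (u i)) ` {..n}) \<subseteq> range (DG y)"
      by (intro span_minimal image_subsetI subspace_scale rangeI)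
    show "range (DG y) \<subseteq> span ((\<lambda>i. \<tau> i *\<^sub>R DG y (u i)) ` {..n})"
    proof
      fix z assume "z \<in> range (DG y)"
      then obtain v where "z = DG y v" by blast
      then have "z = (\<Sum>i\<le>n. (v \<bullet> u i) *\<^sub>R DG y (u i))"
        using linear_orthonormal_expand[OF uD(1) linear_DG[OF y] UNIV_I] by (rule trans)
      also have "\<dots> = (\<Sum>i\<le>n. ((v \<bullet> u i) / \<tau> i) *\<^sub>R (\<tau> i *\<^sub>R DG y (u i)))"
      proof (rule sum.cong)
        show "(v \<bullet> u i) *\<^sub>R DG y (u i) = ((v \<bullet> u i) / \<tau> i) *\<^sub>R (\<tau> i *\<^sub>R DG y (u i))" for i
          using tau_pos[of i] by simp
      qed simp
      also have "\<dots> \<in> span ((\<lambda>i. \<tau> i *\<^sub>R DG y (u i)) ` {..n})"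
        by (intro span_sum span_scale span_base) auto
      finally show "z \<in> span ((\<lambda>i. \<tau> i *\<^sub>R DG y (u i)) ` {..n})" .
    qed
  qed
  then show ?thesis using on by (auto simp: orthonormal_family_def)
qed

lemma image_tau_mset:
  "image_mset (\<lambda>i. g (\<tau> i)) (mset_set {..n}) =
    replicate_mset p (g (sqrt ((real n - real p) / (K - real p))))
    + replicate_mset 1 (g (sqrt ((1 - p / n) / (1 - p / K)))) + replicate_mset (n - p) (g 1)"
proof -
  have "{..n} = {0} \<union> {1..p} \<union> {Suc p..n}" using p_le_n by auto
  then have "mset_set {..n} = mset_set {0} + mset_set {1..p} + mset_set {Suc p..n}"
    by (simp add: mset_set_Union)
  moreover have "image_mset (\<lambda>i. g (\<tau> i)) (mset_set {1..p}) = image_mset (\<lambda>i. g (sqrt ((real n - real p) / (K - real p)))) (mset_set {1..p})"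
    by (rule image_mset_cong) (auto simp: tau_cases)
  moreover have "image_mset (\<lambda>i. g (\<tau> i)) (mset_set {Suc p..n}) = image_mset (\<lambda>i. g 1) (mset_set {Suc p..n})"
    by (rule image_mset_cong) (auto simp: tau_cases)
  ultimately show ?thesis by (simp add: image_mset_const_eq tau_cases[of 0])
qed

text \<open>The orthonormal vectors \<open>\<tau> i *\<^sub>R DG y (u i)\<close> of the tangent
  space project to the orthogonal vectors \<open>\<tau> i *\<^sub>R u i\<close>, whose lengths are
  the cosines.\<close>

lemma tangent_jordan_angles_cone:
  assumes y: "y \<noteq> 0"
  shows "tangent_jordan_angles (range G) (G y) = image_mset (\<lambda>i. arccos (\<tau> i)) (mset_set {..n})"
proof -
  obtain u where u: "singular_frame y u" using exists_singular_frame[OF y] .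
  note U = orthonormal_familyD[OF singular_frameD(1)[OF u]]
  have "singular_values (\<lambda>z. (fst z, 0 :: real^'b)) (range (DG y)) = image_mset \<tau> (mset_set {..n})"
  proof (rule singular_values_orthogonal_images[OF scaled_orthonormal_family[OF y u] linear_fst_Pair_0])
    show "(fst (\<tau> i *\<^sub>R DG y (u i)), 0 :: real^'b) \<bullet> (fst (\<tau> j *\<^sub>R DG y (u j)), 0) = (if i = j then (\<tau> i)\<^sup>2 else 0)"
      if "i \<in> {..n}" "j \<in> {..n}" for i j
      using U(2)[OF that] by (simp add: DG_def power2_eq_square)
  qed (simp add: less_imp_le[OF tau_pos])
  moreover have "orth_proj Q0_perp = (\<lambda>z :: (real^'a) \<times> (real^'b). (fst z, 0))" by (rule ext) (rule orth_proj_Q0_perp)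
  ultimately show ?thesis
    by (simp add: tangent_jordan_angles_def jordan_angles_def tangent_space_cone[OF y] image_mset.compositionality comp_def)
qed

text \<open>The factors beyond \<open>p\<close> are 1, so the same number is the product over
  \<open>{..n}\<close> for tangent spaces and over \<open>{..m}\<close> for normal planes.\<close>

definition cos_alpha :: real where "cos_alpha = (\<Prod>i\<le>p. \<tau> i)"

lemma cos_alpha_eq:
  "cos_alpha = sqrt ((1 - p / n) / (1 - p / K)) * ((real n - real p) / (K - real p)) powr (real p / 2)"
proof -
  have r: "(real n - real p) / (K - real p) > 0" using p_less_n n_less_K by simp
  have "cos_alpha = \<tau> 0 * (\<Prod>i<p. \<tau> (Suc i))"
    unfolding cos_alpha_def by (rule prod.atMost_shift)
  also have "(\<Prod>i<p. \<tau> (Suc i)) = (\<Prod>i<p. sqrt ((real n - real p) / (K - real p)))"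
    by (rule prod.cong) (auto simp: tau_cases)
  also have "\<dots> = ((real n - real p) / (K - real p)) powr (real p / 2)"
  proof -
    have "sqrt ((real n - real p) / (K - real p)) ^ p = sqrt ((real n - real p) / (K - real p)) powr real p"
      using r by (intro powr_realpow[symmetric]) (rule real_sqrt_gt_zero)
    then show ?thesis using r by (simp add: powr_half_sqrt[symmetric] powr_powr)
  qed
  finally show ?thesis by (simp add: tau_cases[of 0])
qed

lemma prod_tau: "p \<le> r \<Longrightarrow> (\<Prod>i\<le>r. \<tau> i) = cos_alpha"
  unfolding cos_alpha_def by (rule prod.mono_neutral_right) (auto simp: tau_cases)

text \<open>The strict upper bound comes from the radial factor alone; the other factors are at most
  1.\<close>

lemma cos_alpha_bounds: "0 < cos_alpha" "cos_alpha < 1"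
proof -
  show "0 < cos_alpha" unfolding cos_alpha_def using tau_pos by (intro prod_pos) auto
  have "cos_alpha = \<tau> 0 * (\<Prod>i<p. \<tau> (Suc i))"
    unfolding cos_alpha_def by (rule prod.atMost_shift)
  also have "\<dots> \<le> \<tau> 0 * 1"
    using tau_pos tau_less_1 by (intro mult_left_mono prod_le_1) (auto intro: less_imp_le)
  finally show "cos_alpha < 1" using tau_0_less_1 by simp
qed

lemma slope_function_cone:
  assumes y: "y \<noteq> 0"
  shows "slope_function (range G) (G y) = 1 / cos_alpha"
proof -
  have "\<tau> i \<le> 1" for i using sv_nonneg[of i] by (auto simp: \<tau>_def)
  then have "cos (arccos (\<tau> i)) = \<tau> i" for i using tau_pos[of i] by (intro cos_arccos) (auto intro: less_imp_le order_trans[of _ 0])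
  then have "slope_function (range G) (G y) = (\<Prod>i\<le>n. 1 / \<tau> i)"
    unfolding slope_function_def tangent_jordan_angles_cone[OF y]
    by (simp add: image_mset.compositionality comp_def prod_unfold_prod_mset)
  then show ?thesis using prod_tau[OF p_le_n] by (simp add: prod_dividef)
qed

subsection \<open>The normal planes\<close>

text \<open>Let \<open>DF y (u i) = s i *\<^sub>R w i\<close> with a singular frame \<open>u\<close>
  and an orthonormal basis \<open>w\<close> of the target. The vectors
  \<open>(- s i *\<^sub>R u i, w i)\<close> are then orthogonal to the graph and to each other, and
  have length \<open>1 / \<tau> i\<close>. The \<open>p + 1\<close> nonzero images are orthogonal in
  a space of dimension \<open>m + 1\<close>, whence \<open>p \<le> m\<close>.\<close>

lemma exists_normal_frame:
  assumes y: "y \<noteq> 0"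
  obtains \<nu> w where "orthonormal_family {..m} \<nu> (N y)" "orthonormal_family {..m} w UNIV" "p \<le> m"
    "\<And>i. i \<le> m \<Longrightarrow> snd (\<nu> i) = \<tau> i *\<^sub>R w i"
proof -
  obtain u where u: "singular_frame y u" using exists_singular_frame[OF y] .
  note uD = singular_frameD[OF u]
  note U = orthonormal_familyD[OF uD(1)]
  define s where "s i = sqrt (sv i)" for i
  have s2: "s i * s i = sv i" for i using sv_nonneg[of i] by (simp add: s_def)
  have s_pos: "s i > 0" if "i \<le> p" for i using that tan_pos K_pos p_pos by (auto simp: s_def sv_def)
  have s_0: "s i = 0" if "i > p" for i using that by (auto simp: s_def sv_def)
  have on: "((1 / s i) *\<^sub>R DF y (u i)) \<bullet> ((1 / s j) *\<^sub>R DF y (u j)) = (if i = j then 1 else 0)"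
    if "i < Suc p" "j < Suc p" for i j
    using uD(3)[of i j] that p_le_n s_pos[of i] s2[of i] by (auto simp: field_simps)
  obtain w where w: "orthonormal_family {..<DIM(real^'b)} w UNIV"
    "\<And>i. i < Suc p \<Longrightarrow> w i = (1 / s i) *\<^sub>R DF y (u i)" "Suc p \<le> DIM(real^'b)"
    using orthonormal_family_extend[of "Suc p" "\<lambda>i. (1 / s i) *\<^sub>R DF y (u i)"] on by blast
  have dim_b: "DIM(real^'b) = Suc m" using card_b by simp
  have w1: "orthonormal_family {..m} w UNIV" and pm: "p \<le> m"
    using w(1,3) unfolding dim_b lessThan_Suc_atMost by auto
  note W = orthonormal_familyD[OF w1]
  have DFu: "DF y (u i) = s i *\<^sub>R w i" if "i \<le> n" for i
  proof (cases "i \<le> p")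
    case True
    then show ?thesis using w(2)[of i] s_pos[OF True] by simp
  next
    case False
    then have "DF y (u i) \<bullet> DF y (u i) = 0" using uD(3)[OF that that] by (simp add: sv_def)
    then show ?thesis using s_0[of i] False by simp
  qed
  \<comment> \<open>For \<open>i > p\<close> the factor \<open>s i\<close> is zero and the vector is
    vertical, so \<open>m\<close> may exceed \<open>n\<close> although \<open>u\<close> is a frame
    only up to index \<open>n\<close>.\<close>
  define \<nu> where "\<nu> i = \<tau> i *\<^sub>R (- s i *\<^sub>R u i, w i)" for i
  have \<nu>N: "\<nu> i \<in> N y" if i: "i \<le> m" for i
  proof -
    have "w i \<bullet> DF y v = s i * (u i \<bullet> v)" for v
    proof -
      have "w i \<bullet> DF y v = (\<Sum>j\<le>n. (v \<bullet> u j) * (s j * (w i \<bullet> w j)))"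
        by (subst linear_orthonormal_expand[OF uD(1) linear_DF[OF y]]) (auto simp: inner_sum_right DFu intro!: sum.cong)
      also have "\<dots> = (\<Sum>j\<le>n. if j = i then s i * (u i \<bullet> v) else 0)"
      proof (rule sum.cong)
        fix j assume "j \<in> {..n}"
        show "(v \<bullet> u j) * (s j * (w i \<bullet> w j)) = (if j = i then s i * (u i \<bullet> v) else 0)"
          using W(2)[of i j] i pm s_0[of j] by (cases "j \<le> p") (auto simp: inner_commute)
      qed simp
      also have "\<dots> = s i * (u i \<bullet> v)"
        using s_0[of i] p_le_n by auto
      finally show ?thesis .
    qed
    then show ?thesis by (auto simp: \<nu>_def N_def DG_def orthogonal_def)
  qed
  have \<nu>on: "\<nu> i \<bullet> \<nu> j = (if i = j then 1 else 0)" if ij: "i \<le> m" "j \<le> m" for i j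
  proof -
    have "s i * s j * (u i \<bullet> u j) = (if i = j then sv i else 0)"
    proof (cases "i \<le> p \<and> j \<le> p")
      case True
      then show ?thesis using U(2)[of i j] p_le_n s2 by auto
    next
      case False
      then show ?thesis using s_0[of i] s_0[of j] s2[of i] by auto
    qed
    moreover have "\<nu> i \<bullet> \<nu> j = \<tau> i * \<tau> j * (s i * s j * (u i \<bullet> u j) + w i \<bullet> w j)"
      by (simp add: \<nu>_def algebra_simps)
    ultimately have "\<nu> i \<bullet> \<nu> j = (if i = j then (\<tau> i * \<tau> i) * (1 + sv i) else 0)"
      using W(2)[of i j] ij by (simp add: add.commute)
    then show ?thesis unfolding tau_square using one_plus_sv[of i] by (cases "i = j") auto
  qed
  have dimN: "dim (N y) = card {..m}"
  proof (rule antisym)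
    \<comment> \<open>The horizontal part of a normal vector is minus the adjoint of
      \<open>DF y\<close> applied to its vertical part; this bounds the dimension by
      \<open>m + 1\<close>.\<close>
    have "inj_on snd (N y)"
    proof (rule inj_onI)
      fix a b assume ab: "a \<in> N y" "b \<in> N y" "snd a = snd b"
      have "fst a \<bullet> v = fst b \<bullet> v" for v
        using ab by (auto simp: N_def DG_def orthogonal_def inner_prod_def) (metis add_right_cancel)
      then have "fst a = fst b" by (metis vector_eq_rdot)
      then show "a = b" using ab(3) by (simp add: prod_eq_iff)
    qed
    then have "dim (N y) = dim (snd ` N y)"
      using dim_image_eq[OF linear_snd, of "N y"] span_eq_iff[THEN iffD2, OF subspace_N[of y]] by simp
    also have "\<dots> \<le> card {..m}" using dim_subset_UNIV[of "snd ` N y"] dim_b by simp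
    finally show "dim (N y) \<le> card {..m}" .
    have "orthonormal_family {..m} \<nu> (span (\<nu> ` {..m}))" using \<nu>on by (simp add: orthonormal_family_def)
    then have "card {..m} = dim (span (\<nu> ` {..m}))" by (rule orthonormal_family_card)
    also have "\<dots> \<le> dim (N y)" by (intro dim_subset span_minimal subspace_N) (use \<nu>N in auto)
    finally show "card {..m} \<le> dim (N y)" .
  qed
  have "orthonormal_family {..m} \<nu> (N y)"
    by (rule orthonormal_family_subset_dim[OF subspace_N]) (use \<nu>N \<nu>on dimN in auto)
  then show thesis by (rule that[OF _ w1 pm]) (simp add: \<nu>_def)
qed

lemma normal_jordan_angles:
  assumes y: "y \<noteq> 0"
  shows "jordan_angles (N y) Q0 = image_mset (\<lambda>i. arccos (\<tau> i)) (mset_set {..m})"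
proof -
  obtain \<nu> w where \<nu>: "orthonormal_family {..m} \<nu> (N y)" and w: "orthonormal_family {..m} w UNIV"
    and snd: "\<And>i. i \<le> m \<Longrightarrow> snd (\<nu> i) = \<tau> i *\<^sub>R w i"
    using exists_normal_frame[OF y] by metis
  have "singular_values (\<lambda>z. (0 :: real^'a, snd z)) (N y) = image_mset \<tau> (mset_set {..m})"
  proof (rule singular_values_orthogonal_images[OF \<nu> linear_Pair_0_snd])
    show "(0 :: real^'a, snd (\<nu> i)) \<bullet> (0, snd (\<nu> j)) = (if i = j then (\<tau> i)\<^sup>2 else 0)"
      if "i \<in> {..m}" "j \<in> {..m}" for i j
      using orthonormal_familyD(2)[OF w that] that by (simp add: snd power2_eq_square)
  qed (simp add: less_imp_le[OF tau_pos])
  moreover have "orth_proj Q0 = (\<lambda>z :: (real^'a) \<times> (real^'b). (0, snd z))" by (rule ext) (rule orth_proj_Q0)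
  ultimately show ?thesis
    by (simp add: jordan_angles_def image_mset.compositionality comp_def)
qed

text \<open>The determinant against \<open>e\<close> is the product of the cosines times the
  determinant \<open>d\<close> of the change of basis between \<open>w\<close> and \<open>e\<close>,
  which is 1 or -1. Multiplying one normal vector by \<open>d\<close> makes it positive.\<close>

lemma exists_oriented_normal_frame:
  assumes y: "y \<noteq> 0" and e: "orthonormal_family {..m} e (Q0 :: ((real^'a) \<times> (real^'b)) set)"
  obtains \<nu> where "orthonormal_family {..m} \<nu> (N y)" "det_on {..m} (\<lambda>i j. \<nu> i \<bullet> e j) = cos_alpha"
proof -
  obtain \<nu> w where \<nu>: "orthonormal_family {..m} \<nu> (N y)" and w: "orthonormal_family {..m} w UNIV" and pm: "p \<le> m"
    and snd: "\<And>i. i \<le> m \<Longrightarrow> snd (\<nu> i) = \<tau> i *\<^sub>R w i"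
    using exists_normal_frame[OF y] by metis
  note \<nu>D = orthonormal_familyD[OF \<nu>] and wD = orthonormal_familyD[OF w] and eD = orthonormal_familyD[OF e]
  let ?w = "\<lambda>i. (0 :: real^'a, w i)"
  have w': "orthonormal_family {..m} ?w (Q0 :: ((real^'a) \<times> (real^'b)) set)"
  proof -
    have "span (?w ` {..m}) = Pair 0 ` span (w ` {..m})"
      using linear_span_image[of "Pair (0::real^'a)" "w ` {..m}"] by (simp add: image_image linear_iff)
    also have "\<dots> = Q0" unfolding wD(3) by (auto simp: Q0_def image_iff)
    finally show ?thesis using wD(2) by (auto simp: orthonormal_family_def)
  qed
  define d where "d = det_on {..m} (\<lambda>k j. ?w k \<bullet> e j)"
  have d: "d * d = 1" using det_on_orthonormal_square[OF w' e] by (simp add: d_def power2_eq_square)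
  define c where "c i = (if i = 0 then d else 1)" for i :: nat
  have c: "c i * c i = 1" "c i \<noteq> 0" for i using d by (auto simp: c_def)
  let ?\<nu> = "\<lambda>i. c i *\<^sub>R \<nu> i"
  have "orthonormal_family {..m} ?\<nu> (N y)"
    by (rule orthonormal_family_subset_dim[OF subspace_N])
      (use \<nu>D(2,6) c subspace_scale[OF subspace_N] orthonormal_family_card[OF \<nu>] in \<open>auto simp: mult.assoc[symmetric]\<close>)
  moreover have "det_on {..m} (\<lambda>i j. ?\<nu> i \<bullet> e j) = cos_alpha"
  proof -
    have "det_on {..m} (\<lambda>i j. ?\<nu> i \<bullet> e j) =
        det_on {..m} (\<lambda>i j. \<Sum>l\<in>{..m}. (if i = l then c i * \<tau> i else 0) * (?w l \<bullet> e j))"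
    proof (rule det_on_cong)
      fix i j assume ij: "i \<in> {..m}" "j \<in> {..m}"
      have "?\<nu> i \<bullet> e j = (c i * \<tau> i) * (?w i \<bullet> e j)"
        using eD(6)[OF ij(2)] ij(1) by (simp add: Q0_def inner_prod_def snd)
      also have "\<dots> = (\<Sum>l\<in>{..m}. if i = l then c i * \<tau> i * (?w l \<bullet> e j) else 0)" using ij(1) by simp
      also have "\<dots> = (\<Sum>l\<in>{..m}. (if i = l then c i * \<tau> i else 0) * (?w l \<bullet> e j))"
        by (intro sum.cong) auto
      finally show "?\<nu> i \<bullet> e j = (\<Sum>l\<in>{..m}. (if i = l then c i * \<tau> i else 0) * (?w l \<bullet> e j))" .
    qed
    also have "\<dots> = (\<Prod>i\<le>m. c i * \<tau> i) * d"
      using det_on_mult[of "{..m}" "\<lambda>i l. if i = l then c i * \<tau> i else 0" "\<lambda>l j. ?w l \<bullet> e j"]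
        det_on_diagonal[of "{..m}" "\<lambda>i. c i * \<tau> i"] by (simp add: d_def)
    also have "(\<Prod>i\<le>m. c i * \<tau> i) = d * cos_alpha"
      using prod_tau[OF pm] by (simp add: prod.distrib c_def prod.atMost_shift)
    finally show ?thesis using d by (simp add: mult_ac)
  qed
  ultimately show thesis by (rule that)
qed

text \<open>The frames come from a pointwise choice, so continuity of the orientation has to be
  proved. Each frame is written in a basis \<open>g z\<close> of the normal plane that is continuous
  in \<open>z\<close> and projects onto \<open>e\<close>. The wedge product then factors into two
  transition determinants, both equal to \<open>cos_alpha\<close>, and the determinant of the inner
  products of \<open>g y\<close> and \<open>g z\<close>, which is continuous in
  \<open>z\<close>.\<close>

lemma normal_frames_coherent:
  assumes e: "orthonormal_family {..m} e (Q0 :: ((real^'a) \<times> (real^'b)) set)"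
    and \<nu>: "\<And>y. y \<noteq> 0 \<Longrightarrow> orthonormal_family {..m} (\<nu> y) (N y)"
    and pos: "\<And>y. y \<noteq> 0 \<Longrightarrow> det_on {..m} (\<lambda>i j. \<nu> y i \<bullet> e j) = cos_alpha"
    and y: "y \<noteq> 0"
  obtains h where "continuous_on (- {0}) h" "h y > 0" "\<And>y'. y' \<noteq> 0 \<Longrightarrow> det_on {..m} (\<lambda>i j. \<nu> y i \<bullet> \<nu> y' j) = h y'"
proof -
  define b where "b j = snd (e j)" for j
  \<comment> \<open>The normal vector with vertical part \<open>b j\<close>: its horizontal part is
    minus the adjoint of \<open>DF z\<close> applied to \<open>b j\<close>.\<close>
  define g where "g z j = (- (\<Sum>c\<in>Basis. (DF z c \<bullet> b j) *\<^sub>R c), b j)" for z j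
  note eD = orthonormal_familyD[OF e]
  have expand: "\<nu> z i = (\<Sum>j\<le>m. (\<nu> z i \<bullet> e j) *\<^sub>R g z j)" if z: "z \<noteq> 0" and i: "i \<le> m" for z i
  proof -
    have N: "\<nu> z i \<in> N z" using orthonormal_familyD(6)[OF \<nu>[OF z]] i by simp
    have "(0, snd (\<nu> z i)) = (\<Sum>j\<le>m. ((0, snd (\<nu> z i)) \<bullet> e j) *\<^sub>R e j)"
      by (rule orthonormal_family_expand[OF e]) (simp add: Q0_def)
    moreover have "(0, snd (\<nu> z i)) \<bullet> e j = \<nu> z i \<bullet> e j" if "j \<le> m" for j
      using eD(6)[of j] that by (simp add: Q0_def inner_prod_def)
    ultimately have "(0, snd (\<nu> z i)) = (\<Sum>j\<le>m. (\<nu> z i \<bullet> e j) *\<^sub>R e j)" by simp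
    from arg_cong[OF this, of snd] have snd: "snd (\<nu> z i) = (\<Sum>j\<le>m. (\<nu> z i \<bullet> e j) *\<^sub>R b j)"
      by (simp add: snd_sum b_def)
    have "fst (\<nu> z i) \<bullet> c = - (DF z c \<bullet> snd (\<nu> z i))" for c
      using N by (simp add: N_def DG_def orthogonal_def inner_prod_def inner_commute eq_neg_iff_add_eq_0)
    then have "fst (\<nu> z i) = - (\<Sum>c\<in>Basis. (DF z c \<bullet> snd (\<nu> z i)) *\<^sub>R c)"
      using euclidean_representation[of "fst (\<nu> z i)"] by (simp add: sum_negf)
    also have "\<dots> = (\<Sum>j\<le>m. (\<nu> z i \<bullet> e j) *\<^sub>R (- (\<Sum>c\<in>Basis. (DF z c \<bullet> b j) *\<^sub>R c)))"
      unfolding snd by (simp add: inner_sum_right scaleR_sum_left scaleR_sum_right sum_negf sum.swap[of _ Basis])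
    finally show ?thesis
      using snd by (simp add: prod_eq_iff fst_sum snd_sum g_def)
  qed
  define H where "H z = det_on {..m} (\<lambda>j l. g y j \<bullet> g z l)" for z
  have wedge: "det_on {..m} (\<lambda>i j. \<nu> y i \<bullet> \<nu> z j) = cos_alpha * (H z * cos_alpha)" if z: "z \<noteq> 0" for z
  proof -
    let ?P = "\<lambda>z i j. \<nu> z i \<bullet> e j"
    have "det_on {..m} (\<lambda>i j. \<nu> y i \<bullet> \<nu> z j) =
        det_on {..m} (\<lambda>i j. \<Sum>a\<in>{..m}. ?P y i a * (\<Sum>l\<in>{..m}. (g y a \<bullet> g z l) * ?P z j l))"
    proof (rule det_on_cong)
      fix i j assume ij: "i \<in> {..m}" "j \<in> {..m}"
      have "\<nu> y i \<bullet> \<nu> z j = (\<Sum>a\<le>m. ?P y i a *\<^sub>R g y a) \<bullet> (\<Sum>l\<le>m. ?P z j l *\<^sub>R g z l)"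
        using expand[OF y, of i] expand[OF z, of j] ij by simp
      then show "\<nu> y i \<bullet> \<nu> z j = (\<Sum>a\<in>{..m}. ?P y i a * (\<Sum>l\<in>{..m}. (g y a \<bullet> g z l) * ?P z j l))"
        by (simp only:) (subst inner_sum_left, simp add: inner_sum_right sum_distrib_left mult_ac)
    qed
    also have "\<dots> = cos_alpha * (H z * det_on {..m} (\<lambda>l j. ?P z j l))"
      using det_on_mult[of "{..m}" "?P y" "\<lambda>a j. \<Sum>l\<in>{..m}. (g y a \<bullet> g z l) * ?P z j l"]
        det_on_mult[of "{..m}" "\<lambda>a l. g y a \<bullet> g z l" "\<lambda>l j. ?P z j l"] pos[OF y] by (simp add: H_def)
    finally show ?thesis using det_on_transpose[of "{..m}" "?P z"] pos[OF z] by simp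
  qed
  have "continuous_on (- {0}) (\<lambda>z. DF z c)" for c
    by (rule smooth_on_continuous[OF smooth_on_frechet_derivative[OF smooth_F]])
  then have "continuous_on (- {0}) H"
    unfolding H_def g_def by (intro continuous_on_det_on continuous_intros)
  \<comment> \<open>At \<open>z = y\<close> the wedge product is 1, which gives positivity of the
    continuous expression there.\<close>
  moreover have "det_on {..m} (\<lambda>i j. \<nu> y i \<bullet> \<nu> y j) = 1"
    using det_on_diagonal[of "{..m}" "\<lambda>_. 1"] orthonormal_familyD(2)[OF \<nu>[OF y]]
    by (subst det_on_cong[of "{..m}" "\<lambda>i j. \<nu> y i \<bullet> \<nu> y j" "\<lambda>i j. if i = j then 1 else 0"]) auto
  then have "cos_alpha * (H y * cos_alpha) > 0" using wedge[OF y] by simp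
  then have "H y > 0" using cos_alpha_bounds by (simp add: zero_less_mult_iff)
  ultimately show thesis
    using wedge cos_alpha_bounds
    by (intro that[of "\<lambda>z. cos_alpha * (H z * cos_alpha)"] continuous_on_mult continuous_on_const) auto
qed

lemma normal_planes_angle:
  assumes e: "orthonormal_frame (m + 1) e (Q0 :: ((real^'a) \<times> (real^'b)) set)"
  shows "\<exists>\<nu>. orientation_of (m + 1) (lo_sphere f \<theta>) (sphere_normal_plane (lo_sphere f \<theta>)) \<nu> \<and>
             (\<forall>q\<in>lo_sphere f \<theta>. oriented_angle (m + 1) (\<nu> q) e = arccos cos_alpha)"
proof -
  have idx: "{..<m + 1} = {..m}" by auto
  have e': "orthonormal_family {..m} e (Q0 :: ((real^'a) \<times> (real^'b)) set)"
    using e unfolding orthonormal_family_nat idx .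
  have "\<forall>y. \<exists>\<nu>. y \<noteq> 0 \<longrightarrow> orthonormal_family {..m} \<nu> (N y) \<and> det_on {..m} (\<lambda>i j. \<nu> i \<bullet> e j) = cos_alpha"
    using exists_oriented_normal_frame[OF _ e'] by metis
  then obtain \<nu> where \<nu>: "\<And>y. y \<noteq> 0 \<Longrightarrow> orthonormal_family {..m} (\<nu> y) (N y)"
    "\<And>y. y \<noteq> 0 \<Longrightarrow> det_on {..m} (\<lambda>i j. \<nu> y i \<bullet> e j) = cos_alpha"
    by metis
  have lo: "\<exists>y. y \<noteq> 0 \<and> norm y = cos \<theta> \<and> q = G y" if "q \<in> lo_sphere f \<theta>" for q
  proof -
    have "q \<in> G ` sphere 0 (cos \<theta>)" using that unfolding lo_sphere_eq .
    then obtain y where "y \<in> sphere 0 (cos \<theta>)" "q = G y" by blast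
    then show ?thesis using cos_pos by (intro exI[of _ y]) auto
  qed
  show ?thesis
  proof (intro exI conjI ballI)
    \<comment> \<open>A point of a graph is determined by its first component, which therefore
      indexes the chosen frames.\<close>
    let ?\<nu> = "\<lambda>q. \<nu> (fst q)"
    show "oriented_angle (m + 1) (?\<nu> q) e = arccos cos_alpha" if "q \<in> lo_sphere f \<theta>" for q
      using lo[OF that] \<nu>(2) by (auto simp: oriented_angle_def wedge_inner_def lessThan_Suc_atMost G_def)
    show "orientation_of (m + 1) (lo_sphere f \<theta>) (sphere_normal_plane (lo_sphere f \<theta>)) ?\<nu>"
      unfolding orientation_of_def
    proof (intro conjI ballI)
      fix q assume "q \<in> lo_sphere f \<theta>"
      then obtain y where y: "y \<noteq> 0" "norm y = cos \<theta>" "q = G y" using lo by blast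
      have "sphere_normal_plane (lo_sphere f \<theta>) q = N y"
        using sphere_normal_plane_link[OF y(1)] by (simp add: lo_sphere_eq y)
      then show "orthonormal_frame (m + 1) (?\<nu> q) (sphere_normal_plane (lo_sphere f \<theta>) q)"
        using \<nu>(1)[OF y(1)] unfolding orthonormal_family_nat idx by (simp add: y G_def)
      obtain h where h: "continuous_on (- {0}) h" "h y > 0"
        "\<And>y'. y' \<noteq> 0 \<Longrightarrow> det_on {..m} (\<lambda>i j. \<nu> y i \<bullet> \<nu> y' j) = h y'"
        using normal_frames_coherent[OF e' \<nu> y(1)] by metis
      have "continuous_on (lo_sphere f \<theta>) (\<lambda>q'. h (fst q'))"
        by (rule continuous_on_compose2[OF h(1)]) (auto intro!: continuous_intros dest!: lo simp: G_def)
      then have "((\<lambda>q'. h (fst q')) \<longlongrightarrow> h (fst q)) (at q within lo_sphere f \<theta>)"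
        using \<open>q \<in> lo_sphere f \<theta>\<close> by (simp add: continuous_on)
      then have "\<forall>\<^sub>F q' in at q within lo_sphere f \<theta>. h (fst q') > 0"
        by (rule order_tendstoD(1)) (simp add: y G_def h(2))
      moreover have "\<forall>\<^sub>F q' in at q within lo_sphere f \<theta>. q' \<in> lo_sphere f \<theta>"
        by (simp add: eventually_at_filter)
      ultimately show "\<forall>\<^sub>F q' in at q within lo_sphere f \<theta>. wedge_inner (m + 1) (?\<nu> q) (?\<nu> q') > 0"
      proof eventually_elim
        case (elim q')
        then show ?case using lo[OF elim(2)] h(3) by (auto simp: wedge_inner_def lessThan_Suc_atMost y G_def)
      qed
    qed
  qed
qed

end

section \<open>Volumes\<close>

text \<open>Relabelling coordinates preserves a product of identical measures, so coordinate
  subspaces of equal dimension carry the same measure, even in different ambient spaces.\<close>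

lemma lborel_span_reindex:
  fixes D1 :: "'e::euclidean_space set" and D2 :: "'f::euclidean_space set"
  assumes D1: "D1 \<subseteq> Basis" and D2: "D2 \<subseteq> Basis" and h: "bij_betw h D1 D2"
  shows "lborel_span D1 = distr (lborel_span D2) borel (\<lambda>z. \<Sum>b\<in>D1. (z \<bullet> h b) *\<^sub>R b)"
proof -
  interpret E: product_sigma_finite "\<lambda>_::'e. lborel :: real measure" by standard
  interpret F: product_sigma_finite "\<lambda>_::'f. lborel :: real measure" by standard
  have fin: "finite D1" "finite D2" using D1 D2 finite_Basis finite_subset by blast+
  have hD: "h b \<in> D2" if "b \<in> D1" for b using h that by (auto simp: bij_betw_def)
  let ?r = "\<lambda>g :: 'f \<Rightarrow> real. \<lambda>b\<in>D1. g (h b)"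
  have r: "?r \<in> measurable (\<Pi>\<^sub>M b\<in>D2. lborel) (\<Pi>\<^sub>M b\<in>D1. lborel)"
    by (rule measurable_restrict) (use hD in auto)
  have "distr (\<Pi>\<^sub>M b\<in>D2. lborel) (\<Pi>\<^sub>M b\<in>D1. lborel) ?r = (\<Pi>\<^sub>M b\<in>D1. lborel)"
  proof (rule E.PiM_eqI)
    fix A :: "'e \<Rightarrow> real set" assume A: "\<And>b. b \<in> D1 \<Longrightarrow> A b \<in> sets lborel"
    let ?A = "\<lambda>b'. A (inv_into D1 h b')"
    have inv: "inv_into D1 h (h b) = b" if "b \<in> D1" for b using bij_betw_inv_into_left[OF h that] .
    have A': "?A b' \<in> sets lborel" if "b' \<in> D2" for b'
      using A bij_betw_apply[OF bij_betw_inv_into[OF h] that] by blast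
    have "?r -` (Pi\<^sub>E D1 A) \<inter> space (\<Pi>\<^sub>M b\<in>D2. lborel :: real measure) = Pi\<^sub>E D2 ?A"
    proof -
      have "(\<forall>b\<in>D1. g (h b) \<in> A b) \<longleftrightarrow> (\<forall>b'\<in>D2. g b' \<in> ?A b')" for g :: "'f \<Rightarrow> real"
        using inv bij_betw_imp_surj_on[OF h] by (metis (no_types, lifting) imageE image_eqI)
      then show ?thesis by (auto simp: space_PiM PiE_iff)
    qed
    then have "emeasure (distr (\<Pi>\<^sub>M b\<in>D2. lborel) (\<Pi>\<^sub>M b\<in>D1. lborel) ?r) (Pi\<^sub>E D1 A)
        = emeasure (\<Pi>\<^sub>M b\<in>D2. lborel) (Pi\<^sub>E D2 ?A)"
      using A fin by (subst emeasure_distr[OF r]) (auto intro!: sets_PiM_I_finite)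
    also have "\<dots> = (\<Prod>b'\<in>D2. emeasure lborel (?A b'))"
      using fin(2) A' by (rule F.emeasure_PiM)
    also have "\<dots> = (\<Prod>b\<in>D1. emeasure lborel (?A (h b)))"
      by (rule prod.reindex_bij_betw[OF h, symmetric])
    also have "\<dots> = (\<Prod>b\<in>D1. emeasure lborel (A b))"
      by (rule prod.cong) (auto simp: inv)
    finally show "emeasure (distr (\<Pi>\<^sub>M b\<in>D2. lborel) (\<Pi>\<^sub>M b\<in>D1. lborel) ?r) (Pi\<^sub>E D1 A) = (\<Prod>b\<in>D1. emeasure lborel (A b))" .
  qed (use fin in auto)
  then have "lborel_span D1 =
      distr (distr (\<Pi>\<^sub>M b\<in>D2. lborel) (\<Pi>\<^sub>M b\<in>D1. lborel) ?r) borel (\<lambda>g. \<Sum>b\<in>D1. g b *\<^sub>R b)"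
    unfolding lborel_span_def by simp
  also have "\<dots> = distr (\<Pi>\<^sub>M b\<in>D2. lborel) borel ((\<lambda>g. \<Sum>b\<in>D1. g b *\<^sub>R b) \<circ> ?r)"
    by (rule distr_distr[OF _ r]) measurable
  also have "\<dots> = distr (\<Pi>\<^sub>M b\<in>D2. lborel) borel
      ((\<lambda>z. \<Sum>b\<in>D1. (z \<bullet> h b) *\<^sub>R b) \<circ> (\<lambda>g. \<Sum>b\<in>D2. g b *\<^sub>R b))"
  proof (rule distr_cong)
    fix g :: "'f \<Rightarrow> real"
    have "(\<Sum>b'\<in>D2. g b' *\<^sub>R b') \<bullet> h b = g (h b)" if "b \<in> D1" for b
    proof -
      have "(\<Sum>b'\<in>D2. g b' *\<^sub>R b') \<bullet> h b = (\<Sum>b'\<in>D2. if b' = h b then g (h b) else 0)"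
        unfolding inner_sum_left using D2 hD[OF that] by (intro sum.cong) (auto simp: inner_Basis subset_iff)
      then show ?thesis using fin hD[OF that] by simp
    qed
    then show "((\<lambda>g. \<Sum>b\<in>D1. g b *\<^sub>R b) \<circ> ?r) g = ((\<lambda>z. \<Sum>b\<in>D1. (z \<bullet> h b) *\<^sub>R b) \<circ> (\<lambda>g. \<Sum>b\<in>D2. g b *\<^sub>R b)) g"
      by simp
  qed auto
  also have "\<dots> = distr (lborel_span D2) borel (\<lambda>z. \<Sum>b\<in>D1. (z \<bullet> h b) *\<^sub>R b)"
    unfolding lborel_span_def by (rule distr_distr[symmetric]) measurable
  finally show ?thesis .
qed

section \<open>Transport of parametrized pieces between submanifolds\<close>

lemma span_subset_Basis_expand:
  assumes "D \<subseteq> Basis" "y \<in> span D"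
  shows "(\<Sum>b\<in>D. (y \<bullet> b) *\<^sub>R b) = y"
proof -
  have "orthonormal_family D (\<lambda>b. b) (span D)"
    using assms finite_subset[OF assms(1) finite_Basis] by (auto simp: orthonormal_family_def inner_Basis subset_iff)
  from orthonormal_family_expand[OF this assms(2)] show ?thesis by simp
qed

text \<open>A coordinate direction is the velocity of a line in the parameter domain, and the
  parametrization maps a short piece of that line into \<open>M\<close>.\<close>

lemma parametrization_velocity:
  fixes \<phi> :: "'e::euclidean_space \<Rightarrow> 'e"
  assumes U: "open U" and \<phi>: "smooth_on U \<phi>" "\<phi> ` (U \<inter> span D) \<subseteq> M" and y: "y \<in> U \<inter> span D" and b: "b \<in> D"
  shows "frechet_derivative \<phi> (at y) b \<in> tangent_space M (\<phi> y)"
proof -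
  let ?k = "\<lambda>t::real. y + t *\<^sub>R b"
  have "open ((\<lambda>t. ?k t) -` U)" by (rule open_vimage[OF U]) (intro continuous_intros)
  moreover have "0 \<in> ?k -` U" using y by simp
  ultimately obtain \<epsilon> where e: "\<epsilon> > 0" "ball 0 \<epsilon> \<subseteq> ?k -` U" using openE by blast
  then have img: "?k ` {-\<epsilon><..<\<epsilon>} \<subseteq> U" by (auto simp: subset_iff)
  have k: "smooth_on {-\<epsilon><..<\<epsilon>} ?k" by (intro smooth_intros) auto
  have "smooth_on {-\<epsilon><..<\<epsilon>} (\<lambda>t. \<phi> (?k t))" by (rule smooth_on_compose[OF _ U \<phi>(1) k img]) simp
  moreover have "?k t \<in> span D" for t using y b by (auto intro: span_add span_scale span_base)
  ultimately have "curve_at M (\<phi> y) (\<lambda>t. \<phi> (?k t))"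
    unfolding curve_at_def using e(1) img \<phi>(2) by (auto intro!: exI[of _ \<epsilon>] simp: image_subset_iff)
  moreover have "velocity ?k = b"
    unfolding velocity_def by (rule vector_derivative_at) (auto intro!: derivative_eq_intros)
  then have "velocity (\<lambda>t. \<phi> (?k t)) = frechet_derivative \<phi> (at y) b"
    using velocity_compose[OF \<phi>(1) U k e(1)] y by simp
  ultimately show ?thesis unfolding tangent_space_def by force
qed

lemma continuous_on_param_jacobian:
  assumes "smooth_on U \<phi>"
  shows "continuous_on U (param_jacobian D \<phi>)"
  unfolding param_jacobian_def
  by (intro continuous_intros continuous_on_det_on smooth_on_continuous smooth_on_frechet_derivative assms)

lemma borel_measurable_param_jacobian:
  assumes "smooth_on U \<phi>" "compact K" "K \<subseteq> U"
  shows "(\<lambda>y. ennreal (param_jacobian D \<phi> y) * indicator K y) \<in> borel_measurable borel"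
proof -
  have "continuous_on K (param_jacobian D \<phi>)"
    by (rule continuous_on_subset[OF continuous_on_param_jacobian[OF assms(1)] assms(3)])
  then have "(\<lambda>y. indicator K y *\<^sub>R param_jacobian D \<phi> y) \<in> borel_measurable borel"
    by (intro borel_measurable_continuous_on_indicator) (auto simp: assms(2) borel_compact)
  then have "(\<lambda>y. ennreal (indicator K y *\<^sub>R param_jacobian D \<phi> y)) \<in> borel_measurable borel" by measurable
  moreover have "(\<lambda>y. ennreal (param_jacobian D \<phi> y) * indicator K y) = (\<lambda>y. ennreal (indicator K y *\<^sub>R param_jacobian D \<phi> y))"
    by (auto simp: fun_eq_iff indicator_def)
  ultimately show ?thesis by simp
qed

text \<open>Every parametrized piece of \<open>M1\<close> is composed with \<open>\<Psi>\<close>.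
  Parameter domains lie in the ambient space of the submanifold, so the parameter subspace has to be
  moved to a coordinate subspace of the other ambient space; the bound on \<open>d\<close> provides
  one. Gram determinants of tangent vectors scale by the square of \<open>c\<close>, hence areas by
  \<open>c\<close>.\<close>

lemma riemannian_volume_image_le:
  fixes \<Psi> :: "'e::euclidean_space \<Rightarrow> 'f::euclidean_space"
  assumes \<Psi>: "smooth_on V \<Psi>" "open V" "M1 \<subseteq> V" "\<Psi> ` M1 \<subseteq> M2" "inj_on \<Psi> M1"
    and c: "c \<ge> 0" and d: "d \<le> DIM('f)"
    and jac: "\<And>D u q. finite D \<Longrightarrow> card D = d \<Longrightarrow> q \<in> M1 \<Longrightarrow> (\<And>b::'e. b \<in> D \<Longrightarrow> u b \<in> tangent_space M1 q) \<Longrightarrow>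
      det_on D (\<lambda>a b. frechet_derivative \<Psi> (at q) (u a) \<bullet> frechet_derivative \<Psi> (at q) (u b)) =
      c\<^sup>2 * det_on D (\<lambda>a b. u a \<bullet> u b)"
  shows "ennreal c * riemannian_volume d M1 \<le> riemannian_volume d M2"
proof -
  have main: "\<exists>D' U' K' \<phi>'. (ennreal c * (\<integral>\<^sup>+ y\<in>K. ennreal (param_jacobian D \<phi> y) \<partial>lborel_span D)) =
       (\<integral>\<^sup>+ y\<in>K'. ennreal (param_jacobian D' \<phi>' y) \<partial>lborel_span D') \<and>
     (D' \<subseteq> Basis \<and> card D' = d \<and> open U' \<and> smooth_on U' \<phi>' \<and> \<phi>' ` (U' \<inter> span D') \<subseteq> M2 \<and>
     compact K' \<and> K' \<subseteq> U' \<inter> span D' \<and> inj_on \<phi>' K')"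
    if H: "D \<subseteq> Basis" "card D = d" "open U" "smooth_on U \<phi>" "\<phi> ` (U \<inter> span D) \<subseteq> M1"
      "compact K" "K \<subseteq> U \<inter> span D" "inj_on \<phi> K" for D U K and \<phi> :: "'e \<Rightarrow> 'e"
  proof -
    obtain D' :: "'f set" where D': "D' \<subseteq> Basis" "card D' = d"
      using d obtain_subset_with_card_n by metis
    have fin: "finite D" "finite D'" using H(1) D'(1) finite_subset finite_Basis by blast+
    obtain h where h: "bij_betw h D D'" using fin H(2) D'(2) finite_same_card_bij by metis
    have hD: "h b \<in> D'" if "b \<in> D" for b using h that by (auto simp: bij_betw_def)
    \<comment> \<open>\<open>L\<close> and \<open>R\<close> restrict to mutually inverse isometries
      between the two coordinate subspaces and are defined linearly on the whole spaces, which keeps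
      the new parameter domain open.\<close>
    define L where "L z = (\<Sum>b\<in>D. (z \<bullet> h b) *\<^sub>R b)" for z
    define R where "R y = (\<Sum>b\<in>D. (y \<bullet> b) *\<^sub>R h b)" for y
    have L: "bounded_linear L" unfolding L_def
      by (intro bounded_linear_sum bounded_linear_compose[OF bounded_linear_scaleR_left] bounded_linear_inner_left)
    have R: "bounded_linear R" unfolding R_def
      by (intro bounded_linear_sum bounded_linear_compose[OF bounded_linear_scaleR_left] bounded_linear_inner_left)
    have hh: "h a \<bullet> h b = (if a = b then 1 else 0)" if "a \<in> D" "b \<in> D" for a b
      using D'(1) hD that bij_betw_imp_inj_on[OF h] by (auto simp: inner_Basis subset_iff inj_on_def)
    have Lh: "L (h b) = b" if "b \<in> D" for b
    proof -
      have "L (h b) = (\<Sum>a\<in>D. if a = b then b else 0)"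
        unfolding L_def using hh that by (intro sum.cong) auto
      then show ?thesis using fin that by simp
    qed
    have LR: "L (R y) = y" if "y \<in> span D" for y
    proof -
      have "L (R y) = (\<Sum>b\<in>D. (y \<bullet> b) *\<^sub>R b)"
        unfolding R_def linear_sum[OF bounded_linear.linear[OF L]] linear_cmul[OF bounded_linear.linear[OF L]]
        by (rule sum.cong) (auto simp: Lh)
      then show ?thesis using span_subset_Basis_expand[OF H(1) that] by simp
    qed
    have Lspan: "L z \<in> span D" for z unfolding L_def by (intro span_sum span_scale span_base)
    have Rspan: "R y \<in> span D'" for y unfolding R_def using hD by (intro span_sum span_scale span_base)
    define U' where "U' = L -` U"
    define K' where "K' = R ` K"
    define \<phi>' where "\<phi>' z = \<Psi> (\<phi> (L z))" for z
    have U': "open U'" unfolding U'_def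
      by (rule open_vimage[OF H(3)]) (intro linear_continuous_on L)
    have in_M1: "\<phi> (L z) \<in> M1" if "z \<in> U'" for z
      using that H(5) Lspan[of z] by (auto simp: U'_def)
    have sm_L: "smooth_on U' L" by (rule smooth_on_linear[OF L U'])
    have sm1: "smooth_on U' (\<lambda>z. \<phi> (L z))"
      by (rule smooth_on_compose[OF U' H(3,4) sm_L]) (auto simp: U'_def)
    have sm: "smooth_on U' \<phi>'" unfolding \<phi>'_def
      by (rule smooth_on_compose[OF U' \<Psi>(2,1) sm1]) (use in_M1 \<Psi>(3) in auto)
    have der: "frechet_derivative \<phi>' (at z) w = frechet_derivative \<Psi> (at (\<phi> (L z))) (frechet_derivative \<phi> (at (L z)) (L w))"
      if z: "z \<in> U'" for z w
    proof -
      have "((\<lambda>z. \<phi> (L z)) has_derivative (\<lambda>w. frechet_derivative \<phi> (at (L z)) (L w))) (at z)"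
        by (rule has_derivative_compose[OF bounded_linear.has_derivative[OF L has_derivative_ident]
              smooth_on_has_derivative[OF H(4,3)]]) (use z in \<open>simp add: U'_def\<close>)
      then have "(\<phi>' has_derivative (\<lambda>w. frechet_derivative \<Psi> (at (\<phi> (L z))) (frechet_derivative \<phi> (at (L z)) (L w)))) (at z)"
        unfolding \<phi>'_def
        by (rule has_derivative_compose) (use in_M1[OF z] \<Psi>(3) in \<open>auto intro!: smooth_on_has_derivative[OF \<Psi>(1,2)]\<close>)
      then show ?thesis by (rule frechet_derivative_eqI)
    qed
    have J: "param_jacobian D' \<phi>' z = c * param_jacobian D \<phi> (L z)" if z: "z \<in> U'" for z
    proof -
      let ?u = "\<lambda>b. frechet_derivative \<phi> (at (L z)) b"
      have "det_on D' (\<lambda>a b. frechet_derivative \<phi>' (at z) a \<bullet> frechet_derivative \<phi>' (at z) b)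
        = det_on D (\<lambda>a b. frechet_derivative \<Psi> (at (\<phi> (L z))) (?u a) \<bullet> frechet_derivative \<Psi> (at (\<phi> (L z))) (?u b))"
        unfolding det_on_reindex[OF h fin(1)] by (rule det_on_cong) (simp add: der[OF z] Lh)
      also have "\<dots> = c\<^sup>2 * det_on D (\<lambda>a b. ?u a \<bullet> ?u b)"
        by (rule jac[OF fin(1) H(2) in_M1[OF z]], rule parametrization_velocity[OF H(3,4,5)])
          (use z Lspan in \<open>auto simp: U'_def\<close>)
      finally show ?thesis using c by (simp add: param_jacobian_def real_sqrt_mult)
    qed
    have LK: "L z \<in> K" "R (L z) = z" if "z \<in> K'" for z using that LR H(7) by (auto simp: K'_def)
    have K'U: "K' \<subseteq> U' \<inter> span D'" 
    proof -
      have "L (R x) \<in> U" if "x \<in> K" for x using LR[of x] subsetD[OF H(7) that] by simp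
      then show ?thesis using Rspan by (auto simp: K'_def U'_def)
    qed
    have cK': "compact K'" unfolding K'_def
      by (rule compact_continuous_image[OF linear_continuous_on[OF R] H(6)])
    let ?J = "\<lambda>y. ennreal (param_jacobian D \<phi> y) * indicator K y"
    let ?J' = "\<lambda>z. ennreal (param_jacobian D' \<phi>' z) * indicator K' z"
    have meas: "?J \<in> borel_measurable borel" and meas': "?J' \<in> borel_measurable borel"
      by (rule borel_measurable_param_jacobian[OF H(4,6)] borel_measurable_param_jacobian[OF sm cK'], use H(7) K'U in auto)+
    have mL: "L \<in> borel_measurable borel"
      using linear_continuous_on[OF L] by (intro borel_measurable_continuous_onI)
    have mJL: "(\<lambda>z. ?J (L z)) \<in> borel_measurable borel"
      using measurable_compose[OF mL meas] .
    have RL: "R (L z) = z" if "z \<in> span D'" for z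
    proof -
      have "(\<Sum>b\<in>D. (z \<bullet> h b) *\<^sub>R h b) = (\<Sum>b'\<in>D'. (z \<bullet> b') *\<^sub>R b')"
        by (rule sum.reindex_bij_betw[OF h])
      then have "z = (\<Sum>b\<in>D. (z \<bullet> h b) *\<^sub>R h b)" using span_subset_Basis_expand[OF D'(1) that] by simp
      also have "\<dots> = R (L z)"
        unfolding L_def linear_sum[OF bounded_linear.linear[OF R]] linear_cmul[OF bounded_linear.linear[OF R]]
      proof (rule sum.cong)
        fix b assume b: "b \<in> D"
        have "R b = (\<Sum>a\<in>D. if a = b then h b else 0)"
          unfolding R_def using H(1) b by (intro sum.cong) (auto simp: inner_Basis subset_iff)
        then have "R b = h b" using fin b by simp
        then show "(z \<bullet> h b) *\<^sub>R h b = (z \<bullet> h b) *\<^sub>R R b" by simp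
      qed simp
      finally show ?thesis ..
    qed
    have JJ': "ennreal c * ?J (L z) = ?J' z" if z: "z \<in> span D'" for z
    proof (cases "z \<in> K'")
      case True
      then have "z \<in> U'" using K'U by blast
      then show ?thesis using True LK(1)[OF True] c by (simp add: J ennreal_mult')
    next
      case False
      then have "L z \<notin> K" using RL[OF z] unfolding K'_def by (metis image_eqI)
      then show ?thesis using False by simp
    qed
    have gm: "(\<lambda>g. \<Sum>b\<in>D'. g b *\<^sub>R b) \<in> measurable (\<Pi>\<^sub>M b\<in>D'. lborel) borel" by measurable
    have sets': "sets (lborel_span D') = sets borel" by (simp add: lborel_span_def)
    have "(\<integral>\<^sup>+ y. ?J y \<partial>lborel_span D) = (\<integral>\<^sup>+ z. ?J (L z) \<partial>lborel_span D')"
      unfolding lborel_span_reindex[OF H(1) D'(1) h] L_def[symmetric]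
      by (rule nn_integral_distr) (use mL meas in \<open>simp_all add: measurable_cong_sets[OF sets' refl]\<close>)
    then have "ennreal c * (\<integral>\<^sup>+ y. ?J y \<partial>lborel_span D) = (\<integral>\<^sup>+ z. ennreal c * ?J (L z) \<partial>lborel_span D')"
      using nn_integral_cmult[of "\<lambda>z. ?J (L z)" "lborel_span D'" "ennreal c"] mJL
      by (simp add: measurable_cong_sets[OF sets' refl])
    \<comment> \<open>The integrands are known to agree only on \<open>span D'\<close>; passing to
      the product measure turns every argument into a point of this span.\<close>
    also have "\<dots> = (\<integral>\<^sup>+ g. ennreal c * ?J (L (\<Sum>b\<in>D'. g b *\<^sub>R b)) \<partial>(\<Pi>\<^sub>M b\<in>D'. lborel))"
      unfolding lborel_span_def using mJL by (intro nn_integral_distr[OF gm]) simp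
    also have "\<dots> = (\<integral>\<^sup>+ g. ?J' (\<Sum>b\<in>D'. g b *\<^sub>R b) \<partial>(\<Pi>\<^sub>M b\<in>D'. lborel))"
      by (rule nn_integral_cong, rule JJ') (intro span_sum span_scale span_base)
    also have "\<dots> = (\<integral>\<^sup>+ z. ?J' z \<partial>lborel_span D')"
      unfolding lborel_span_def using meas' by (intro nn_integral_distr[OF gm, symmetric]) simp
    finally have int: "ennreal c * (\<integral>\<^sup>+ y. ?J y \<partial>lborel_span D) = (\<integral>\<^sup>+ z. ?J' z \<partial>lborel_span D')" .
    show ?thesis
    proof (intro exI conjI)
      show "ennreal c * (\<integral>\<^sup>+ y\<in>K. ennreal (param_jacobian D \<phi> y) \<partial>lborel_span D) =
          (\<integral>\<^sup>+ y\<in>K'. ennreal (param_jacobian D' \<phi>' y) \<partial>lborel_span D')"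
        by (rule int)
      show "D' \<subseteq> Basis" "card D' = d" "open U'" "smooth_on U' \<phi>'" "K' \<subseteq> U' \<inter> span D'"
        by fact+
      show "\<phi>' ` (U' \<inter> span D') \<subseteq> M2" using in_M1 \<Psi>(4) by (auto simp: \<phi>'_def)
      show "compact K'" by fact
      show "inj_on \<phi>' K'"
      proof (rule inj_onI)
        fix a b assume ab: "a \<in> K'" "b \<in> K'" "\<phi>' a = \<phi>' b"
        then have "\<phi> (L a) = \<phi> (L b)"
          using inj_onD[OF \<Psi>(5)] in_M1 K'U unfolding \<phi>'_def by blast
        then have "L a = L b" using inj_onD[OF H(8)] LK(1) ab by blast
        then show "a = b" using LK(2) ab by metis
      qed
    qed
  qed
  have "ennreal c * riemannian_volume d M1 = (SUP x\<in>{\<integral>\<^sup>+ y\<in>K. ennreal (param_jacobian D \<phi> y) \<partial>lborel_span D | D U K \<phi>.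
     D \<subseteq> Basis \<and> card D = d \<and> open U \<and> smooth_on U \<phi> \<and> \<phi> ` (U \<inter> span D) \<subseteq> M1 \<and>
     compact K \<and> K \<subseteq> U \<inter> span D \<and> inj_on \<phi> K}. ennreal c * x)"
    unfolding riemannian_volume_def using SUP_mult_left_ennreal[of "ennreal c" "\<lambda>x. x"] by simp
  also have "\<dots> \<le> riemannian_volume d M2"
  proof (rule SUP_least)
    fix x assume "x \<in> {\<integral>\<^sup>+ y\<in>K. ennreal (param_jacobian D \<phi> y) \<partial>lborel_span D | D U K \<phi>.
     D \<subseteq> Basis \<and> card D = d \<and> open U \<and> smooth_on U \<phi> \<and> \<phi> ` (U \<inter> span D) \<subseteq> M1 \<and>
     compact K \<and> K \<subseteq> U \<inter> span D \<and> inj_on \<phi> K}"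
    then obtain D U K \<phi> where x: "x = (\<integral>\<^sup>+ y\<in>K. ennreal (param_jacobian D \<phi> y) \<partial>lborel_span D)"
      and H: "D \<subseteq> Basis" "card D = d" "open U" "smooth_on U \<phi>" "\<phi> ` (U \<inter> span D) \<subseteq> M1"
      "compact K" "K \<subseteq> U \<inter> span D" "inj_on \<phi> K" by blast
    show "ennreal c * x \<le> riemannian_volume d M2"
      unfolding riemannian_volume_def x using main[OF H] by (intro Sup_upper) blast
  qed
  finally show ?thesis .
qed

text \<open>Parameter directions are indexed by \<open>D\<close> and singular frames by numbers; a
  bijection matches the two.\<close>

lemma det_on_gram_card:
  assumes v: "orthonormal_family {..<n::nat} v V" and A: "linear A" and D: "finite D" "card D = n"
    and u: "\<And>b. b \<in> D \<Longrightarrow> u b \<in> V"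
    and s: "\<And>i j. i < n \<Longrightarrow> j < n \<Longrightarrow> A (v i) \<bullet> A (v j) = (if i = j then s i else 0)"
  shows "det_on D (\<lambda>a b. A (u a) \<bullet> A (u b)) = (\<Prod>i<n. s i) * det_on D (\<lambda>a b. u a \<bullet> u b)"
proof -
  obtain h where h: "bij_betw h D {..<n}"
    using D by (metis card_lessThan finite_lessThan finite_same_card_bij)
  have hn: "h a < n" if "a \<in> D" for a using bij_betw_apply[OF h that] by simp
  have "det_on D (\<lambda>a b. A (u a) \<bullet> A (u b)) = (\<Prod>a\<in>D. s (h a)) * det_on D (\<lambda>a b. u a \<bullet> u b)"
    by (rule det_on_gram[OF orthonormal_family_reindex[OF v h] A u])
      (use s hn bij_betw_imp_inj_on[OF h] in \<open>auto simp: inj_on_def\<close>)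
  then show ?thesis by (simp add: prod.reindex_bij_betw[OF h, of s])
qed

section \<open>Volume of the Lawson-Osserman sphere\<close>

context lomse_target
begin

text \<open>The Jacobian of the map \<open>\<lambda>x. G (cos \<theta> *\<^sub>R x)\<close> from the
  unit sphere to the link: the tangent direction with index \<open>Suc i\<close> is stretched by
  \<open>cos \<theta> / \<tau> (Suc i)\<close>. Index 0 is absent because it is radial.\<close>

definition volume_ratio :: real where "volume_ratio = (\<Prod>i<n. cos \<theta> / \<tau> (Suc i))"

lemma volume_ratio_pos: "volume_ratio > 0"
  unfolding volume_ratio_def using cos_pos tau_pos by (intro prod_pos) auto

lemma n_le_dim: "n \<le> DIM(real^'a)" "n \<le> DIM((real^'a) \<times> (real^'b))"
  using card_a by auto

lemma tangent_space_sphere: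
  "tangent_space (sphere 0 1) x \<subseteq> {v. orthogonal x v}" for x :: "real^'a"
proof
  fix v assume "v \<in> tangent_space (sphere 0 1) x"
  then obtain \<gamma> \<epsilon> where g: "\<gamma> 0 = x" "v = velocity \<gamma>" "\<epsilon> > 0" "smooth_on {-\<epsilon><..<\<epsilon>} \<gamma>" "\<gamma> ` {-\<epsilon><..<\<epsilon>} \<subseteq> sphere 0 1"
    unfolding tangent_space_def curve_at_def by blast
  have "norm (\<gamma> t) = 1" if "t \<in> {-\<epsilon><..<\<epsilon>}" for t
    using subsetD[OF g(5), of "\<gamma> t"] that by simp
  from velocity_in_sphere[OF g(4,3) this] show "v \<in> {v. orthogonal x v}" using g by simp
qed

text \<open>The Jacobian is the same at all points, so pieces of the unit sphere go to pieces of the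
  link with areas multiplied by one factor. Together with the estimate for the inverse map this
  gives the exact volume.\<close>

lemma volume_le: "ennreal volume_ratio * riemannian_volume n (sphere (0::real^'a) 1) \<le> riemannian_volume n (lo_sphere f \<theta>)"
proof (rule riemannian_volume_image_le[where \<Psi> = "\<lambda>x. G (cos \<theta> *\<^sub>R x)" and V = "- {0}"])
  have "smooth_on (- {0::real^'a}) (\<lambda>x. cos \<theta> *\<^sub>R x)" by (intro smooth_intros open_nonzero)
  then show "smooth_on (- {0::real^'a}) (\<lambda>x. G (cos \<theta> *\<^sub>R x))"
    by (rule smooth_on_compose[OF open_nonzero open_nonzero smooth_G]) (use cos_pos in auto)
  show "(\<lambda>x. G (cos \<theta> *\<^sub>R x)) ` sphere 0 1 \<subseteq> lo_sphere f \<theta>"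
    unfolding lo_sphere_eq using cos_pos by (auto intro!: imageI)
  show "inj_on (\<lambda>x. G (cos \<theta> *\<^sub>R x)) (sphere 0 1)"
    using cos_pos by (auto simp: inj_on_def G_def)
  fix D u and q :: "real^'a"
  assume D: "finite D" "card D = n" and q: "q \<in> sphere 0 1" and u: "\<And>b::real^'a. b \<in> D \<Longrightarrow> u b \<in> tangent_space (sphere 0 1) q"
  have q0: "q \<noteq> 0" using q by auto
  have der: "frechet_derivative (\<lambda>x. G (cos \<theta> *\<^sub>R x)) (at q) v = cos \<theta> *\<^sub>R DG q v" for v
  proof -
    have "((\<lambda>x. G (cos \<theta> *\<^sub>R x)) has_derivative (\<lambda>v. DG (cos \<theta> *\<^sub>R q) (cos \<theta> *\<^sub>R v))) (at q)"
      by (rule has_derivative_compose[OF _ G_has_derivative]) (use q0 cos_pos in \<open>auto intro!: derivative_eq_intros\<close>)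
    then show ?thesis using frechet_derivative_eqI linear_cmul[OF linear_DG[OF q0]] DF_scale[OF cos_pos q0] by (fastforce simp: DG_def)
  qed
  obtain w where w: "singular_frame q w" using exists_singular_frame[OF q0] .
  note wD = singular_frameD[OF w]
  note sf = scaled_orthonormal_family[OF q0 w]
  have "det_on D (\<lambda>a b. cos \<theta> *\<^sub>R DG q (u a) \<bullet> cos \<theta> *\<^sub>R DG q (u b)) = (\<Prod>i<n. (cos \<theta> / \<tau> (Suc i))\<^sup>2) * det_on D (\<lambda>a b. u a \<bullet> u b)"
  proof (rule det_on_gram_card[OF wD(5) linear_compose_scale_right[OF linear_DG[OF q0]] D])
    show "u b \<in> {w. orthogonal q w}" if "b \<in> D" for b using u[OF that] tangent_space_sphere by blast
    show "cos \<theta> *\<^sub>R DG q (w (Suc i)) \<bullet> cos \<theta> *\<^sub>R DG q (w (Suc j)) = (if i = j then (cos \<theta> / \<tau> (Suc i))\<^sup>2 else 0)"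
      if "i < n" "j < n" for i j
    proof -
      have "\<tau> (Suc i) * \<tau> (Suc j) * (DG q (w (Suc i)) \<bullet> DG q (w (Suc j))) = (if i = j then 1 else 0)"
        using orthonormal_familyD(2)[OF sf, of "Suc i" "Suc j"] that by (simp add: mult_ac)
      then show ?thesis using tau_pos[of "Suc i"] tau_pos[of "Suc j"] by (auto simp: power2_eq_square field_simps)
    qed
  qed
  then show "det_on D (\<lambda>a b. frechet_derivative (\<lambda>x. G (cos \<theta> *\<^sub>R x)) (at q) (u a) \<bullet> frechet_derivative (\<lambda>x. G (cos \<theta> *\<^sub>R x)) (at q) (u b)) =
      volume_ratio\<^sup>2 * det_on D (\<lambda>a b. u a \<bullet> u b)"
    by (simp only: der volume_ratio_def prod_power_distrib)
qed (use n_le_dim less_imp_le[OF volume_ratio_pos] in auto)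

text \<open>The inverse map is a multiple of the projection \<open>fst\<close>. It is linear on the
  whole ambient space and has the reciprocal Jacobian on the link.\<close>

lemma volume_ge: "ennreal (1 / volume_ratio) * riemannian_volume n (lo_sphere f \<theta>) \<le> riemannian_volume n (sphere (0::real^'a) 1)"
proof (rule riemannian_volume_image_le[where \<Psi> = "\<lambda>z. (1 / cos \<theta>) *\<^sub>R fst z" and V = UNIV])
  have bl: "bounded_linear (\<lambda>z::(real^'a) \<times> (real^'b). (1 / cos \<theta>) *\<^sub>R fst z)"
    by (rule bounded_linear_const_scaleR[OF bounded_linear_fst])
  then show "smooth_on UNIV (\<lambda>z::(real^'a) \<times> (real^'b). (1 / cos \<theta>) *\<^sub>R fst z)" by (rule smooth_on_linear) simp
  show "(\<lambda>z. (1 / cos \<theta>) *\<^sub>R fst z) ` lo_sphere f \<theta> \<subseteq> sphere 0 1"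
    unfolding lo_sphere_eq using cos_pos by (auto simp: G_def)
  show "inj_on (\<lambda>z. (1 / cos \<theta>) *\<^sub>R fst z) (lo_sphere f \<theta>)"
    unfolding lo_sphere_eq using cos_pos by (auto simp: inj_on_def G_def)
  fix D u and q :: "(real^'a) \<times> (real^'b)"
  assume D: "finite D" "card D = n" and q: "q \<in> lo_sphere f \<theta>"
    and u: "\<And>b::(real^'a) \<times> (real^'b). b \<in> D \<Longrightarrow> u b \<in> tangent_space (lo_sphere f \<theta>) q"
  obtain y where y: "y \<in> sphere 0 (cos \<theta>)" "q = G y" using q unfolding lo_sphere_eq by blast
  then have y0: "y \<noteq> 0" "norm y = cos \<theta>" using cos_pos by auto
  have der: "frechet_derivative (\<lambda>z. (1 / cos \<theta>) *\<^sub>R fst z) (at q) v = (1 / cos \<theta>) *\<^sub>R fst v" for v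
    using frechet_derivative_eqI[OF bounded_linear.has_derivative[OF bl has_derivative_ident]] .
  obtain w where w: "singular_frame y w" using exists_singular_frame[OF y0(1)] .
  note wD = singular_frameD[OF w]
  note sf = orthonormal_familyD[OF scaled_orthonormal_family[OF y0(1) w]]
  have sub: "subspace (DG y ` {v. orthogonal y v})"
    by (rule linear_subspace_image[OF linear_DG[OF y0(1)]]) (auto simp: subspace_def orthogonal_clauses)
  have fam: "orthonormal_family {..<n} (\<lambda>i. \<tau> (Suc i) *\<^sub>R DG y (w (Suc i))) (DG y ` {v. orthogonal y v})"
  proof (rule orthonormal_family_subset_dim[OF sub])
    show "\<tau> (Suc i) *\<^sub>R DG y (w (Suc i)) \<in> DG y ` {v. orthogonal y v}" if "i \<in> {..<n}" for i
      using subspace_scale[OF sub] orthonormal_familyD(6)[OF wD(5) that] by blast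
    have "inj (DG y)" by (auto simp: inj_on_def DG_def)
    then have "dim (DG y ` {v. orthogonal y v}) = dim {v. orthogonal y v}"
      by (intro dim_image_eq linear_DG y0(1)) (auto intro: inj_on_subset)
    then show "card {..<n} = dim (DG y ` {v. orthogonal y v})" using orthonormal_family_card[OF wD(5)] by simp
  qed (use sf(2) in auto)
  have "det_on D (\<lambda>a b. (1 / cos \<theta>) *\<^sub>R fst (u a) \<bullet> (1 / cos \<theta>) *\<^sub>R fst (u b)) = (\<Prod>i<n. (\<tau> (Suc i) / cos \<theta>)\<^sup>2) * det_on D (\<lambda>a b. u a \<bullet> u b)"
  proof (rule det_on_gram_card[OF fam bounded_linear.linear[OF bl] D])
    show "u b \<in> DG y ` {v. orthogonal y v}" if "b \<in> D" for b
      using u[OF that] tangent_space_link[OF y0(1)] by (simp add: lo_sphere_eq y y0)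
    show "(1 / cos \<theta>) *\<^sub>R fst (\<tau> (Suc i) *\<^sub>R DG y (w (Suc i))) \<bullet> (1 / cos \<theta>) *\<^sub>R fst (\<tau> (Suc j) *\<^sub>R DG y (w (Suc j))) =
        (if i = j then (\<tau> (Suc i) / cos \<theta>)\<^sup>2 else 0)" if "i < n" "j < n" for i j
      using orthonormal_familyD(2)[OF wD(5), of i j] that by (simp add: DG_def power2_eq_square)
  qed
  moreover have "(\<Prod>i<n. (\<tau> (Suc i) / cos \<theta>)\<^sup>2) = (1 / volume_ratio)\<^sup>2"
    unfolding prod_power_distrib[symmetric] by (simp add: volume_ratio_def prod_dividef)
  ultimately show "det_on D (\<lambda>a b. frechet_derivative (\<lambda>z. (1 / cos \<theta>) *\<^sub>R fst z) (at q) (u a) \<bullet> frechet_derivative (\<lambda>z. (1 / cos \<theta>) *\<^sub>R fst z) (at q) (u b)) =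
      (1 / volume_ratio)\<^sup>2 * det_on D (\<lambda>a b. u a \<bullet> u b)"
    by (simp only: der)
qed (use n_le_dim volume_ratio_pos in auto)

lemma volume_lo_sphere:
  "riemannian_volume n (lo_sphere f \<theta>) = ennreal volume_ratio * riemannian_volume n (sphere (0::real^'a) 1)"
proof (rule antisym[OF _ volume_le])
  have "riemannian_volume n (lo_sphere f \<theta>) = ennreal volume_ratio * (ennreal (1 / volume_ratio) * riemannian_volume n (lo_sphere f \<theta>))"
    using volume_ratio_pos by (simp add: mult.assoc[symmetric] ennreal_mult''[symmetric])
  also have "\<dots> \<le> ennreal volume_ratio * riemannian_volume n (sphere (0::real^'a) 1)"
    using volume_ge by (rule mult_left_mono) simp
  finally show "riemannian_volume n (lo_sphere f \<theta>) \<le> ennreal volume_ratio * riemannian_volume n (sphere (0::real^'a) 1)" .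
qed

text \<open>The first \<open>p\<close> factors have square \<open>K / n\<close>, by the values of
  \<open>cos \<theta>\<close> and \<open>\<tau>\<close>; the remaining ones are
  \<open>cos \<theta>\<close> because \<open>\<tau>\<close> is 1 there.\<close>

lemma volume_ratio_eq:
  "volume_ratio = (K / n) powr (real p / 2) * ((1 - p / n) / (1 - p / K)) powr ((real n - real p) / 2)"
proof -
  let ?c = "(1 - p / n) / (1 - p / K)"
  have r: "real n > real p" "K > real n" "real p > 0" using p_less_n n_less_K p_pos by auto
  then have c0: "?c > 0" by (intro divide_pos_pos) (auto simp: divide_less_eq)
  have cos: "cos \<theta> = ?c powr (1 / 2)"
    using cos_theta_square cos_pos c0 by (metis abs_of_pos less_imp_le powr_half_sqrt real_sqrt_abs)
  have quot: "cos \<theta> / \<tau> (Suc i) = (K / n) powr (1 / 2)" if "i < p" for i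
  proof -
    have "(cos \<theta> / \<tau> (Suc i))\<^sup>2 = K / n"
    proof -
      have "1 - p / n = (real n - p) / n" "1 - p / K = (K - p) / K"
        using r by (simp_all add: diff_divide_distrib)
      then show ?thesis using that r by (simp add: power_divide cos_theta_square tau_cases)
    qed
    moreover have "cos \<theta> / \<tau> (Suc i) > 0" using cos_pos tau_pos by simp
    ultimately show ?thesis using K_pos by (metis abs_of_pos divide_nonneg_nonneg less_imp_le of_nat_0_le_iff powr_half_sqrt real_sqrt_abs)
  qed
  have "volume_ratio = (\<Prod>i\<in>{..<p} \<union> {p..<n}. cos \<theta> / \<tau> (Suc i))"
    unfolding volume_ratio_def using p_le_n by (intro prod.cong) auto
  also have "\<dots> = (\<Prod>i<p. cos \<theta> / \<tau> (Suc i)) * (\<Prod>i\<in>{p..<n}. cos \<theta> / \<tau> (Suc i))"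
    by (rule prod.union_disjoint) auto
  also have "(\<Prod>i<p. cos \<theta> / \<tau> (Suc i)) = ((K / n) powr (1 / 2)) ^ p"
    using quot by simp
  also have "(\<Prod>i\<in>{p..<n}. cos \<theta> / \<tau> (Suc i)) = (\<Prod>i\<in>{p..<n}. cos \<theta>)"
    by (rule prod.cong) (auto simp: tau_cases)
  also have "\<dots> = (?c powr (1 / 2)) ^ (n - p)" by (simp add: cos)
  also have "((K / n) powr (1 / 2)) ^ p = (K / n) powr (real p / 2)"
    using K_pos r by (simp add: powr_realpow[symmetric] powr_powr)
  also have "(?c powr (1 / 2)) ^ (n - p) = ?c powr ((real n - real p) / 2)"
    using c0 p_le_n by (subst powr_realpow[symmetric]) (auto simp: powr_powr of_nat_diff)
  finally show ?thesis .
qed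

end

section \<open>Bounded divergence-free vector fields with an isolated singularity\<close>

lemma integrable_bounded_support:
  fixes g :: "'e::euclidean_space \<Rightarrow> real"
  assumes "g \<in> borel_measurable borel" "\<And>y. \<bar>g y\<bar> \<le> C" "\<And>y. norm y > R \<Longrightarrow> g y = 0"
  shows "integrable lborel g"
proof (rule integrableI_bounded_set[of "cball 0 R"])
  show "emeasure lborel (cball (0::'e) R) < \<infinity>" by (rule emeasure_bounded_finite) simp
qed (use assms in \<open>auto simp: not_le\<close>)

text \<open>The value at the single exceptional point is split off as a multiple of an
  indicator.\<close>

lemma borel_measurable_continuous_off_0:
  fixes g :: "'e::euclidean_space \<Rightarrow> real"
  assumes "continuous_on (- {0}) g"
  shows "g \<in> borel_measurable borel"
proof -
  have "(\<lambda>y. indicator (- {0}) y *\<^sub>R g y) \<in> borel_measurable borel"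
    by (rule borel_measurable_continuous_on_indicator[OF _ assms]) auto
  moreover have "(\<lambda>y::'e. indicator {0} y * g 0) \<in> borel_measurable borel"
    by (intro borel_measurable_times borel_measurable_indicator borel_closed) auto
  ultimately have "(\<lambda>y. indicator (- {0}) y *\<^sub>R g y + indicator {0} y * g 0) \<in> borel_measurable borel"
    by (rule borel_measurable_add)
  moreover have "(\<lambda>y. indicator (- {0}) y *\<^sub>R g y + indicator {0} y * g 0) = g"
    by (auto simp: fun_eq_iff indicator_def)
  ultimately show ?thesis by simp
qed

text \<open>By translation invariance every difference quotient has integral zero.\<close>

lemma integral_directional_derivative:
  fixes g :: "'e::euclidean_space \<Rightarrow> real"
  assumes der: "\<And>y. (g has_derivative g' y) (at y)"
    and supp: "\<And>y. norm y > R \<Longrightarrow> g y = 0" and bound: "\<And>y. \<bar>g' y b\<bar> \<le> C"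
  shows "integrable lborel (\<lambda>y. g' y b)" "(\<integral>y. g' y b \<partial>lborel) = 0"
proof -
  have "isCont g y" for y by (rule has_derivative_continuous[OF der])
  then have cont: "continuous_on UNIV g" by (simp add: continuous_at_imp_continuous_on)
  then have [measurable]: "g \<in> borel_measurable borel" by (rule borel_measurable_continuous_onI)
  obtain B where "\<forall>y\<in>cball 0 R. \<bar>g y\<bar> \<le> B"
    using compact_imp_bounded[OF compact_continuous_image[OF continuous_on_subset[OF cont subset_UNIV] compact_cball[of 0 R]]]
    by (auto simp: bounded_iff)
  then have B: "\<And>y. y \<in> cball 0 R \<Longrightarrow> \<bar>g y\<bar> \<le> B" by blast
  have int_g: "integrable lborel g"
  proof (rule integrable_bounded_support)
    show "\<bar>g y\<bar> \<le> max B 0" for y using B[of y] supp[of y] by (cases "norm y \<le> R") auto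
  qed (use supp in auto)
  define s where "s k = 1 / real (Suc k)" for k
  have s: "0 < s k" "s k \<le> 1" for k by (auto simp: s_def)
  define d where "d k y = (g (s k *\<^sub>R b + y) - g y) / s k" for k y
  have line: "((\<lambda>t. g (y + t *\<^sub>R b)) has_real_derivative g' (y + t *\<^sub>R b) b) (at t)" for y t
    using has_derivative_line[OF der] by (simp add: has_real_derivative_iff_has_vector_derivative)
  have lim: "(\<lambda>k. d k y) \<longlonglongrightarrow> g' y b" for y
  proof -
    have "((\<lambda>t. (g (y + t *\<^sub>R b) - g (y + 0 *\<^sub>R b)) / (t - 0)) \<longlongrightarrow> g' y b) (at 0)"
      using line[of y 0] by (simp add: has_field_derivative_iff)
    moreover have "filterlim s (at 0) sequentially"
    proof (rule filterlim_atI)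
      show "s \<longlonglongrightarrow> 0" using LIMSEQ_Suc[OF lim_1_over_n] by (simp add: s_def[abs_def])
    qed (simp add: s_def)
    ultimately have "((\<lambda>k. (g (y + s k *\<^sub>R b) - g (y + 0 *\<^sub>R b)) / (s k - 0)) \<longlongrightarrow> g' y b) sequentially"
      by (rule filterlim_compose)
    then show ?thesis by (simp add: d_def add.commute)
  qed
  \<comment> \<open>By the mean value theorem the quotients inherit the bound on the derivative; as
    the increments are at most 1, they also vanish outside one fixed ball, and dominated convergence
    applies.\<close>
  have d_bound: "\<bar>d k y\<bar> \<le> C" for k y
  proof -
    have "\<exists>z>0. z < s k \<and> g (y + s k *\<^sub>R b) - g (y + 0 *\<^sub>R b) = (s k - 0) * g' (y + z *\<^sub>R b) b"
      by (rule MVT2[OF s(1)]) (rule line)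
    then obtain z where "g (y + s k *\<^sub>R b) - g y = s k * g' (y + z *\<^sub>R b) b" by auto
    then have "d k y = g' (y + z *\<^sub>R b) b" using s(1)[of k] by (simp add: d_def add.commute)
    then show ?thesis using bound by simp
  qed
  have d_supp: "d k y = 0" if "norm y > R + norm b" for k y
  proof -
    have "norm (s k *\<^sub>R b) \<le> norm b" using s(1,2)[of k] by (simp add: mult_left_le_one_le)
    then have "norm (s k *\<^sub>R b + y) > R" using that norm_diff_ineq[of y "s k *\<^sub>R b"] by (simp add: add.commute)
    moreover have "norm y > R" using that norm_ge_zero[of b] by linarith
    ultimately show ?thesis using supp by (simp add: d_def)
  qed
  have d_meas [measurable]: "d k \<in> borel_measurable borel" for k unfolding d_def by measurable
  have g'_meas: "(\<lambda>y. g' y b) \<in> borel_measurable borel"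
    by (rule borel_measurable_LIMSEQ_real[OF lim]) measurable
  let ?w = "\<lambda>y. C * indicator (cball 0 (R + norm b)) y :: real"
  have w: "integrable lborel ?w"
    by (intro integrable_mult_right integrable_real_indicator emeasure_bounded_finite bounded_cball) simp
  have dw: "AE y in lborel. norm (d k y) \<le> ?w y" for k
    using d_bound[of k] d_supp[of _ k] by (intro AE_I2) (auto simp: indicator_def not_le)
  have lim': "AE y in lborel. (\<lambda>k. d k y) \<longlonglongrightarrow> g' y b" using lim by simp
  have m: "(\<lambda>y. g' y b) \<in> borel_measurable lborel" "\<And>k. d k \<in> borel_measurable lborel" using g'_meas d_meas by simp_all
  show "integrable lborel (\<lambda>y. g' y b)" by (rule integrable_dominated_convergence[OF m w lim' dw])
  have lim_int: "(\<lambda>k. \<integral>y. d k y \<partial>lborel) \<longlonglongrightarrow> (\<integral>y. g' y b \<partial>lborel)"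
    by (rule integral_dominated_convergence[OF m w lim' dw])
  have "(\<integral>y. d k y \<partial>lborel) = 0" for k
  proof -
    have tr: "(\<integral>y. g (c + y) \<partial>lborel) = (\<integral>y. g y \<partial>lborel)" "integrable lborel (\<lambda>y. g (c + y))" for c
    proof -
      have "(\<integral>y. g y \<partial>distr lborel borel ((+) c)) = (\<integral>y. g (c + y) \<partial>lborel)"
        by (rule integral_distr) measurable
      then show "(\<integral>y. g (c + y) \<partial>lborel) = (\<integral>y. g y \<partial>lborel)" by (simp add: lborel_distr_plus)
      have "integrable (distr lborel borel ((+) c)) g \<longleftrightarrow> integrable lborel (\<lambda>y. g (c + y))"
        by (rule integrable_distr_eq) measurable
      then show "integrable lborel (\<lambda>y. g (c + y))" using int_g by (simp add: lborel_distr_plus)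
    qed
    show ?thesis unfolding d_def using tr int_g by simp
  qed
  then show "(\<integral>y. g' y b \<partial>lborel) = 0" using lim_int by (simp add: LIMSEQ_const_iff)
qed

text \<open>Squaring makes the positive part differentiable at 0 too, where the criterion of
  Caratheodory is used. Two such functions are nested in the cutoff.\<close>

lemma has_derivative_pos_part_square: "((\<lambda>t::real. (max 0 t)\<^sup>2) has_real_derivative 2 * max 0 t) (at t)"
proof (cases "t = 0")
  case True
  have "((\<lambda>t::real. (max 0 t)\<^sup>2) has_real_derivative 0) (at 0)"
    unfolding CARAT_DERIV
  proof (intro exI conjI allI)
    show "isCont (\<lambda>t::real. max 0 t) 0" by (intro continuous_intros)
  qed (auto simp: max_def power2_eq_square)
  then show ?thesis using True by simp
next
  case False
  show ?thesis
  proof (cases "t > 0")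
    case True
    have "((\<lambda>t::real. t\<^sup>2) has_real_derivative 2 * max 0 t) (at t)"
      using True by (auto intro!: derivative_eq_intros)
    then show ?thesis
      by (rule has_field_derivative_transform_within_open[of _ _ _ "{0<..}"]) (use True in auto)
  next
    case f: False
    have "((\<lambda>t::real. 0) has_real_derivative 2 * max 0 t) (at t)" using f by simp
    then show ?thesis
      by (rule has_field_derivative_transform_within_open[of _ _ _ "{..<0}"]) (use f False in auto)
  qed
qed

text \<open>A \<open>C\<^sup>1\<close> step from \<open>0\<close> on \<open>{..1}\<close> to \<open>1\<close> on \<open>{2..}\<close>.\<close>

definition step :: "real \<Rightarrow> real" where "step r = 1 - (max 0 (1 - (max 0 (r - 1))\<^sup>2))\<^sup>2"
definition step' :: "real \<Rightarrow> real" where "step' r = 2 * max 0 (1 - (max 0 (r - 1))\<^sup>2) * (2 * max 0 (r - 1))"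

lemma step_derivative: "(step has_real_derivative step' r) (at r)"
proof -
  have "((\<lambda>r. (max 0 (r - 1))\<^sup>2) has_real_derivative 2 * max 0 (r - 1) * 1) (at r)"
    by (rule DERIV_chain2[OF has_derivative_pos_part_square]) (auto intro!: derivative_eq_intros)
  then have 1: "((\<lambda>r. 1 - (max 0 (r - 1))\<^sup>2) has_real_derivative - (2 * max 0 (r - 1))) (at r)"
    using DERIV_diff[OF DERIV_const[of 1]] by fastforce
  show ?thesis
    unfolding step_def step'_def
    by (rule DERIV_cong[OF DERIV_diff[OF DERIV_const DERIV_chain2[OF has_derivative_pos_part_square 1]]]) simp
qed

lemma step_low: "r \<le> 1 \<Longrightarrow> step r = 0" "r \<le> 1 \<Longrightarrow> step' r = 0"
  by (auto simp: step_def step'_def max_def)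

lemma step_high: assumes "r \<ge> 2" shows "step r = 1" "step' r = 0"
proof -
  have "1 \<le> (r - 1)\<^sup>2" using assms by (simp add: one_le_power)
  then have "max 0 (1 - (max 0 (r - 1))\<^sup>2) = 0" using assms by simp
  then show "step r = 1" "step' r = 0" by (simp_all add: step_def step'_def)
qed

lemma step_bounds: "0 \<le> step r" "step r \<le> 1"
proof -
  have "max 0 (1 - (max 0 (r - 1))\<^sup>2) \<le> 1" by simp
  then have "(max 0 (1 - (max 0 (r - 1))\<^sup>2))\<^sup>2 \<le> 1" by (intro power_le_one) auto
  then show "0 \<le> step r" "step r \<le> 1" by (simp_all add: step_def)
qed

lemma step'_bounds: "\<bar>step' r\<bar> \<le> 4"
proof (cases "r \<ge> 2")
  case True
  then show ?thesis by (simp add: step_high)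
next
  case False
  have "2 * max 0 (1 - (max 0 (r - 1))\<^sup>2) * (2 * max 0 (r - 1)) \<le> 2 * 1 * (2 * 1)"
    by (intro mult_mono) (use False in auto)
  moreover have "step' r \<ge> 0" by (simp add: step'_def)
  ultimately show ?thesis by (simp add: step'_def)
qed

section \<open>Cutting off an isolated singularity\<close>

lemma compact_support_bound:
  fixes \<phi> :: "'e::euclidean_space \<Rightarrow> real"
  assumes "smooth_on UNIV \<phi>" "compact (closure {y. \<phi> y \<noteq> 0})"
  obtains R M where "R > 0" "M \<ge> 0" "\<And>y. norm y > R \<Longrightarrow> \<phi> y = 0"
    "\<And>y v. norm y > R \<Longrightarrow> frechet_derivative \<phi> (at y) v = 0" "\<And>y. \<bar>\<phi> y\<bar> \<le> M"
    "\<And>y v. \<bar>frechet_derivative \<phi> (at y) v\<bar> \<le> M * norm v"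
proof -
  let ?D = "\<lambda>y. frechet_derivative \<phi> (at y)"
  obtain R where R: "R > 0" "\<And>y. y \<in> closure {y. \<phi> y \<noteq> 0} \<Longrightarrow> norm y \<le> R"
    using compact_imp_bounded[OF assms(2)] bounded_pos by metis
  have zero: "\<phi> y = 0" if "norm y > R" for y
    using R(2)[of y] closure_subset[of "{y. \<phi> y \<noteq> 0}"] that by force
  have zero': "?D y v = 0" if "norm y > R" for y v
  proof (rule frechet_derivative_eqI)
    have "open {y::'e. norm y > R}" by (intro open_Collect_less continuous_intros)
    then show "(\<phi> has_derivative (\<lambda>v. 0)) (at y)"
      by (rule has_derivative_transform_within_open[OF has_derivative_const]) (use that zero in auto)
  qed
  have bd: "\<exists>M. \<forall>y\<in>cball 0 R. \<bar>g y\<bar> \<le> M" if "smooth_on UNIV g" for g :: "'e \<Rightarrow> real"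
    using compact_imp_bounded[OF compact_continuous_image[OF continuous_on_subset[OF smooth_on_continuous[OF that] subset_UNIV] compact_cball[of 0 R]]]
    by (auto simp: bounded_iff)
  obtain M1 where M1: "\<And>y. y \<in> cball 0 R \<Longrightarrow> \<bar>\<phi> y\<bar> \<le> M1" using bd[OF assms(1)] by blast
  have "\<forall>b. \<exists>M. \<forall>y\<in>cball 0 R. \<bar>?D y b\<bar> \<le> M"
    using bd smooth_on_frechet_derivative[OF assms(1)] by blast
  then obtain M2 where M2: "\<And>b y. y \<in> cball 0 R \<Longrightarrow> \<bar>?D y b\<bar> \<le> M2 b" by metis
  define M where "M = \<bar>M1\<bar> + (\<Sum>b\<in>Basis. \<bar>M2 b\<bar>)"
  have sum0: "0 \<le> (\<Sum>b\<in>Basis. \<bar>M2 b\<bar>)" by (intro sum_nonneg) auto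
  show thesis
  proof (rule that[of R M])
    show "M \<ge> 0" using sum0 by (simp add: M_def)
    show "\<bar>\<phi> y\<bar> \<le> M" for y
    proof (cases "norm y > R")
      case False
      then have "\<bar>\<phi> y\<bar> \<le> M1" using M1 by simp
      then show ?thesis using sum0 unfolding M_def by linarith
    qed (use zero sum0 in \<open>simp add: M_def\<close>)
    show "\<bar>?D y v\<bar> \<le> M * norm v" for y v
    proof (cases "norm y > R")
      case False
      have "?D y v = (\<Sum>b\<in>Basis. (v \<bullet> b) *\<^sub>R ?D y b)"
        by (rule linear_sum_Basis[OF has_derivative_linear[OF smooth_on_has_derivative[OF assms(1)]]]) auto
      then have "\<bar>?D y v\<bar> \<le> (\<Sum>b\<in>Basis. \<bar>(v \<bullet> b) *\<^sub>R ?D y b\<bar>)" by (simp only: sum_abs)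
      also have "\<dots> \<le> (\<Sum>b\<in>Basis. norm v * \<bar>M2 b\<bar>)"
      proof (rule sum_mono)
        fix b :: 'e assume b: "b \<in> Basis"
        have "\<bar>?D y b\<bar> \<le> \<bar>M2 b\<bar>" using M2[of y b] False by simp
        moreover have "\<bar>v \<bullet> b\<bar> \<le> norm v" using Basis_le_norm[OF b] .
        ultimately show "\<bar>(v \<bullet> b) *\<^sub>R ?D y b\<bar> \<le> norm v * \<bar>M2 b\<bar>" by (simp add: abs_mult mult_mono)
      qed
      also have "\<dots> = (\<Sum>b\<in>Basis. \<bar>M2 b\<bar>) * norm v" by (simp add: sum_distrib_left mult.commute)
      also have "\<dots> \<le> M * norm v" unfolding M_def by (intro mult_right_mono) auto
      finally show ?thesis .
    qed (use zero' sum0 in \<open>simp add: M_def\<close>)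
  qed (use R zero zero' in auto)
qed

text \<open>\<open>T\<close> is the divergence of \<open>X\<close> multiplied by
  \<open>\<phi>\<close> and by a cutoff that vanishes for \<open>norm y < e\<close>. This product is
  differentiable everywhere and has bounded support, so the derivative of each component in its own
  direction has integral zero; the term containing the divergence of \<open>X\<close> is zero by
  assumption.\<close>

lemma divergence_free_cutoff:
  fixes X :: "'e::euclidean_space \<Rightarrow> 'e" and \<phi> :: "'e \<Rightarrow> real"
  assumes X: "smooth_on (- {0}) X"
    and div: "\<And>y. y \<noteq> 0 \<Longrightarrow> (\<Sum>b\<in>Basis. frechet_derivative X (at y) b \<bullet> b) = 0"
    and \<phi>: "smooth_on UNIV \<phi>" "\<And>y. norm y > R \<Longrightarrow> \<phi> y = 0" "\<And>y v. norm y > R \<Longrightarrow> frechet_derivative \<phi> (at y) v = 0"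
    and e: "e > 0"
  defines "T \<equiv> \<lambda>y. step (y \<bullet> y / e\<^sup>2) * frechet_derivative \<phi> (at y) (X y)
                 + \<phi> y * (step' (y \<bullet> y / e\<^sup>2) * (2 * (y \<bullet> X y) / e\<^sup>2))"
  shows "integrable lborel T" "(\<integral>y. T y \<partial>lborel) = 0"
proof -
  let ?r = "\<lambda>y::'e. y \<bullet> y / e\<^sup>2"
  let ?D\<phi> = "\<lambda>y. frechet_derivative \<phi> (at y)"
  let ?DX = "\<lambda>y. frechet_derivative X (at y)"
  let ?D\<eta> = "\<lambda>y v. step' (?r y) * (2 * (y \<bullet> v) / e\<^sup>2)"
  \<comment> \<open>The \<open>b\<close>-component of the cut-off field. Its derivative in the
    direction \<open>b\<close>, summed over \<open>b\<close>, is \<open>T\<close>.\<close>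
  define \<psi> where "\<psi> b y = (X y \<bullet> b) * (step (?r y) * \<phi> y)" for b y
  define \<psi>' where "\<psi>' b y v = (X y \<bullet> b) * (step (?r y) * ?D\<phi> y v + ?D\<eta> y v * \<phi> y) + (?DX y v \<bullet> b) * (step (?r y) * \<phi> y)" for b y v
  have inside: "step (?r y) = 0" "step' (?r y) = 0" if "norm y < e" for y
  proof -
    have "(norm y)\<^sup>2 \<le> e\<^sup>2" using that by (intro power_mono) auto
    then have "?r y \<le> 1" using e by (simp add: power2_norm_eq_inner divide_le_eq_1)
    then show "step (?r y) = 0" "step' (?r y) = 0" by (simp_all add: step_low)
  qed
  have d\<eta>: "((\<lambda>y. step (?r y)) has_derivative ?D\<eta> y) (at y)" for y
  proof -
    have "(?r has_derivative (\<lambda>v. 2 * (y \<bullet> v) / e\<^sup>2)) (at y)"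
      by (rule derivative_eq_intros refl)+ (use e in \<open>auto simp: inner_commute\<close>)
    from has_derivative_compose[OF this step_derivative[unfolded has_field_derivative_def]] show ?thesis .
  qed
  have der: "(\<psi> b has_derivative \<psi>' b y) (at y)" for b y
  proof (cases "y = 0")
    case False
    have dX: "((\<lambda>y. X y \<bullet> b) has_derivative (\<lambda>v. ?DX y v \<bullet> b)) (at y)"
      by (rule has_derivative_inner_left[OF smooth_on_has_derivative[OF X]]) (use False in auto)
    have d\<phi>: "(\<phi> has_derivative ?D\<phi> y) (at y)" by (rule smooth_on_has_derivative[OF \<phi>(1)]) auto
    show ?thesis
      unfolding \<psi>_def \<psi>'_def by (intro has_derivative_mult dX d\<eta> d\<phi>)
  next
    case True
    have "((\<lambda>y. 0) has_derivative (\<lambda>v. 0)) (at y)" by simp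
    then have "(\<psi> b has_derivative (\<lambda>v. 0)) (at y)"
      by (rule has_derivative_transform_within_open[of _ _ _ _ "ball 0 e"]) (use True e inside in \<open>auto simp: \<psi>_def\<close>)
    moreover have "\<psi>' b y = (\<lambda>v. 0)" using inside[of y] True e by (auto simp: \<psi>'_def)
    ultimately show ?thesis by simp
  qed
  have supp: "\<psi> b y = 0" if "norm y > R" for b y using \<phi>(2)[OF that] by (simp add: \<psi>_def)
  have bound: "\<exists>C. \<forall>y. \<bar>\<psi>' b y b\<bar> \<le> C" for b
  proof -
    \<comment> \<open>Outside this annulus the derivative vanishes, and on it everything is
      continuous away from the singularity.\<close>
    let ?K = "cball 0 R - ball (0::'e) e"
    have cstep: "continuous_on UNIV (\<lambda>y. step (?r y))" "continuous_on UNIV (\<lambda>y. step' (?r y))"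
      unfolding step_def step'_def using e by (auto intro!: continuous_intros)
    have "continuous_on (- {0}) (\<lambda>y. \<psi>' b y b)"
      unfolding \<psi>'_def
      by (intro continuous_intros continuous_on_subset[OF cstep(1)] continuous_on_subset[OF cstep(2)]
          smooth_on_continuous X smooth_on_frechet_derivative[OF X]
          smooth_on_open_subset[OF \<phi>(1)] smooth_on_open_subset[OF smooth_on_frechet_derivative[OF \<phi>(1)]]) (use e in auto)
    then have "continuous_on ?K (\<lambda>y. \<psi>' b y b)" by (rule continuous_on_subset) (use e in auto)
    then obtain C where C: "\<And>y. y \<in> ?K \<Longrightarrow> \<bar>\<psi>' b y b\<bar> \<le> C"
      using compact_imp_bounded[OF compact_continuous_image[OF _ compact_diff[OF compact_cball open_ball]]]
      by (fastforce simp: bounded_iff)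
    have "\<bar>\<psi>' b y b\<bar> \<le> max C 0" for y
    proof (cases "y \<in> ?K")
      case True
      then show ?thesis using C[OF True] by simp
    next
      case False
      then have "norm y > R \<or> norm y < e" by auto
      then have "\<psi>' b y b = 0" using \<phi>(2,3)[of y] inside[of y] by (auto simp: \<psi>'_def)
      then show ?thesis by simp
    qed
    then show ?thesis by blast
  qed
  have int: "integrable lborel (\<lambda>y. \<psi>' b y b)" "(\<integral>y. \<psi>' b y b \<partial>lborel) = 0" for b
  proof -
    obtain C where "\<And>y. \<bar>\<psi>' b y b\<bar> \<le> C" using bound by blast
    from integral_directional_derivative[OF der supp this]
    show "integrable lborel (\<lambda>y. \<psi>' b y b)" "(\<integral>y. \<psi>' b y b \<partial>lborel) = 0" by auto
  qed
  have T: "T = (\<lambda>y. \<Sum>b\<in>Basis. \<psi>' b y b)"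
  proof
    fix y
    have lin: "linear (?D\<phi> y)" by (rule has_derivative_linear[OF smooth_on_has_derivative[OF \<phi>(1)]]) auto
    have "(\<Sum>b\<in>Basis. \<psi>' b y b) = step (?r y) * (\<Sum>b\<in>Basis. (X y \<bullet> b) *\<^sub>R ?D\<phi> y b)
        + \<phi> y * (step' (?r y) * (2 * (\<Sum>b\<in>Basis. (X y \<bullet> b) * (y \<bullet> b)) / e\<^sup>2))
        + step (?r y) * \<phi> y * (\<Sum>b\<in>Basis. ?DX y b \<bullet> b)"
      unfolding \<psi>'_def by (simp add: sum.distrib sum_distrib_left sum_divide_distrib algebra_simps)
    also have "(\<Sum>b\<in>Basis. (X y \<bullet> b) *\<^sub>R ?D\<phi> y b) = ?D\<phi> y (X y)"
      by (rule linear_sum_Basis[OF lin, symmetric])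
    also have "(\<Sum>b\<in>Basis. (X y \<bullet> b) * (y \<bullet> b)) = y \<bullet> X y"
      by (subst inner_commute[of y]) (rule euclidean_inner[symmetric])
    also have "step (?r y) * \<phi> y * (\<Sum>b\<in>Basis. ?DX y b \<bullet> b) = 0"
      using div[of y] inside[of y] e by (cases "y = 0") auto
    finally show "T y = (\<Sum>b\<in>Basis. \<psi>' b y b)" by (simp add: T_def)
  qed
  show "integrable lborel T" unfolding T by (intro Bochner_Integration.integrable_sum int(1))
  show "(\<integral>y. T y \<partial>lborel) = 0" unfolding T using int by (simp add: integral_sum)
qed

text \<open>A point is removable because the cutoff error is of order \<open>e\<^sup>N\<^sup>-\<^sup>1\<close> in dimension \<open>N \<ge> 2\<close>.\<close>

lemma divergence_free_weak:
  fixes X :: "'e::euclidean_space \<Rightarrow> 'e" and \<phi> h :: "'e \<Rightarrow> real"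
  assumes X: "smooth_on (- {0}) X" and bound: "\<And>y. y \<noteq> 0 \<Longrightarrow> norm (X y) \<le> C"
    and div: "\<And>y. y \<noteq> 0 \<Longrightarrow> (\<Sum>b\<in>Basis. frechet_derivative X (at y) b \<bullet> b) = 0"
    and dim: "DIM('e) \<ge> 2"
    and \<phi>: "smooth_on UNIV \<phi>" "compact (closure {y. \<phi> y \<noteq> 0})"
    and h: "\<And>y. y \<noteq> 0 \<Longrightarrow> h y = frechet_derivative \<phi> (at y) (X y)"
  shows "has_bochner_integral lborel h 0"
proof -
  let ?D\<phi> = "\<lambda>y. frechet_derivative \<phi> (at y)"
  obtain R M where RM: "R > 0" "M \<ge> 0" "\<And>y. norm y > R \<Longrightarrow> \<phi> y = 0"
    "\<And>y v. norm y > R \<Longrightarrow> ?D\<phi> y v = 0" "\<And>y. \<bar>\<phi> y\<bar> \<le> M" "\<And>y v. \<bar>?D\<phi> y v\<bar> \<le> M * norm v"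
    using compact_support_bound[OF \<phi>] by blast
  have C: "C \<ge> 0"
  proof -
    obtain b :: 'e where "b \<in> Basis" using nonempty_Basis by blast
    then have "norm (X b) \<le> C" by (intro bound nonzero_Basis)
    then show ?thesis using norm_ge_zero[of "X b"] by linarith
  qed
  have hX: "continuous_on (- {0}) (\<lambda>y. ?D\<phi> y (X y))"
  proof -
    have "continuous_on (- {0}) (\<lambda>y. \<Sum>b\<in>Basis. (X y \<bullet> b) *\<^sub>R ?D\<phi> y b)"
      by (intro continuous_intros smooth_on_continuous X smooth_on_open_subset[OF smooth_on_frechet_derivative[OF \<phi>(1)]]) auto
    moreover have "(\<Sum>b\<in>Basis. (X y \<bullet> b) *\<^sub>R ?D\<phi> y b) = ?D\<phi> y (X y)" for y
      by (rule linear_sum_Basis[symmetric, OF has_derivative_linear[OF smooth_on_has_derivative[OF \<phi>(1)]]]) auto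
    ultimately show ?thesis by simp
  qed
  then have ch: "continuous_on (- {0}) h" by (rule continuous_on_eq) (simp add: h)
  have hm: "h \<in> borel_measurable borel" by (rule borel_measurable_continuous_off_0[OF ch])
  have h_bound: "\<bar>h y\<bar> \<le> M * C" if "y \<noteq> 0" for y
    using h[OF that] RM(6)[of y "X y"] mult_left_mono[OF bound[OF that] RM(2)] by simp
  define e where "e k = 1 / real (Suc k)" for k
  have e: "0 < e k" "e k \<le> 1" for k by (auto simp: e_def)
  let ?r = "\<lambda>k y::'e. y \<bullet> y / (e k)\<^sup>2"
  \<comment> \<open>\<open>T1\<close> converges to \<open>h\<close>, while \<open>T2\<close> is the
    error caused by differentiating the cutoff.\<close>
  define T1 where "T1 k y = step (?r k y) * ?D\<phi> y (X y)" for k y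
  define T2 where "T2 k y = \<phi> y * (step' (?r k y) * (2 * (y \<bullet> X y) / (e k)\<^sup>2))" for k y
  \<comment> \<open>Beyond radius \<open>2 * e k\<close> the argument of \<open>step\<close> is in
    the range where \<open>step\<close> is constant, so the error lives in that ball.\<close>
  have r_ge: "2 \<le> ?r k y" if "(2 * e k)\<^sup>2 \<le> (norm y)\<^sup>2" for k y
  proof -
    have "2 * (e k)\<^sup>2 \<le> y \<bullet> y"
    proof -
      have "4 * (e k)\<^sup>2 \<le> y \<bullet> y" using that unfolding power_mult_distrib power2_norm_eq_inner by simp
      then show ?thesis using zero_le_power2[of "e k"] by linarith
    qed
    then show ?thesis using e(1)[of k] by (simp add: le_divide_eq)
  qed
  have cstep: "continuous_on S (\<lambda>y. step (?r k y))" "continuous_on S (\<lambda>y. step' (?r k y))" for k S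
    unfolding step_def step'_def using e(1)[of k] by (auto intro!: continuous_intros)
  have T1m: "T1 k \<in> borel_measurable borel" and T2m: "T2 k \<in> borel_measurable borel" for k
    unfolding T1_def T2_def using e(1)[of k]
    by (auto intro!: borel_measurable_continuous_off_0 continuous_intros cstep hX
        smooth_on_continuous[OF X] smooth_on_continuous[OF smooth_on_open_subset[OF \<phi>(1)]])
  have T0: "T1 k 0 = 0" "T2 k 0 = 0" for k by (simp_all add: T1_def T2_def step_low)
  have T1b: "\<bar>T1 k y\<bar> \<le> M * C * indicator (cball 0 R) y" for k y
  proof (cases "y = 0 \<or> norm y > R")
    case True
    then show ?thesis using T0 RM C by (auto simp: T1_def)
  next
    case False
    then have "\<bar>T1 k y\<bar> \<le> 1 * \<bar>h y\<bar>" unfolding T1_def abs_mult using h[of y] step_bounds[of "?r k y"]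
      by (intro mult_mono) auto
    then show ?thesis using h_bound[of y] False by simp
  qed
  \<comment> \<open>The factor 16 is the bound 4 on \<open>step'\<close> times another 4 from
    doubling \<open>norm y \<le> 2 * e k\<close>.\<close>
  have T2b: "\<bar>T2 k y\<bar> \<le> 16 * M * C / e k * indicator (cball 0 (2 * e k)) y" for k y
  proof (cases "y = 0")
    case True
    then show ?thesis using T0 RM C e(1)[of k] by simp
  next
    case y: False
    show ?thesis
    proof (cases "norm y \<le> 2 * e k")
      case True
      have "\<bar>y \<bullet> X y\<bar> \<le> (2 * e k) * C"
        using Cauchy_Schwarz_ineq2[of y "X y"] mult_mono[OF True bound[OF y]] e(1)[of k] by simp
      then have "\<bar>2 * (y \<bullet> X y) / (e k)\<^sup>2\<bar> \<le> 4 * C / e k"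
        using e(1)[of k] by (simp add: abs_mult power2_eq_square field_simps)
      then have "\<bar>T2 k y\<bar> \<le> M * (4 * (4 * C / e k))"
        unfolding T2_def abs_mult using RM(2,5) step'_bounds by (intro mult_mono) auto
      then show ?thesis using True by (simp add: mult_ac)
    next
      case False
      then have "(2 * e k)\<^sup>2 \<le> (norm y)\<^sup>2" using e(1)[of k] by (intro power_mono) auto
      then have "2 \<le> ?r k y" by (rule r_ge)
      then show ?thesis using False by (simp add: T2_def step_high)
    qed
  qed
  have iw1: "integrable lborel (\<lambda>y::'e. M * C * indicator (cball 0 R) y :: real)"
    by (intro integrable_mult_right integrable_real_indicator emeasure_bounded_finite bounded_cball) simp
  have iw2: "integrable lborel (\<lambda>y::'e. 16 * M * C / e k * indicator (cball 0 (2 * e k)) y :: real)" for k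
    by (intro integrable_mult_right integrable_real_indicator emeasure_bounded_finite bounded_cball) simp
  have iT1: "integrable lborel (T1 k)" for k
    by (rule Bochner_Integration.integrable_bound[OF iw1]) (use T1m T1b in \<open>auto intro!: AE_I2 order_trans[OF T1b] simp: abs_mult RM(2) C\<close>)
  have iT2: "integrable lborel (T2 k)" for k
    by (rule Bochner_Integration.integrable_bound[OF iw2[of k]])
      (use T2m e(1)[of k] in \<open>auto intro!: AE_I2 order_trans[OF T2b] simp: abs_mult RM(2) C less_imp_le\<close>)
  have T12: "(\<integral>y. T1 k y \<partial>lborel) = - (\<integral>y. T2 k y \<partial>lborel)" for k
  proof -
    have "(\<integral>y. T1 k y + T2 k y \<partial>lborel) = 0"
      unfolding T1_def T2_def by (rule divergence_free_cutoff(2)[where R = R]) (use X div \<phi>(1) RM(3,4) e(1) in auto)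
    then show ?thesis using iT1 iT2 by simp
  qed
  define Q where "Q = 16 * M * C * (unit_ball_vol (DIM('e)) * 2 ^ DIM('e))"
  have Q0: "Q \<ge> 0" using RM(2) C by (simp add: Q_def)
  have "\<bar>\<integral>y. T2 k y \<partial>lborel\<bar> \<le> Q * e k" for k
  proof -
    have "\<bar>\<integral>y. T2 k y \<partial>lborel\<bar> \<le> (\<integral>y. 16 * M * C / e k * indicator (cball 0 (2 * e k)) (y::'e) \<partial>lborel)"
      using T2b[of k] by (intro order_trans[OF integral_abs_bound] integral_mono integrable_abs iT2 iw2)
    also have "\<dots> = 16 * M * C / e k * (unit_ball_vol (DIM('e)) * (2 * e k) ^ DIM('e))"
      using e(1)[of k] by (simp add: content_cball less_imp_le)
    also have "\<dots> = Q * (e k ^ (DIM('e) - 1))"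
    proof -
      have "e k ^ DIM('e) = e k * e k ^ (DIM('e) - 1)" using dim by (simp flip: power_Suc)
      then show ?thesis using e(1)[of k] by (simp add: Q_def power_mult_distrib)
    qed
    \<comment> \<open>Dimension at least 2 is what leaves a positive power of \<open>e k\<close>
      here.\<close>
    also have "\<dots> \<le> Q * e k"
    proof -
      have "e k ^ (DIM('e) - 1) \<le> e k ^ 1" using e[of k] dim by (intro power_decreasing) auto
      then show ?thesis using Q0 by (simp add: mult_left_mono)
    qed
    finally show ?thesis .
  qed
  then have small: "norm (\<integral>y. T1 k y \<partial>lborel) \<le> Q * e k" for k using T12 by simp
  have Qe: "(\<lambda>k. Q * e k) \<longlonglongrightarrow> Q * 0"
    unfolding e_def by (intro tendsto_mult tendsto_const LIMSEQ_Suc lim_1_over_n)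
  have lim0: "(\<lambda>k. \<integral>y. T1 k y \<partial>lborel) \<longlonglongrightarrow> 0"
  proof (rule Lim_null_comparison)
    show "\<forall>\<^sub>F k in sequentially. norm (\<integral>y. T1 k y \<partial>lborel) \<le> Q * e k"
      by (rule always_eventually[OF allI]) (rule small)
    show "(\<lambda>k. Q * e k) \<longlonglongrightarrow> 0" using Qe by (simp only: mult_zero_right)
  qed
  have ae0: "AE y in lborel. (y::'e) \<noteq> 0" using AE_lborel_singleton[of 0] .
  have lim: "AE y in lborel. (\<lambda>k. T1 k y) \<longlonglongrightarrow> h y"
    using ae0
  proof eventually_elim
    fix y :: 'e assume y: "y \<noteq> 0"
    have "eventually (\<lambda>k. e k < norm y / 2) sequentially"
      unfolding e_def by (rule order_tendstoD(2)[OF LIMSEQ_Suc[OF lim_1_over_n]]) (use y in simp)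
    then have "eventually (\<lambda>k. T1 k y = h y) sequentially"
    proof eventually_elim
      fix k assume k: "e k < norm y / 2"
      have "(2 * e k)\<^sup>2 \<le> (norm y)\<^sup>2" using k e(1)[of k] by (intro power_mono) auto
      then have "2 \<le> ?r k y" by (rule r_ge)
      then show "T1 k y = h y" using h[OF y] by (simp add: T1_def step_high)
    qed
    then show "(\<lambda>k. T1 k y) \<longlonglongrightarrow> h y" by (rule tendsto_eventually)
  qed
  have meas: "h \<in> borel_measurable lborel" "\<And>k. T1 k \<in> borel_measurable lborel" using hm T1m by simp_all
  have dom: "AE y in lborel. norm (T1 k y) \<le> M * C * indicator (cball 0 R) y" for k
    using T1b by (intro AE_I2) simp
  have "integrable lborel h" by (rule integrable_dominated_convergence[OF meas iw1 lim dom])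
  moreover have "(\<lambda>k. \<integral>y. T1 k y \<partial>lborel) \<longlonglongrightarrow> (\<integral>y. h y \<partial>lborel)"
    by (rule integral_dominated_convergence[OF meas iw1 lim dom])
  then have "(\<integral>y. h y \<partial>lborel) = 0" using lim0 LIMSEQ_unique by blast
  ultimately show ?thesis by (simp add: has_bochner_integral_iff)
qed

section \<open>The minimal surface system\<close>

lemma divergence_free_weak_components:
  fixes g :: "'e::euclidean_space \<Rightarrow> 'e \<Rightarrow> real" and \<phi> h :: "'e \<Rightarrow> real"
  assumes g: "\<And>b. b \<in> Basis \<Longrightarrow> smooth_on (- {0}) (g b)"
    and bound: "\<And>b y. b \<in> Basis \<Longrightarrow> y \<noteq> 0 \<Longrightarrow> \<bar>g b y\<bar> \<le> C"
    and div: "\<And>y. y \<noteq> 0 \<Longrightarrow> (\<Sum>b\<in>Basis. frechet_derivative (g b) (at y) b) = 0"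
    and dim: "DIM('e) \<ge> 2"
    and \<phi>: "smooth_on UNIV \<phi>" "compact (closure {y. \<phi> y \<noteq> 0})"
    and h: "\<And>y. y \<noteq> 0 \<Longrightarrow> h y = (\<Sum>b\<in>Basis. g b y * frechet_derivative \<phi> (at y) b)"
  shows "has_bochner_integral lborel h 0"
proof (rule divergence_free_weak[where X = "\<lambda>y. \<Sum>b\<in>Basis. g b y *\<^sub>R b" and C = "real DIM('e) * C", OF _ _ _ dim \<phi>])
  have U: "open (- {0::'e})" by auto
  show "smooth_on (- {0}) (\<lambda>y. \<Sum>b\<in>Basis. g b y *\<^sub>R b)" by (intro smooth_intros U g)
  show "norm (\<Sum>b\<in>Basis. g b y *\<^sub>R b) \<le> real DIM('e) * C" if "y \<noteq> 0" for y
    using sum_norm_bound[of Basis "\<lambda>b. g b y *\<^sub>R b" C] bound[OF _ that] by simp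
  show "(\<Sum>b\<in>Basis. frechet_derivative (\<lambda>y. \<Sum>b\<in>Basis. g b y *\<^sub>R b) (at y) b \<bullet> b) = 0" if "y \<noteq> 0" for y
  proof -
    have "frechet_derivative (\<lambda>y. \<Sum>b\<in>Basis. g b y *\<^sub>R b) (at y) v = (\<Sum>b\<in>Basis. frechet_derivative (g b) (at y) v *\<^sub>R b)" for v
      by (rule frechet_derivative_eqI)
        (intro has_derivative_sum has_derivative_scaleR_left smooth_on_has_derivative[OF g U], use that in auto)
    then show ?thesis using div[OF that] by simp
  qed
  show "h y = frechet_derivative \<phi> (at y) (\<Sum>b\<in>Basis. g b y *\<^sub>R b)" if "y \<noteq> 0" for y
  proof -
    have lin: "linear (frechet_derivative \<phi> (at y))"
      by (rule has_derivative_linear[OF smooth_on_has_derivative[OF \<phi>(1)]]) auto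
    show ?thesis unfolding h[OF that] linear_sum[OF lin] linear_cmul[OF lin] by simp
  qed
qed

lemma sum_Basis_axis: "(\<Sum>b\<in>Basis. h b) = (\<Sum>i\<in>UNIV. h (axis i (1::real)))" for h :: "real^'a \<Rightarrow> 'f::comm_monoid_add"
proof -
  have 1: "Basis = (\<lambda>i. axis i (1::real)) ` (UNIV :: 'a set)" by (auto simp: Basis_vec_def)
  have 2: "inj (\<lambda>i::'a. axis i (1::real))" by (auto simp: inj_on_def axis_eq_axis)
  show ?thesis unfolding 1 sum.reindex[OF 2] by (simp add: o_def)
qed

lemma matrix_inv_eqI:
  fixes A B :: "real^'n^'n"
  assumes "A ** B = mat 1"
  shows "matrix_inv A = B"
proof -
  have BA: "B ** A = mat 1" using assms matrix_left_right_inverse by blast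
  then have "A ** matrix_inv A = mat 1"
    unfolding matrix_inv_def using assms someI[of "\<lambda>A'. A ** A' = mat 1 \<and> A' ** A = mat 1" B] by blast
  then have "B ** (A ** matrix_inv A) = B" by simp
  then show ?thesis by (simp add: matrix_mul_assoc BA)
qed

context lomse
begin

section \<open>The graph metric in singular frames\<close>

lemma jacobian_F: "jacobian F (at y) $ l $ i = DF y (axis i 1) $ l"
  by (simp add: jacobian_def matrix_def)

lemma frame_coordinates:
  assumes y: "y \<noteq> 0" and u: "singular_frame y u"
  shows "v \<bullet> w = (\<Sum>k\<le>n. (v \<bullet> u k) * (w \<bullet> u k))"
    "DF y v \<bullet> DF y w = (\<Sum>k\<le>n. sv k * (v \<bullet> u k) * (w \<bullet> u k))"
    "Dft y v \<bullet> Dft y w = (\<Sum>k\<le>n. (if 1 \<le> k \<and> k \<le> p then K / p / (norm y)\<^sup>2 else 0) * (v \<bullet> u k) * (w \<bullet> u k))"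
proof -
  note uD = singular_frameD[OF u]
  show "v \<bullet> w = (\<Sum>k\<le>n. (v \<bullet> u k) * (w \<bullet> u k))" by (rule orthonormal_family_inner[OF uD(1)]) simp
  show "DF y v \<bullet> DF y w = (\<Sum>k\<le>n. sv k * (v \<bullet> u k) * (w \<bullet> u k))"
    by (rule orthogonal_images_inner[OF uD(1) linear_DF[OF y]]) (use uD(3) in auto)
  show "Dft y v \<bullet> Dft y w = (\<Sum>k\<le>n. (if 1 \<le> k \<and> k \<le> p then K / p / (norm y)\<^sup>2 else 0) * (v \<bullet> u k) * (w \<bullet> u k))"
    by (rule orthogonal_images_inner[OF uD(1) linear_Dft[OF y]]) (use uD(4) in auto)
qed

lemma graph_metric_F:
  assumes y: "y \<noteq> 0" and u: "singular_frame y u"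
  shows "graph_metric F y $ i $ j = (\<Sum>k\<le>n. (1 + sv k) * (u k $ i) * (u k $ j))"
proof -
  have "(transpose (jacobian F (at y)) ** jacobian F (at y)) $ i $ j = DF y (axis i 1) \<bullet> DF y (axis j 1)"
    by (simp add: matrix_matrix_mult_def transpose_def jacobian_F inner_vec_def)
  then have "graph_metric F y $ i $ j = axis i 1 \<bullet> (axis j 1 :: real^'a) + DF y (axis i 1) \<bullet> DF y (axis j 1)"
    by (simp add: graph_metric_def mat_def inner_axis_axis)
  also have "\<dots> = (\<Sum>k\<le>n. (1 + sv k) * (u k $ i) * (u k $ j))"
    by (subst frame_coordinates(1)[OF y u], subst frame_coordinates(2)[OF y u]) (simp add: inner_axis' sum.distrib[symmetric] algebra_simps)
  finally show ?thesis .
qed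

lemma matrix_inv_graph_metric:
  assumes y: "y \<noteq> 0" and u: "singular_frame y u"
  shows "matrix_inv (graph_metric F y) $ i $ j = (\<Sum>k\<le>n. 1 / (1 + sv k) * (u k $ i) * (u k $ j))"
proof -
  note uD = singular_frameD[OF u]
  let ?B = "(\<chi> i j. \<Sum>k\<le>n. 1 / (1 + sv k) * (u k $ i) * (u k $ j)) :: real^'a^'a"
  have "(graph_metric F y ** ?B) $ i $ l = mat 1 $ i $ l" for i l
  proof -
    have "(graph_metric F y ** ?B) $ i $ l =
        (\<Sum>j\<in>UNIV. \<Sum>k\<le>n. \<Sum>k'\<le>n. (1 + sv k) / (1 + sv k') * (u k $ i) * (u k' $ l) * ((u k $ j) * (u k' $ j)))"
      by (simp add: matrix_matrix_mult_def graph_metric_F[OF y u] sum_product mult_ac)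
    also have "\<dots> = (\<Sum>k\<le>n. \<Sum>k'\<le>n. (1 + sv k) / (1 + sv k') * (u k $ i) * (u k' $ l) * (u k \<bullet> u k'))"
      by (simp add: sum.swap[of _ _ UNIV] inner_vec_def sum_distrib_left)
    also have "\<dots> = (\<Sum>k\<le>n. \<Sum>k'\<le>n. if k = k' then (u k $ i) * (u k $ l) else 0)"
    proof (intro sum.cong refl)
      fix k k' assume "k \<in> {..n}" "k' \<in> {..n}"
      then have "u k \<bullet> u k' = (if k = k' then 1 else 0)" by (rule orthonormal_familyD(2)[OF uD(1)])
      then show "(1 + sv k) / (1 + sv k') * (u k $ i) * (u k' $ l) * (u k \<bullet> u k') =
          (if k = k' then (u k $ i) * (u k $ l) else 0)"
        using one_plus_sv[of k] by (cases "k = k'") simp_all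
    qed
    also have "\<dots> = axis i 1 \<bullet> (axis l 1 :: real^'a)"
      by (subst frame_coordinates(1)[OF y u]) (simp add: inner_axis')
    finally show ?thesis by (simp add: mat_def inner_axis_axis)
  qed
  then have "graph_metric F y ** ?B = mat 1" by (simp add: vec_eq_iff)
  then show ?thesis by (simp add: matrix_inv_eqI)
qed

text \<open>The frame, reindexed by the coordinate type, forms an orthogonal matrix that
  diagonalizes the metric. The eigenvalues are the same at all nonzero points, so the density is
  constant there.\<close>

lemma graph_area_density_F:
  assumes y: "y \<noteq> 0"
  shows "graph_area_density F y = sqrt (\<Prod>k\<le>n. 1 + sv k)"
proof -
  obtain u where u: "singular_frame y u" using exists_singular_frame[OF y] .
  note uD = singular_frameD[OF u]
  obtain h :: "'a \<Rightarrow> nat" where h: "bij_betw h UNIV {..n}"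
    using finite_same_card_bij[of "UNIV :: 'a set" "{..n}"] card_a by auto
  have hn: "h a \<le> n" for a using bij_betw_apply[OF h, of a] by simp
  let ?V = "(\<chi> a j. u (h a) $ j) :: real^'a^'a"
  let ?D = "(\<chi> a b. if a = b then 1 + sv (h a) else 0) :: real^'a^'a"
  have "(transpose ?V ** (?D ** ?V)) $ i $ j = graph_metric F y $ i $ j" for i j
  proof -
    have "(?D ** ?V) $ a $ j = (1 + sv (h a)) * (u (h a) $ j)" for a
      by (simp add: matrix_matrix_mult_def if_distrib[of "\<lambda>x. x * _"] cong: if_cong)
    then have "(transpose ?V ** (?D ** ?V)) $ i $ j = (\<Sum>a\<in>UNIV. (1 + sv (h a)) * (u (h a) $ i) * (u (h a) $ j))"
    proof -
      have "(transpose ?V ** E) $ i $ j = (\<Sum>a\<in>UNIV. (u (h a) $ i) * (E $ a $ j))" for E :: "real^'a^'a"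
        by (simp add: matrix_matrix_mult_def transpose_def)
      from this[of "?D ** ?V"] show ?thesis
        using \<open>\<And>a. (?D ** ?V) $ a $ j = (1 + sv (h a)) * (u (h a) $ j)\<close> by (simp only: mult_ac)
    qed
    also have "\<dots> = (\<Sum>k\<le>n. (1 + sv k) * (u k $ i) * (u k $ j))"
      by (rule sum.reindex_bij_betw[OF h])
    finally show ?thesis by (simp add: graph_metric_F[OF y u])
  qed
  then have "graph_metric F y = transpose ?V ** (?D ** ?V)" by (simp add: vec_eq_iff)
  then have "det (graph_metric F y) = det ?V * det ?V * det ?D"
    by (simp add: det_mul det_transpose)
  also have "det ?V * det ?V = 1"
  proof -
    have "(?V ** transpose ?V) $ a $ b = mat 1 $ a $ b" for a b
    proof -
      have "(?V ** transpose ?V) $ a $ b = u (h a) \<bullet> u (h b)"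
        by (simp add: matrix_matrix_mult_def transpose_def inner_vec_def)
      also have "\<dots> = (if a = b then 1 else 0)"
        using orthonormal_familyD(2)[OF uD(1), of "h a" "h b"] hn bij_betw_imp_inj_on[OF h] by (auto simp: inj_on_def)
      finally show ?thesis by (simp add: mat_def)
    qed
    then have "?V ** transpose ?V = mat 1" by (simp add: vec_eq_iff)
    then have "det (?V ** transpose ?V) = 1" by simp
    then show ?thesis by (simp add: det_mul det_transpose)
  qed
  also have "det ?D = (\<Prod>a\<in>UNIV. 1 + sv (h a))"
    by (subst det_diagonal) auto
  also have "\<dots> = (\<Prod>k\<le>n. 1 + sv k)" by (rule prod.reindex_bij_betw[OF h])
  finally show ?thesis by (simp add: graph_area_density_def)
qed

definition radial_coeff :: real where "radial_coeff = 1 - 1 / (1 + sv 0)"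
text \<open>The factor \<open>p / K\<close> compensates for the nonzero eigenvalue
  \<open>K / p\<close> of the second correction field, so that the eigenvalue of the inverse metric
  comes out as \<open>1 / (1 + sv 1)\<close>.\<close>

definition tangential_coeff :: real where "tangential_coeff = (1 - 1 / (1 + sv 1)) * (p / K)"

text \<open>The inverse metric: \<open>radial_coeff\<close> is the correction in the radial direction, \<open>tangential_coeff\<close> the one on the
  orthogonal complement of the kernel of the differential of \<open>f\<close>.\<close>

definition gi :: "real^'a \<Rightarrow> real^'a \<Rightarrow> real^'a \<Rightarrow> real" where
  "gi b c y = b \<bullet> c - radial_coeff * ((y \<bullet> b) * (y \<bullet> c) * inverse (y \<bullet> y)) - tangential_coeff * ((y \<bullet> y) * (Dft y b \<bullet> Dft y c))"

text \<open>The value of the angle enters the differential equations here: both sides equal p (K -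
  n) / (K - p), and they are the sizes of the two divergences that have to cancel.\<close>

lemma trace_balance: "radial_coeff * n = tangential_coeff * K"
proof -
  have r: "real n > real p" "K > real n" "real p > 0" using p_less_n n_less_K p_pos by auto
  have "tangential_coeff * K = (1 - 1 / (1 + sv 1)) * p" using r by (simp add: tangential_coeff_def)
  also have "1 / (1 + sv 1) = (real n - real p) / (K - real p)" using tau_eq p_pos by (simp add: sv_def)
  finally have "tangential_coeff * K = p * (K - n) / (K - p)" using r by (simp add: field_simps)
  moreover have "1 / (1 + sv 0) = (1 - p / n) / (1 - p / K)"
  proof -
    have "1 + (tan \<theta>)\<^sup>2 = inverse ((cos \<theta>)\<^sup>2)" using tan_sec[of \<theta>] cos_pos by (simp add: power_inverse)
    then show ?thesis using cos_theta_square by (simp add: sv_def)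
  qed
  moreover have "(1 - (1 - p / n) / (1 - p / K)) * n = p * (K - n) / (K - p)"
  proof -
    have "1 - p / n = (real n - p) / n" "1 - p / K = (K - p) / K" using r by (simp_all add: diff_divide_distrib)
    then have "(1 - p / n) / (1 - p / K) * n = K * (real n - p) / (K - p)" using r by simp
    then have "(1 - (1 - p / n) / (1 - p / K)) * n = real n - K * (real n - p) / (K - p)"
      by (simp add: left_diff_distrib)
    also have "\<dots> = (real n * (K - p) - K * (real n - p)) / (K - p)" using r by (simp add: diff_divide_distrib)
    also have "real n * (K - p) - K * (real n - p) = p * (K - n)" by (simp add: algebra_simps)
    finally show ?thesis .
  qed
  ultimately show ?thesis by (simp add: radial_coeff_def)
qed

text \<open>The inverse metric has one eigenvalue at the radial index, one on the indices 1 to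
  \<open>p\<close>, and 1 elsewhere. Hence two corrections of the identity suffice, and both can be
  written without the frame.\<close>

lemma gi_frame:
  assumes y: "y \<noteq> 0" and u: "singular_frame y u"
  shows "gi b c y = (\<Sum>k\<le>n. 1 / (1 + sv k) * (b \<bullet> u k) * (c \<bullet> u k))"
proof -
  note uD = singular_frameD[OF u]
  have coeff: "1 / (1 + sv k) = 1 - (if k = 0 then radial_coeff else 0) - (if 1 \<le> k \<and> k \<le> p then tangential_coeff * (K / p) else 0)" for k
    using p_pos K_pos by (auto simp: radial_coeff_def tangential_coeff_def sv_def)
  have "(\<Sum>k\<le>n. 1 / (1 + sv k) * (b \<bullet> u k) * (c \<bullet> u k)) =
    (\<Sum>k\<le>n. (b \<bullet> u k) * (c \<bullet> u k)) - (\<Sum>k\<le>n. if k = 0 then radial_coeff * (b \<bullet> u 0) * (c \<bullet> u 0) else 0)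
    - (\<Sum>k\<le>n. (tangential_coeff * (norm y)\<^sup>2) * ((if 1 \<le> k \<and> k \<le> p then K / p / (norm y)\<^sup>2 else 0) * (b \<bullet> u k) * (c \<bullet> u k)))"
    unfolding sum_subtractf[symmetric]
  proof (intro sum.cong refl)
    fix k
    show "1 / (1 + sv k) * (b \<bullet> u k) * (c \<bullet> u k) =
      (b \<bullet> u k) * (c \<bullet> u k) - (if k = 0 then radial_coeff * (b \<bullet> u 0) * (c \<bullet> u 0) else 0)
      - (tangential_coeff * (norm y)\<^sup>2) * ((if 1 \<le> k \<and> k \<le> p then K / p / (norm y)\<^sup>2 else 0) * (b \<bullet> u k) * (c \<bullet> u k))"
      unfolding coeff[of k] using y
      by (cases "k = 0"; cases "1 \<le> k \<and> k \<le> p") (simp_all add: left_diff_distrib)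
  qed
  also have "\<dots> = b \<bullet> c - radial_coeff * (b \<bullet> u 0) * (c \<bullet> u 0) - (tangential_coeff * (norm y)\<^sup>2) * (Dft y b \<bullet> Dft y c)"
    unfolding sum_distrib_left[symmetric] frame_coordinates(1,3)[OF y u, of b c, symmetric] by simp
  also have "\<dots> = gi b c y"
    unfolding gi_def uD(2) using y
    by (simp add: power2_norm_eq_inner[symmetric] inner_commute[of _ y] power2_eq_square field_simps)
  finally show ?thesis ..
qed

lemma inverse_metric_eq:
  assumes y: "y \<noteq> 0"
  shows "matrix_inv (graph_metric F y) $ i $ j = gi (axis i 1) (axis j 1) y"
proof -
  obtain u where u: "singular_frame y u" using exists_singular_frame[OF y] .
  show ?thesis unfolding matrix_inv_graph_metric[OF y u] gi_frame[OF y u] by (simp add: inner_axis')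
qed

lemma gi_bound:
  assumes y: "y \<noteq> 0" and b: "norm b \<le> 1" and c: "norm c \<le> 1"
  shows "\<bar>gi b c y\<bar> \<le> n + 1"
proof -
  obtain u where u: "singular_frame y u" using exists_singular_frame[OF y] .
  note U = orthonormal_familyD[OF singular_frameD(1)[OF u]]
  have le1: "\<bar>w \<bullet> u k\<bar> \<le> 1" if "k \<le> n" "norm w \<le> 1" for k w
    using Cauchy_Schwarz_ineq2[of w "u k"] U(8)[of k] that by simp
  have "\<bar>gi b c y\<bar> \<le> (\<Sum>k\<le>n. \<bar>1 / (1 + sv k) * (b \<bullet> u k) * (c \<bullet> u k)\<bar>)"
    unfolding gi_frame[OF y u] by (rule sum_abs)
  also have "\<dots> \<le> (\<Sum>k\<le>n. 1 * 1 * 1)"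
  proof (rule sum_mono)
    fix k assume k: "k \<in> {..n}"
    have "\<bar>1 / (1 + sv k)\<bar> \<le> 1" using sv_nonneg[of k] by simp
    then show "\<bar>1 / (1 + sv k) * (b \<bullet> u k) * (c \<bullet> u k)\<bar> \<le> 1 * 1 * 1"
      unfolding abs_mult using le1 k b c by (intro mult_mono) auto
  qed
  finally show ?thesis by simp
qed

text \<open>The Hilbert-Schmidt norm of \<open>DF\<close>, which is the same at all nonzero
  points.\<close>

definition lipschitz_const :: real where "lipschitz_const = sqrt (\<Sum>k\<le>n. sv k)"

lemma norm_DF_le:
  assumes y: "y \<noteq> 0"
  shows "norm (DF y v) \<le> lipschitz_const * norm v"
proof -
  obtain u where u: "singular_frame y u" using exists_singular_frame[OF y] .
  note U = orthonormal_familyD[OF singular_frameD(1)[OF u]]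
  have "(norm (DF y v))\<^sup>2 = (\<Sum>k\<le>n. sv k * (v \<bullet> u k)\<^sup>2)"
    unfolding power2_norm_eq_inner by (subst frame_coordinates(2)[OF y u]) (simp add: power2_eq_square mult.assoc)
  also have "\<dots> \<le> (\<Sum>k\<le>n. sv k * (norm v)\<^sup>2)"
  proof (intro sum_mono mult_left_mono sv_nonneg)
    fix k assume "k \<in> {..n}"
    then have "\<bar>v \<bullet> u k\<bar> \<le> norm v" using Cauchy_Schwarz_ineq2[of v "u k"] U(8)[of k] by simp
    then show "(v \<bullet> u k)\<^sup>2 \<le> (norm v)\<^sup>2" by (metis abs_norm_cancel abs_le_square_iff)
  qed
  also have "\<dots> = (lipschitz_const * norm v)\<^sup>2"
    using sv_nonneg by (simp add: lipschitz_const_def power_mult_distrib sum_distrib_right sum_nonneg)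
  finally show ?thesis by (rule power2_le_imp_le) (simp add: lipschitz_const_def sum_nonneg sv_nonneg)
qed

lemma lipschitz_const_ge: "lipschitz_const \<ge> tan \<theta>"
proof -
  have "sv 0 \<le> (\<Sum>k\<le>n. sv k)" by (rule member_le_sum) (auto simp: sv_nonneg)
  then have "(tan \<theta>)\<^sup>2 \<le> (\<Sum>k\<le>n. sv k)" by (simp add: sv_def)
  then show ?thesis unfolding lipschitz_const_def by (rule real_le_rsqrt)
qed

text \<open>A segment that avoids the origin is covered by the bound on the derivative. On a segment
  through the origin the norms of the end points add up to their distance, and \<open>F\<close>
  multiplies norms by \<open>tan \<theta>\<close>.\<close>

lemma lipschitz_F: "lipschitz_const-lipschitz_on UNIV F"
proof (rule lipschitz_onI)
  show "0 \<le> lipschitz_const" using lipschitz_const_ge tan_pos by linarith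
  fix y z :: "real^'a"
  show "dist (F y) (F z) \<le> lipschitz_const * dist y z"
  proof (cases "0 \<in> closed_segment y z")
    case True
    then have "dist y z = norm y + norm z"
      using between_mem_segment[of y z 0] between[of y z 0] by simp
    moreover have "norm (F w) = tan \<theta> * norm w" for w
      using tan_pos norm_ft[of w] by (cases "w = 0") (auto simp: F_def)
    ultimately have "dist (F y) (F z) \<le> tan \<theta> * dist y z"
      using norm_triangle_ineq4[of "F y" "F z"] by (simp add: dist_norm distrib_left)
    also have "\<dots> \<le> lipschitz_const * dist y z" by (intro mult_right_mono lipschitz_const_ge) simp
    finally show ?thesis .
  next
    case False
    have "norm (F z - F y) \<le> lipschitz_const * norm (z - y)"
    proof (rule differentiable_bound[of "closed_segment y z" F "\<lambda>w. DF w"])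
      fix w assume "w \<in> closed_segment y z"
      then have w: "w \<noteq> 0" using False by auto
      show "(F has_derivative DF w) (at w within closed_segment y z)"
        by (rule has_derivative_at_withinI[OF F_has_derivative[OF w]])
      show "onorm (DF w) \<le> lipschitz_const" by (rule onorm_le) (rule norm_DF_le[OF w])
    qed auto
    then show ?thesis by (simp add: dist_norm norm_minus_commute)
  qed
qed

section \<open>Divergence of the inverse metric and the weak equations\<close>

lemma smooth_gi: "smooth_on (- {0}) (gi b c)"
  unfolding gi_def
  by (intro smooth_intros open_nonzero smooth_on_frechet_derivative smooth_ft) auto

lemma gi_has_derivative:
  assumes y: "y \<noteq> 0"
  shows "(gi b c has_derivative (\<lambda>v.
     - radial_coeff * (((v \<bullet> b) * (y \<bullet> c) + (y \<bullet> b) * (v \<bullet> c)) * inverse (y \<bullet> y)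
            - (y \<bullet> b) * (y \<bullet> c) * (2 * (y \<bullet> v) * (inverse (y \<bullet> y))\<^sup>2))
     - tangential_coeff * (2 * (y \<bullet> v) * (Dft y b \<bullet> Dft y c) + (y \<bullet> y) * (D2 ft y v b \<bullet> Dft y c + Dft y b \<bullet> D2 ft y v c)))) (at y)"
proof -
  have d: "((\<lambda>z. Dft z w) has_derivative (\<lambda>v. D2 ft y v w)) (at y)" for w
    by (rule D2_has_derivative[OF smooth_ft open_nonzero]) (use y in auto)
  have id: "((\<lambda>z. z) has_derivative (\<lambda>v. v)) (at y)" by (rule has_derivative_ident)
  have Q: "((\<lambda>z. z \<bullet> z) has_derivative (\<lambda>v. y \<bullet> v + v \<bullet> y)) (at y)"
    by (rule has_derivative_inner[OF id id])
  have R: "((\<lambda>z. inverse (z \<bullet> z)) has_derivative (\<lambda>v. - (inverse (y \<bullet> y) * (y \<bullet> v + v \<bullet> y) * inverse (y \<bullet> y)))) (at y)"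
    by (rule Deriv.has_derivative_inverse[OF _ Q]) (use y in simp)
  have P: "((\<lambda>z. (z \<bullet> b) * (z \<bullet> c)) has_derivative (\<lambda>v. (y \<bullet> b) * (v \<bullet> c) + (v \<bullet> b) * (y \<bullet> c))) (at y)"
    by (intro has_derivative_mult has_derivative_inner_left id)
  have S: "((\<lambda>z. Dft z b \<bullet> Dft z c) has_derivative (\<lambda>v. Dft y b \<bullet> D2 ft y v c + D2 ft y v b \<bullet> Dft y c)) (at y)"
    by (rule has_derivative_inner[OF d d])
  have "(gi b c has_derivative (\<lambda>v. 0
     - radial_coeff * (((y \<bullet> b) * (y \<bullet> c)) * (- (inverse (y \<bullet> y) * (y \<bullet> v + v \<bullet> y) * inverse (y \<bullet> y)))
            + ((y \<bullet> b) * (v \<bullet> c) + (v \<bullet> b) * (y \<bullet> c)) * inverse (y \<bullet> y))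
     - tangential_coeff * ((y \<bullet> y) * (Dft y b \<bullet> D2 ft y v c + D2 ft y v b \<bullet> Dft y c) + (y \<bullet> v + v \<bullet> y) * (Dft y b \<bullet> Dft y c)))) (at y)"
    unfolding gi_def
    by (intro has_derivative_diff has_derivative_const has_derivative_mult_right has_derivative_mult P Q R S)
  then show ?thesis
    by (rule has_derivative_eq_rhs)
      (simp add: fun_eq_iff power2_eq_square inner_commute algebra_simps)
qed

text \<open>The Laplacian of \<open>ft\<close> is parallel to \<open>ft\<close>, hence orthogonal to
  its derivatives; the radial derivative of \<open>ft\<close> is zero; and differentiating the
  energy identity, with the symmetry of \<open>D2\<close>, gives \<open>s4\<close>. The radial
  correction field then has divergence n y / |y|^2 and the other one - K y / |y|^2, and
  \<open>trace_balance\<close> cancels them.\<close>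

lemma divergence_gi:
  assumes y: "y \<noteq> 0"
  shows "(\<Sum>b\<in>Basis. frechet_derivative (gi b c) (at y) b) = 0"
proof -
  define r where "r = inverse (y \<bullet> y)"
  have yr: "(y \<bullet> y) * r = 1" using y by (simp add: r_def)
  have yU: "y \<in> - {0}" using y by simp
  note lin = linear_Dft[OF y]
  have s1: "(\<Sum>b\<in>Basis. (y \<bullet> b) * (b \<bullet> w)) = y \<bullet> w" for w
    by (subst euclidean_inner[of y w]) (simp add: inner_commute)
  have s2: "(\<Sum>b\<in>Basis. (y \<bullet> b) * (Dft y b \<bullet> Dft y c)) = 0"
  proof -
    have "(\<Sum>b\<in>Basis. (y \<bullet> b) * (Dft y b \<bullet> Dft y c)) = (\<Sum>b\<in>Basis. (y \<bullet> b) *\<^sub>R Dft y b) \<bullet> Dft y c"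
      by (simp add: inner_sum_left)
    also have "(\<Sum>b\<in>Basis. (y \<bullet> b) *\<^sub>R Dft y b) = Dft y y" by (rule linear_sum_Basis[OF lin, symmetric])
    finally show ?thesis by (simp add: Dft_self[OF y])
  qed
  have s3: "(\<Sum>b\<in>Basis. D2 ft y b b \<bullet> Dft y c) = 0"
    unfolding inner_sum_left[symmetric] laplace_ft[OF y] using inner_ft_Dft[OF y] by simp
  have s4: "(\<Sum>b\<in>Basis. Dft y b \<bullet> D2 ft y b c) = - K * (y \<bullet> c) * r\<^sup>2"
  proof -
    have d: "((\<lambda>z. Dft z w) has_derivative (\<lambda>v. D2 ft y v w)) (at y)" for w
      by (rule D2_has_derivative[OF smooth_ft open_nonzero yU])
    have "((\<lambda>z. \<Sum>b\<in>Basis. Dft z b \<bullet> Dft z b) has_derivative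
        (\<lambda>v. \<Sum>b\<in>Basis. Dft y b \<bullet> D2 ft y v b + D2 ft y v b \<bullet> Dft y b)) (at y)"
      by (intro has_derivative_sum has_derivative_inner d)
    moreover have "((\<lambda>z. \<Sum>b\<in>Basis. Dft z b \<bullet> Dft z b) has_derivative (\<lambda>v. - K * (2 * (y \<bullet> v) * r\<^sup>2))) (at y)"
    proof (rule has_derivative_transform_within_open[OF _ open_nonzero yU])
      show "((\<lambda>z. K * inverse (z \<bullet> z)) has_derivative (\<lambda>v. - K * (2 * (y \<bullet> v) * r\<^sup>2))) (at y)"
      proof -
        have id: "((\<lambda>z. z) has_derivative (\<lambda>v. v)) (at y)" by (rule has_derivative_ident)
        have "((\<lambda>z. K * inverse (z \<bullet> z)) has_derivative (\<lambda>v. K * - (inverse (y \<bullet> y) * (y \<bullet> v + v \<bullet> y) * inverse (y \<bullet> y)))) (at y)"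
          by (rule has_derivative_mult_right[OF Deriv.has_derivative_inverse[OF _ has_derivative_inner[OF id id]]]) (use y in simp)
        then show ?thesis
          by (rule has_derivative_eq_rhs) (simp add: r_def fun_eq_iff power2_eq_square inner_commute)
      qed
      show "K * inverse (z \<bullet> z) = (\<Sum>b\<in>Basis. Dft z b \<bullet> Dft z b)" if "z \<in> - {0}" for z
        using energy_ft[of z] that by (simp add: power2_norm_eq_inner divide_inverse)
    qed
    ultimately have eq: "(\<lambda>v. \<Sum>b\<in>Basis. Dft y b \<bullet> D2 ft y v b + D2 ft y v b \<bullet> Dft y b) = (\<lambda>v. - K * (2 * (y \<bullet> v) * r\<^sup>2))"
      by (rule has_derivative_unique)
    have cancel: "a = - K * x * z" if "2 * a = - K * (2 * x * z)" for a x z :: real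
      using that by simp
    from fun_cong[OF eq, of c] have "2 * (\<Sum>b\<in>Basis. Dft y b \<bullet> D2 ft y c b) = - K * (2 * (y \<bullet> c) * r\<^sup>2)"
      by (simp add: inner_commute sum_distrib_left)
    then have "(\<Sum>b\<in>Basis. Dft y b \<bullet> D2 ft y c b) = - K * (y \<bullet> c) * r\<^sup>2" by (rule cancel)
    moreover have "(\<Sum>b\<in>Basis. Dft y b \<bullet> D2 ft y b c) = (\<Sum>b\<in>Basis. Dft y b \<bullet> D2 ft y c b)"
      by (rule sum.cong[OF refl], rule arg_cong2[where f = inner, OF refl], rule D2_commute[OF smooth_ft open_nonzero yU])
    ultimately show ?thesis by (simp only:)
  qed
  have "(\<Sum>b\<in>Basis. frechet_derivative (gi b c) (at y) b) =
    (\<Sum>b\<in>Basis. - radial_coeff * (((b \<bullet> b) * (y \<bullet> c) + (y \<bullet> b) * (b \<bullet> c)) * r - (y \<bullet> b) * (y \<bullet> c) * (2 * (y \<bullet> b) * r\<^sup>2))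
      - tangential_coeff * (2 * (y \<bullet> b) * (Dft y b \<bullet> Dft y c) + (y \<bullet> y) * (D2 ft y b b \<bullet> Dft y c + Dft y b \<bullet> D2 ft y b c)))"
    by (intro sum.cong refl) (simp only: frechet_derivative_eqI[OF gi_has_derivative[OF y]] r_def)
  also have "\<dots> = - radial_coeff * ((real DIM(real^'a) * (y \<bullet> c) + (\<Sum>b\<in>Basis. (y \<bullet> b) * (b \<bullet> c))) * r
      - 2 * (y \<bullet> c) * r\<^sup>2 * (\<Sum>b\<in>Basis. (y \<bullet> b) * (b \<bullet> y)))
      - tangential_coeff * (2 * (\<Sum>b\<in>Basis. (y \<bullet> b) * (Dft y b \<bullet> Dft y c))
         + (y \<bullet> y) * ((\<Sum>b\<in>Basis. D2 ft y b b \<bullet> Dft y c) + (\<Sum>b\<in>Basis. Dft y b \<bullet> D2 ft y b c)))"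
    by (simp add: sum_subtractf sum.distrib sum_negf sum_distrib_left sum_distrib_right inner_commute algebra_simps)
  also have "\<dots> = - radial_coeff * ((real (n + 1) * (y \<bullet> c) + (y \<bullet> c)) * r - 2 * (y \<bullet> c) * r * ((y \<bullet> y) * r))
      + tangential_coeff * K * (y \<bullet> c) * r * ((y \<bullet> y) * r)"
    unfolding s1 s2 s3 s4 using card_a by (simp add: power2_eq_square algebra_simps)
  also have "\<dots> = (tangential_coeff * K - radial_coeff * n) * ((y \<bullet> c) * r)"
    unfolding yr by (simp add: algebra_simps)
  finally show ?thesis using trace_balance by simp
qed

text \<open>The minimality relation is freed of its frame by expansion over \<open>Basis\<close>;
  only this form can be combined with the product rule for \<open>gi\<close>.\<close>

lemma trace_gi_D2F:
  assumes y: "y \<noteq> 0"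
  shows "(\<Sum>b\<in>Basis. \<Sum>c\<in>Basis. gi b c y *\<^sub>R D2 F y b c) = 0"
proof -
  obtain u where u: "singular_frame y u" using exists_singular_frame[OF y] .
  have yU: "y \<in> - {0}" using y by simp
  have exp: "D2 F y w w = (\<Sum>b\<in>Basis. \<Sum>c\<in>Basis. ((b \<bullet> w) * (c \<bullet> w)) *\<^sub>R D2 F y b c)" for w
    by (subst linear_sum_Basis[OF D2_linear_left[OF smooth_F open_nonzero yU], of _ w],
        subst D2_expand_right[OF smooth_F open_nonzero yU, of _ w])
      (simp add: scaleR_sum_right inner_commute)
  have "(\<Sum>b\<in>Basis. \<Sum>c\<in>Basis. gi b c y *\<^sub>R D2 F y b c) =
    (\<Sum>b\<in>Basis. \<Sum>c\<in>Basis. \<Sum>k\<le>n. (1 / (1 + sv k)) *\<^sub>R (((b \<bullet> u k) * (c \<bullet> u k)) *\<^sub>R D2 F y b c))"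
    unfolding gi_frame[OF y u] by (simp add: scaleR_sum_left mult.assoc)
  also have "\<dots> = (\<Sum>k\<le>n. (1 / (1 + sv k)) *\<^sub>R D2 F y (u k) (u k))"
    unfolding exp scaleR_sum_right by (simp only: sum.swap[of _ Basis "{..n}"])
  finally show ?thesis using minimal_trace[OF y u] by simp
qed

text \<open>Off the origin the density is the constant \<open>W\<close>, so the first equations
  reduce to vanishing divergence of \<open>gi\<close>. In the second ones the product rule leaves
  the trace of \<open>D2 F\<close> against \<open>gi\<close> and the divergence of \<open>gi\<close>
  contracted with \<open>DF\<close>, and both vanish. All fields are bounded, as the removal of the
  vertex requires.\<close>

lemma weak_minimal_surface_system_F: "weak_minimal_surface_system F"
  unfolding weak_minimal_surface_system_def
proof (intro allI impI conjI)
  fix \<phi> :: "real^'a \<Rightarrow> real" assume "test_function \<phi>"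
  then have \<phi>: "smooth_on UNIV \<phi>" "compact (closure {y. \<phi> y \<noteq> 0})" by (auto simp: test_function_def)
  define W where "W = sqrt (\<Prod>k\<le>n. 1 + sv k)"
  have dim: "DIM(real^'a) \<ge> 2" using card_a p_less_n by simp
  {
    fix j
    show "has_bochner_integral lborel
        (\<lambda>y. \<Sum>i\<in>UNIV. graph_area_density F y * matrix_inv (graph_metric F y) $ i $ j * partial_deriv i \<phi> y) 0"
    proof (rule divergence_free_weak_components[where g = "\<lambda>b y. W * gi b (axis j 1) y" and C = "\<bar>W\<bar> * (n + 1)", OF _ _ _ dim \<phi>])
      show "smooth_on (- {0}) (\<lambda>y. W * gi b (axis j 1) y)" for b
        by (intro smooth_intros smooth_gi open_nonzero)
      show "\<bar>W * gi b (axis j 1) y\<bar> \<le> \<bar>W\<bar> * (n + 1)" if "b \<in> Basis" "y \<noteq> 0" for b y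
        unfolding abs_mult using gi_bound[OF that(2), of b "axis j 1"] that(1) by (intro mult_left_mono) auto
      show "(\<Sum>b\<in>Basis. frechet_derivative (\<lambda>y. W * gi b (axis j 1) y) (at y) b) = 0" if "y \<noteq> 0" for y
      proof -
        have "frechet_derivative (\<lambda>y. W * gi b (axis j 1) y) (at y) b = W * frechet_derivative (gi b (axis j 1)) (at y) b" for b
          by (rule frechet_derivative_eqI[OF has_derivative_mult_right[OF smooth_on_has_derivative[OF smooth_gi open_nonzero]]])
            (use that in simp)
        then show ?thesis using divergence_gi[OF that] by (simp add: sum_distrib_left[symmetric])
      qed
      show "(\<Sum>i\<in>UNIV. graph_area_density F y * matrix_inv (graph_metric F y) $ i $ j * partial_deriv i \<phi> y) =
          (\<Sum>b\<in>Basis. W * gi b (axis j 1) y * frechet_derivative \<phi> (at y) b)" if "y \<noteq> 0" for y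
        unfolding sum_Basis_axis using that
        by (simp add: graph_area_density_F inverse_metric_eq partial_deriv_def W_def)
    qed
  }
  {
    fix \<beta>
    let ?w = "axis \<beta> 1 :: real^'b"
    have sm: "smooth_on (- {0}) (\<lambda>y. \<Sum>c\<in>Basis. gi b c y * (DF y c \<bullet> ?w))" for b
      by (intro smooth_intros smooth_gi open_nonzero smooth_on_frechet_derivative smooth_F)
    show "has_bochner_integral lborel
        (\<lambda>y. \<Sum>i\<in>UNIV. \<Sum>j\<in>UNIV. graph_area_density F y * matrix_inv (graph_metric F y) $ i $ j
               * jacobian F (at y) $ \<beta> $ j * partial_deriv i \<phi> y) 0"
    proof (rule divergence_free_weak_components[where g = "\<lambda>b y. W * (\<Sum>c\<in>Basis. gi b c y * (DF y c \<bullet> ?w))"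
          and C = "\<bar>W\<bar> * (real DIM(real^'a) * ((n + 1) * lipschitz_const))", OF _ _ _ dim \<phi>])
      show "smooth_on (- {0}) (\<lambda>y. W * (\<Sum>c\<in>Basis. gi b c y * (DF y c \<bullet> ?w)))" for b
        by (intro smooth_intros sm open_nonzero)
      show "\<bar>W * (\<Sum>c\<in>Basis. gi b c y * (DF y c \<bullet> ?w))\<bar> \<le> \<bar>W\<bar> * (real DIM(real^'a) * ((n + 1) * lipschitz_const))"
        if "b \<in> Basis" "y \<noteq> 0" for b y
        unfolding abs_mult
      proof (rule mult_left_mono)
        have "\<bar>gi b c y * (DF y c \<bullet> ?w)\<bar> \<le> (n + 1) * lipschitz_const" if c: "c \<in> Basis" for c
        proof -
          have "\<bar>DF y c \<bullet> ?w\<bar> \<le> lipschitz_const"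
            using Cauchy_Schwarz_ineq2[of "DF y c" ?w] norm_DF_le[OF \<open>y \<noteq> 0\<close>, of c] c by simp
          then show ?thesis unfolding abs_mult using gi_bound[OF \<open>y \<noteq> 0\<close>, of b c] \<open>b \<in> Basis\<close> c
            by (intro mult_mono) auto
        qed
        then show "\<bar>\<Sum>c\<in>Basis. gi b c y * (DF y c \<bullet> ?w)\<bar> \<le> real DIM(real^'a) * ((n + 1) * lipschitz_const)"
          using sum_norm_bound[of Basis "\<lambda>c. gi b c y * (DF y c \<bullet> ?w)" "(n + 1) * lipschitz_const"] by simp
      qed simp
      show "(\<Sum>b\<in>Basis. frechet_derivative (\<lambda>y. W * (\<Sum>c\<in>Basis. gi b c y * (DF y c \<bullet> ?w))) (at y) b) = 0" if y: "y \<noteq> 0" for y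
      proof -
        have yU: "y \<in> - {0}" using y by simp
        have "frechet_derivative (\<lambda>y. W * (\<Sum>c\<in>Basis. gi b c y * (DF y c \<bullet> ?w))) (at y) b =
          W * (\<Sum>c\<in>Basis. gi b c y * (D2 F y b c \<bullet> ?w) + frechet_derivative (gi b c) (at y) b * (DF y c \<bullet> ?w))" for b
          by (rule frechet_derivative_eqI)
            (intro has_derivative_mult_right has_derivative_sum has_derivative_mult has_derivative_inner_left
              smooth_on_has_derivative[OF smooth_gi open_nonzero yU] D2_has_derivative[OF smooth_F open_nonzero yU])
        then have "(\<Sum>b\<in>Basis. frechet_derivative (\<lambda>y. W * (\<Sum>c\<in>Basis. gi b c y * (DF y c \<bullet> ?w))) (at y) b) =
          W * ((\<Sum>b\<in>Basis. \<Sum>c\<in>Basis. gi b c y *\<^sub>R D2 F y b c) \<bullet> ?w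
            + (\<Sum>c\<in>Basis. (\<Sum>b\<in>Basis. frechet_derivative (gi b c) (at y) b) * (DF y c \<bullet> ?w)))"
          by (simp add: sum.distrib sum_distrib_left[symmetric] inner_sum_left sum_distrib_right)
            (subst sum.swap, simp)
        then show ?thesis using trace_gi_D2F[OF y] divergence_gi[OF y] by simp
      qed
      show "(\<Sum>i\<in>UNIV. \<Sum>j\<in>UNIV. graph_area_density F y * matrix_inv (graph_metric F y) $ i $ j
               * jacobian F (at y) $ \<beta> $ j * partial_deriv i \<phi> y) =
          (\<Sum>b\<in>Basis. W * (\<Sum>c\<in>Basis. gi b c y * (DF y c \<bullet> ?w)) * frechet_derivative \<phi> (at y) b)" if "y \<noteq> 0" for y
        unfolding sum_Basis_axis using that
        by (simp add: graph_area_density_F inverse_metric_eq partial_deriv_def W_def jacobian_F inner_axis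
            sum_distrib_left sum_distrib_right mult_ac)
    qed
  }
qed

lemma entire_minimal_graph_cone: "entire_minimal_graph (lo_cone f \<theta>)"
  unfolding entire_minimal_graph_def lo_cone_eq G_def
  using lipschitz_F smooth_F weak_minimal_surface_system_F by blast

end

theorem corollary2p9:
  fixes f :: "real^'a::finite \<Rightarrow> real^'b::finite" and n m p k :: nat and \<theta> \<alpha> :: real
  assumes "CARD('a) = n + 1" and "CARD('b) = m + 1"
    and "LOMSE_of_type n p k f"
    and "lo_angle f \<theta>"
    and \<alpha>_eq: "\<alpha> = arccos (sqrt ((1 - real p / real n) / (1 - real p / (real k * (real k + real n - 1))))
                 * ((real n - real p) / (real k * (real k + real n - 1) - real p)) powr (real p / 2))"
  shows
    "(0 < \<alpha> \<and> \<alpha> < pi / 2 \<and>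
     cos \<alpha> = sqrt ((1 - real p / real n) / (1 - real p / (real k * (real k + real n - 1))))
               * ((real n - real p) / (real k * (real k + real n - 1) - real p)) powr (real p / 2) \<and>
     (\<forall>e. orthonormal_frame (m + 1) e (Q0 :: ((real^'a) \<times> (real^'b)) set) \<longrightarrow>
        (\<exists>\<nu>. orientation_of (m + 1) (lo_sphere f \<theta>) (sphere_normal_plane (lo_sphere f \<theta>)) \<nu> \<and>
             (\<forall>q\<in>lo_sphere f \<theta>. oriented_angle (m + 1) (\<nu> q) e = \<alpha>)))) \<and>
     (riemannian_volume n (lo_sphere f \<theta>) =
       ennreal ((real k * (real k + real n - 1) / real n) powr (real p / 2)
                * ((1 - real p / real n) / (1 - real p / (real k * (real k + real n - 1))))
                    powr ((real n - real p) / 2))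
       * riemannian_volume n (sphere (0 :: real^'a) 1)) \<and>
     (entire_minimal_graph (lo_cone f \<theta>) \<and>
     (\<exists>J. \<forall>q\<in>lo_cone f \<theta> - {0}. jordan_angles (normal_plane (lo_cone f \<theta>) q) Q0 = J) \<and>
     (\<forall>q\<in>lo_cone f \<theta> - {0}. tangent_jordan_angles (lo_cone f \<theta>) q =
        replicate_mset p (arccos (sqrt ((real n - real p) / (real k * (real k + real n - 1) - real p))))
        + replicate_mset 1
            (arccos (sqrt ((1 - real p / real n) / (1 - real p / (real k * (real k + real n - 1))))))
        + replicate_mset (n - p) 0) \<and>
     (\<forall>q\<in>lo_cone f \<theta> - {0}. slope_function (lo_cone f \<theta>) q = 1 / cos \<alpha>))"
proof -
  interpret lomse_target f n p k \<theta> m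
    by unfold_locales (use assms in auto)
  have \<alpha>: "\<alpha> = arccos cos_alpha" unfolding \<alpha>_eq cos_alpha_eq K_def ..
  have cos: "cos \<alpha> = cos_alpha" unfolding \<alpha> using cos_alpha_bounds by (intro cos_arccos) auto
  have pos: "0 < \<alpha>" "\<alpha> < pi / 2"
  proof -
    show "0 < \<alpha>" unfolding \<alpha> using arccos_less_arccos[of cos_alpha 1] cos_alpha_bounds by simp
    show "\<alpha> < pi / 2" unfolding \<alpha> using arccos_less_arccos[of 0 cos_alpha] cos_alpha_bounds by simp
  qed
  \<comment> \<open>Off the vertex every point of the cone is \<open>G y\<close> with nonzero
    \<open>y\<close>, so the pointwise results apply.\<close>
  have cone: "\<exists>y. y \<noteq> 0 \<and> q = G y" if "q \<in> lo_cone f \<theta> - {0}" for q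
    using that unfolding lo_cone_eq by (auto simp: G_def F_0 zero_prod_def)
  have jordan: "tangent_jordan_angles (lo_cone f \<theta>) q =
        replicate_mset p (arccos (sqrt ((real n - real p) / (K - real p))))
        + replicate_mset 1 (arccos (sqrt ((1 - real p / real n) / (1 - real p / K))))
        + replicate_mset (n - p) 0" if q: "q \<in> lo_cone f \<theta> - {0}" for q
    using cone[OF q] image_tau_mset[of arccos] by (auto simp: lo_cone_eq tangent_jordan_angles_cone)
  have normal: "jordan_angles (normal_plane (lo_cone f \<theta>) q) Q0 = image_mset (\<lambda>i. arccos (\<tau> i)) (mset_set {..m})"
    if q: "q \<in> lo_cone f \<theta> - {0}" for q
    using cone[OF q] by (auto simp: lo_cone_eq normal_plane_cone normal_jordan_angles)
  have slope: "slope_function (lo_cone f \<theta>) q = 1 / cos \<alpha>" if q: "q \<in> lo_cone f \<theta> - {0}" for q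
    using cone[OF q] by (auto simp: lo_cone_eq slope_function_cone cos)
  have cos_eq: "cos \<alpha> = sqrt ((1 - real p / real n) / (1 - real p / (real k * (real k + real n - 1))))
               * ((real n - real p) / (real k * (real k + real n - 1) - real p)) powr (real p / 2)"
    unfolding cos cos_alpha_eq K_def ..
  have angle: "\<forall>e. orthonormal_frame (m + 1) e (Q0 :: ((real^'a) \<times> (real^'b)) set) \<longrightarrow>
        (\<exists>\<nu>. orientation_of (m + 1) (lo_sphere f \<theta>) (sphere_normal_plane (lo_sphere f \<theta>)) \<nu> \<and>
             (\<forall>q\<in>lo_sphere f \<theta>. oriented_angle (m + 1) (\<nu> q) e = \<alpha>))"
    unfolding \<alpha> using normal_planes_angle by blast
  have volume: "riemannian_volume n (lo_sphere f \<theta>) =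
       ennreal ((real k * (real k + real n - 1) / real n) powr (real p / 2)
                * ((1 - real p / real n) / (1 - real p / (real k * (real k + real n - 1))))
                    powr ((real n - real p) / 2))
       * riemannian_volume n (sphere (0 :: real^'a) 1)"
    unfolding volume_lo_sphere volume_ratio_eq K_def ..
  have const: "\<exists>J. \<forall>q\<in>lo_cone f \<theta> - {0}. jordan_angles (normal_plane (lo_cone f \<theta>) q) Q0 = J"
    using normal by blast
  show ?thesis
    by (intro conjI ballI) (rule pos cos_eq angle volume entire_minimal_graph_cone const
        jordan[unfolded K_def] slope | assumption)+
qed

end
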